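(* For each integer $n\ge 0$ let $P^4_n$ denote a stacked $4$-polytope obtained from a $4$-simplex by stacking $n$ times (with any choice of the facets that are stacked). Then, in a suitable geometric realization, $P^4_n$ is truncatable in such a way that $D_1(P^4_n)$ is a rational, $2$-simplicial and $2$-simple $4$-polytope, with $$(f_0,f_1,f_2,f_3;f_{03})(D_1(P^4_n))=(10+4n,\,30+18n,\,30+18n,\,10+4n;\,50+26n).$$ In particular there are infinitely many combinatorially distinct rational $2$-simplicial $2$-simple $4$-polytopes.
   Context: A stacked $d$-polytope is a polytope obtained from a $d$-simplex by repeatedly stacking, i.e. adding a new vertex beyond a facet (glueing a simplex onto a facet) and taking the convex hull; stacking $n$ times gives $n+d+1$ vertices. Let $P$ be a $d$-polytope, $d\ge 3$. A vertex $v$ of $P$ is truncated if $P$ is intersected with a closed half-space that does not contain $v$ but contains all other vertices of $P$ in its interior. $P$ is truncatable if all its vertices can be truncated simultaneously in such a way that from each edge of $P$ exactly one point, lying in the relative interior of the edge, remains; the resulting polytope is denoted $D_1(P)$. A $d$-polytope is $k$-simplicial if all its $k$-dimensional faces are simplices, and $h$-simple if every $(d-h-1)$-dimensional face is contained in exactly $h+1$ facets (equivalently, the interval in the face lattice from the face to the top element is boolean). A polytope is rational if all its vertices have rational coordinates. $f_i$ is the number of $i$-dimensional faces, and $f_{03}$ is the number of pairs (vertex, $3$-face) with the vertex contained in the $3$-face. *)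

theory Defs
  imports "HOL-Analysis.Analysis"
begin

definition d_polytope :: "nat \<Rightarrow> 'a::euclidean_space set \<Rightarrow> bool" where
  "d_polytope d P \<longleftrightarrow> polytope P \<and> aff_dim P = int d"

definition combinatorially_equivalent ::
    "'a::euclidean_space set \<Rightarrow> 'b::euclidean_space set \<Rightarrow> bool" where
  "combinatorially_equivalent P Q \<longleftrightarrow>
     (\<exists>\<phi>. bij_betw \<phi> {F. F face_of P} {G. G face_of Q} \<and>
          (\<forall>F F'. F face_of P \<longrightarrow> F' face_of P \<longrightarrow> (F \<subseteq> F' \<longleftrightarrow> \<phi> F \<subseteq> \<phi> F')))"

text \<open>
  The next two predicates are meant for a facet \<open>F\<close> of \<open>P\<close> and a point \<open>v\<close> of the affine hull
  of \<open>P\<close>; then the side of \<open>v\<close> does not depend on the supporting hyperplane chosen for \<open>F\<close>.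
\<close>

definition beyond :: "'a::euclidean_space set \<Rightarrow> 'a set \<Rightarrow> 'a \<Rightarrow> bool" where
  "beyond P F v \<longleftrightarrow>
     (\<exists>a b. P \<subseteq> {x. a \<bullet> x \<le> b} \<and> F = P \<inter> {x. a \<bullet> x = b} \<and> a \<bullet> v > b)"

definition beneath :: "'a::euclidean_space set \<Rightarrow> 'a set \<Rightarrow> 'a \<Rightarrow> bool" where
  "beneath P F v \<longleftrightarrow>
     (\<exists>a b. P \<subseteq> {x. a \<bullet> x \<le> b} \<and> F = P \<inter> {x. a \<bullet> x = b} \<and> a \<bullet> v < b)"

text \<open>
  The new vertex is beyond the stacked facet and beneath all the others, so that the
  convex hull is \<open>P\<close> with a simplex glued onto that facet.
\<close>

inductive stacked_polytope :: "nat \<Rightarrow> nat \<Rightarrow> 'a::euclidean_space set \<Rightarrow> bool" for d where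
  simplex: "int d simplex P \<Longrightarrow> stacked_polytope d 0 P"
| stack: "\<lbrakk>stacked_polytope d n P; F facet_of P; v \<in> affine hull P; beyond P F v;
           \<And>G. G facet_of P \<Longrightarrow> G \<noteq> F \<Longrightarrow> beneath P G v\<rbrakk>
          \<Longrightarrow> stacked_polytope d (Suc n) (convex hull (insert v P))"

definition closed_halfspace :: "'a::euclidean_space set \<Rightarrow> bool" where
  "closed_halfspace H \<longleftrightarrow> (\<exists>a b. a \<noteq> 0 \<and> H = {x. a \<bullet> x \<le> b})"

definition truncates_vertex :: "'a::euclidean_space set \<Rightarrow> 'a \<Rightarrow> 'a set \<Rightarrow> bool" where
  "truncates_vertex P v H \<longleftrightarrow>
     closed_halfspace H \<and> v \<notin> H \<and>
     (\<forall>w. w extreme_point_of P \<longrightarrow> w \<noteq> v \<longrightarrow> w \<in> interior H)"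

text \<open>
  \<open>D\<^sub>1(P)\<close> depends on the half-spaces \<open>H v\<close> (one for each vertex \<open>v\<close>) used for the simultaneous
  truncation, so these are an argument here.
\<close>

definition D1 :: "'a::euclidean_space set \<Rightarrow> ('a \<Rightarrow> 'a set) \<Rightarrow> 'a set" where
  "D1 P H = P \<inter> (\<Inter>v\<in>{v. v extreme_point_of P}. H v)"

definition truncatable_via :: "'a::euclidean_space set \<Rightarrow> ('a \<Rightarrow> 'a set) \<Rightarrow> bool" where
  "truncatable_via P H \<longleftrightarrow>
     (\<forall>v. v extreme_point_of P \<longrightarrow> truncates_vertex P v (H v)) \<and>
     (\<forall>e. e edge_of P \<longrightarrow> (\<exists>x\<in>rel_interior e. e \<inter> D1 P H = {x}))"

definition simplicial :: "nat \<Rightarrow> 'a::euclidean_space set \<Rightarrow> bool" where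
  "simplicial k P \<longleftrightarrow> (\<forall>F. F face_of P \<longrightarrow> aff_dim F = int k \<longrightarrow> int k simplex F)"

definition simple :: "nat \<Rightarrow> 'a::euclidean_space set \<Rightarrow> bool" where
  "simple h P \<longleftrightarrow>
     (\<forall>F. F face_of P \<longrightarrow> aff_dim F = aff_dim P - int h - 1 \<longrightarrow>
          card {G. G facet_of P \<and> F \<subseteq> G} = h + 1)"

definition rational_polytope :: "(real ^ 'n) set \<Rightarrow> bool" where
  "rational_polytope P \<longleftrightarrow> (\<forall>v. v extreme_point_of P \<longrightarrow> (\<forall>i. v $ i \<in> \<rat>))"

definition face_number :: "nat \<Rightarrow> 'a::euclidean_space set \<Rightarrow> nat" where
  "face_number i P = card {F. F face_of P \<and> aff_dim F = int i}"

definition vertex_face_number :: "nat \<Rightarrow> 'a::euclidean_space set \<Rightarrow> nat" where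
  "vertex_face_number i P =
     card {(v, F). v extreme_point_of P \<and> F face_of P \<and> aff_dim F = int i \<and> v \<in> F}"

definition rational_2s2s_4_polytope :: "(real ^ 4) set \<Rightarrow> bool" where
  "rational_2s2s_4_polytope P \<longleftrightarrow>
     d_polytope 4 P \<and> rational_polytope P \<and> simplicial 2 P \<and> simple 2 P"

end

theory Submission
  imports Defs
begin

text \<open>
  A face of the convex hull of finitely many points is cut out by an affine functional that is
  nonnegative at the points, and it is determined by the set of the points where the functional
  vanishes. So the face lattice is the family of these zero sets (\<open>face_supports\<close>), and all the
  geometry below is about the signs of affine functionals at vertices.

  In these terms, stacking has a purely combinatorial effect (\<open>face_supports_stack\<close>): the stacked
  facet is replaced by the cone over its boundary. Hence every stacked 4-polytope realizes one of the
  inductively defined \<open>stacked_complex\<close>es, and since two polytopes with the same zero sets are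
  combinatorially equivalent, it is enough to realize each such complex once, in a way that suits
  the truncation.

  A simultaneous truncation is a family of functionals \<open>a i\<close>, one for each vertex \<open>q i\<close>,
  with \<open>a i (q i) = -1\<close> and positive values at the other vertices. The cuts at the two ends of
  an edge meet in one point of the edge if and only if \<open>a i (q k) * a k (q i) = 1\<close>, and the cuts at
  the ends of a diagonal are disjoint if the product exceeds \<open>1\<close>. Such a system
  (\<open>truncation_system\<close>) exists by induction (\<open>truncation_system_stack\<close>). The centroid of the six
  truncation points on the edges of the facet to be stacked satisfies all the truncations strictly;
  the new vertex is put just beyond it. The old cuts mark one point on each of the four new edges,
  and these four points span the hyperplane that cuts off the new vertex. If the new vertex is close
  to the facet, so is this hyperplane, and therefore all the other vertices are far on the other
  side of it, measured by the normalized functional. Everything stays rational because the new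
  functional takes rational values at five affinely independent rational points.

  In the truncated polytope, two cuts meet only in the truncation point of an edge
  (\<open>two_tight_functionals\<close>). So its faces are the truncated faces of the old polytope and the
  vertex figures of these (\<open>face_supports_D\<close>): its vertices are the edges of the old polytope, its
  edges are the angles of triangles, its 2-faces are the truncated triangles and the triangles that
  are the vertex figures of tetrahedra, and its facets are the truncated facets and the vertex
  figures of the polytope. The face numbers follow by counting in the complex, where each stacking
  adds one vertex, four edges, six triangles and three facets. Each of its edges lies in one vertex figure
  and in the truncations of the two facets that share its triangle, which is 2-simplicity.
  The number of vertices grows with \<open>n\<close>, so infinitely many combinatorial types occur.
\<close>

section \<open>Affine functionals and the faces of a convex hull\<close>

definition affine_functional :: "('a::euclidean_space \<Rightarrow> real) \<Rightarrow> bool" where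
  "affine_functional f \<longleftrightarrow> (\<exists>a b. f = (\<lambda>x. a \<bullet> x + b))"

lemma affine_functionalI: "affine_functional (\<lambda>x. a \<bullet> x + b)"
  by (auto simp: affine_functional_def)

lemma affine_functional_const: "affine_functional (\<lambda>x. c)"
  using affine_functionalI[of 0 c] by simp

lemma affine_functional_add:
  assumes "affine_functional f" "affine_functional g"
  shows "affine_functional (\<lambda>x. f x + g x)"
proof -
  obtain a b c d where "f = (\<lambda>x. a \<bullet> x + b)" "g = (\<lambda>x. c \<bullet> x + d)"
    using assms by (auto simp: affine_functional_def)
  then have "(\<lambda>x. f x + g x) = (\<lambda>x. (a + c) \<bullet> x + (b + d))"
    by (auto simp: inner_add_left)
  then show ?thesis by (simp add: affine_functionalI)
qed

lemma affine_functional_cmul: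
  assumes "affine_functional f"
  shows "affine_functional (\<lambda>x. c * f x)"
proof -
  obtain a b where "f = (\<lambda>x. a \<bullet> x + b)"
    using assms by (auto simp: affine_functional_def)
  then have "(\<lambda>x. c * f x) = (\<lambda>x. (c *\<^sub>R a) \<bullet> x + c * b)"
    by (auto simp: algebra_simps)
  then show ?thesis by (simp only: affine_functionalI)
qed

lemma affine_functional_sum:
  assumes "\<And>i. i \<in> I \<Longrightarrow> affine_functional (f i)"
  shows "affine_functional (\<lambda>x. \<Sum>i\<in>I. f i x)"
  using assms
  by (induction I rule: infinite_finite_induct)
     (auto intro: affine_functional_const affine_functional_add)

lemma affine_functional_combination:
  assumes "affine_functional f" "finite I" "sum \<beta> I = 1"
  shows "f (\<Sum>i\<in>I. \<beta> i *\<^sub>R p i) = (\<Sum>i\<in>I. \<beta> i * f (p i))"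
proof -
  obtain a b where f: "f = (\<lambda>x. a \<bullet> x + b)"
    using assms by (auto simp: affine_functional_def)
  have "(\<Sum>i\<in>I. \<beta> i * f (p i)) = (\<Sum>i\<in>I. \<beta> i * (a \<bullet> p i)) + (\<Sum>i\<in>I. \<beta> i) * b"
    by (simp add: f algebra_simps sum.distrib sum_distrib_left)
  then show ?thesis
    by (simp add: f assms inner_sum_right)
qed

lemma affine_functional_combination2:
  assumes "affine_functional f" "s + t = 1"
  shows "f (s *\<^sub>R x + t *\<^sub>R y) = s * f x + t * f y"
proof -
  obtain a b where f: "f = (\<lambda>x. a \<bullet> x + b)"
    using assms by (auto simp: affine_functional_def)
  have "b = (s + t) * b" using assms by simp
  then show ?thesis by (simp add: f algebra_simps)
qed

lemma tendsto_affine_functional: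
  assumes "affine_functional f" "(g \<longlongrightarrow> l) F"
  shows "((\<lambda>x. f (g x)) \<longlongrightarrow> f l) F"
proof -
  obtain a b where f: "f = (\<lambda>x. a \<bullet> x + b)"
    using assms by (auto simp: affine_functional_def)
  show ?thesis unfolding f by (intro tendsto_intros assms)
qed

lemma convex_hull_indexed_family:
  assumes "finite I"
  shows "convex hull (p ` I) =
    {y. \<exists>\<beta>. (\<forall>i\<in>I. 0 \<le> \<beta> i) \<and> sum \<beta> I = (1::real) \<and> y = (\<Sum>i\<in>I. \<beta> i *\<^sub>R p i)}"
    (is "_ = ?C")
proof
  have "convex ?C"
  proof (rule convexI, clarsimp)
    fix u v :: real and \<beta> \<gamma> :: "_ \<Rightarrow> real"
    assume "0 \<le> u" "0 \<le> v" "u + v = 1" "\<forall>i\<in>I. 0 \<le> \<beta> i" "sum \<beta> I = 1"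
      "\<forall>i\<in>I. 0 \<le> \<gamma> i" "sum \<gamma> I = 1"
    then show "\<exists>\<delta>. (\<forall>i\<in>I. 0 \<le> \<delta> i) \<and> sum \<delta> I = 1 \<and>
        u *\<^sub>R (\<Sum>i\<in>I. \<beta> i *\<^sub>R p i) + v *\<^sub>R (\<Sum>i\<in>I. \<gamma> i *\<^sub>R p i) = (\<Sum>i\<in>I. \<delta> i *\<^sub>R p i)"
      by (intro exI[of _ "\<lambda>i. u * \<beta> i + v * \<gamma> i"])
         (auto simp: sum.distrib sum_distrib_left[symmetric] scaleR_add_left scaleR_sum_right)
  qed
  moreover have "p ` I \<subseteq> ?C"
  proof clarify
    fix j assume "j \<in> I"
    have "(\<Sum>i\<in>I. (if i = j then 1 else 0::real) *\<^sub>R p i) = p j"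
      using assms \<open>j \<in> I\<close> by (simp add: if_distrib[of "\<lambda>c. c *\<^sub>R _"] sum.delta cong: if_cong)
    then show "\<exists>\<beta>. (\<forall>i\<in>I. 0 \<le> \<beta> i) \<and> sum \<beta> I = (1::real) \<and> p j = (\<Sum>i\<in>I. \<beta> i *\<^sub>R p i)"
      using assms \<open>j \<in> I\<close> by (intro exI[of _ "\<lambda>i. if i = j then 1 else 0"]) auto
  qed
  ultimately show "convex hull (p ` I) \<subseteq> ?C"
    by (intro hull_minimal)
  show "?C \<subseteq> convex hull (p ` I)"
  proof clarify
    fix \<beta> :: "_ \<Rightarrow> real" assume "\<forall>i\<in>I. 0 \<le> \<beta> i" "sum \<beta> I = 1"
    then show "(\<Sum>i\<in>I. \<beta> i *\<^sub>R p i) \<in> convex hull (p ` I)"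
      using assms by (intro convex_sum) (auto intro: hull_inc)
  qed
qed

text \<open>
  The sets of indices of the points on a face of the convex hull of a family \<open>p\<close>. A face is cut
  out by an affine functional that is nonnegative on the family, and only the zeros of the functional
  matter. The zero functional yields \<open>I\<close> itself and a positive constant yields \<open>{}\<close>, so that the
  improper face and the empty face are included.
\<close>

definition face_supports :: "('i \<Rightarrow> 'a::euclidean_space) \<Rightarrow> 'i set \<Rightarrow> 'i set set" where
  "face_supports p I =
     {S. \<exists>f. affine_functional f \<and> (\<forall>i\<in>I. 0 \<le> f (p i)) \<and> S = {i\<in>I. f (p i) = 0}}"

lemma face_supportsI:
  assumes "affine_functional f" "\<And>i. i \<in> I \<Longrightarrow> 0 \<le> f (p i)"
    "\<And>i. i \<in> I \<Longrightarrow> f (p i) = 0 \<longleftrightarrow> i \<in> S" "S \<subseteq> I"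
  shows "S \<in> face_supports p I"
  using assms by (auto simp: face_supports_def intro!: exI[of _ f])

lemma face_supportsE:
  assumes "S \<in> face_supports p I"
  obtains f where "affine_functional f" "\<And>i. i \<in> I \<Longrightarrow> 0 \<le> f (p i)"
    "\<And>i. i \<in> I \<Longrightarrow> f (p i) = 0 \<longleftrightarrow> i \<in> S" "\<And>i. i \<in> S \<Longrightarrow> f (p i) = 0"
  using assms by (auto simp: face_supports_def)

lemma face_supports_subset: "S \<in> face_supports p I \<Longrightarrow> S \<subseteq> I"
  by (auto simp: face_supports_def)

text \<open>
  In a convex combination of nonnegative values that sums up to zero, all the weights off the zero
  set vanish.
\<close>

lemma convex_hull_zero_set:
  assumes "finite I" "affine_functional f" "\<And>i. i \<in> I \<Longrightarrow> 0 \<le> f (p i)"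
  shows "convex hull (p ` I) \<inter> {x. f x = 0} = convex hull (p ` {i\<in>I. f (p i) = 0})"
    (is "?L = convex hull (p ` ?Z)")
proof
  show "?L \<subseteq> convex hull (p ` ?Z)"
  proof
    fix x assume "x \<in> ?L"
    then obtain \<beta> where \<beta>: "\<forall>i\<in>I. 0 \<le> \<beta> i" "sum \<beta> I = 1" "x = (\<Sum>i\<in>I. \<beta> i *\<^sub>R p i)" "f x = 0"
      using convex_hull_indexed_family[OF assms(1), of p] by auto
    have "(\<Sum>i\<in>I. \<beta> i * f (p i)) = 0"
      using affine_functional_combination[OF assms(2,1) \<beta>(2)] \<beta> by simp
    then have z: "\<forall>i\<in>I. \<beta> i * f (p i) = 0"
      using assms \<beta>(1) by (subst (asm) sum_nonneg_eq_0_iff) auto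
    then have b0: "\<beta> i = 0" if "i \<in> I - ?Z" for i
      using that by auto
    have "sum \<beta> ?Z = sum \<beta> I"
      using b0 assms(1) by (intro sum.mono_neutral_left) auto
    moreover have "(\<Sum>i\<in>?Z. \<beta> i *\<^sub>R p i) = (\<Sum>i\<in>I. \<beta> i *\<^sub>R p i)"
      using b0 assms(1) by (intro sum.mono_neutral_left) auto
    ultimately have "sum \<beta> ?Z = 1" "x = (\<Sum>i\<in>?Z. \<beta> i *\<^sub>R p i)"
      using \<beta>(2,3) by simp_all
    then show "x \<in> convex hull (p ` ?Z)"
      using convex_hull_indexed_family[of ?Z p] assms(1) \<beta>(1) by auto
  qed
  have "convex hull (p ` ?Z) \<subseteq> convex hull (p ` I)"
    by (intro hull_mono) auto
  moreover have "f x = 0" if x: "x \<in> convex hull (p ` ?Z)" for x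
  proof -
    have "finite ?Z" using assms by simp
    then obtain \<beta> where \<beta>: "sum \<beta> ?Z = 1" "x = (\<Sum>i\<in>?Z. \<beta> i *\<^sub>R p i)"
      using x convex_hull_indexed_family[of ?Z p] by auto
    have "f x = (\<Sum>i\<in>?Z. \<beta> i * f (p i))"
      unfolding \<beta>(2) by (rule affine_functional_combination[OF assms(2) \<open>finite ?Z\<close> \<beta>(1)])
    also have "\<dots> = 0" by (intro sum.neutral) auto
    finally show ?thesis .
  qed
  ultimately show "convex hull (p ` ?Z) \<subseteq> ?L" by blast
qed

lemma affine_functional_nonneg_on_hull:
  assumes "affine_functional f" "\<And>x. x \<in> S \<Longrightarrow> 0 \<le> f x" "x \<in> convex hull S"
  shows "0 \<le> f x"
proof -
  obtain a b where f: "f = (\<lambda>x. a \<bullet> x + b)"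
    using assms by (auto simp: affine_functional_def)
  have "convex {x. 0 \<le> f x}"
  proof -
    have "{x. 0 \<le> f x} = {x. a \<bullet> x \<ge> - b}" by (auto simp: f)
    then show ?thesis by (metis convex_halfspace_ge)
  qed
  then have "convex hull S \<subseteq> {x. 0 \<le> f x}"
    using assms(2) by (intro hull_minimal) auto
  then show ?thesis using assms(3) by auto
qed

lemma affine_functional_pos_on_hull:
  assumes "affine_functional f" "\<And>x. x \<in> S \<Longrightarrow> 0 < f x" "x \<in> convex hull S"
  shows "0 < f x"
proof -
  obtain a b where f: "f = (\<lambda>x. a \<bullet> x + b)"
    using assms by (auto simp: affine_functional_def)
  have "{x. 0 < f x} = {x. a \<bullet> x > - b}" by (auto simp: f)
  then have "convex {x. 0 < f x}"
    by (metis convex_halfspace_gt)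
  then have "convex hull S \<subseteq> {x. 0 < f x}"
    using assms(2) by (intro hull_minimal) auto
  then show ?thesis using assms(3) by auto
qed

lemma face_of_zero_set:
  assumes "convex D" "affine_functional f" "\<And>x. x \<in> D \<Longrightarrow> 0 \<le> f x"
  shows "D \<inter> {x. f x = 0} face_of D"
proof -
  obtain a b where f: "f = (\<lambda>x. a \<bullet> x + b)"
    using assms by (auto simp: affine_functional_def)
  have "a \<bullet> x \<ge> - b" if "x \<in> D" for x
    using assms(3)[OF that] by (simp add: f)
  then have "D \<inter> {x. a \<bullet> x = -b} face_of D"
    using assms(1) by (intro face_of_Int_supporting_hyperplane_ge) auto
  also have "{x. a \<bullet> x = -b} = {x. f x = 0}"
    by (auto simp: f)
  finally show ?thesis .
qed

text \<open>
  Every face of a polytope is exposed; this turns questions about faces into questions about the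
  signs of affine functionals at finitely many points.
\<close>

lemma faces_of_convex_hull:
  assumes "finite I"
  shows "{F. F face_of convex hull (p ` I)} = (\<lambda>S. convex hull (p ` S)) ` face_supports p I"
proof (intro subset_antisym subsetI)
  fix F assume "F \<in> {F. F face_of convex hull (p ` I)}"
  then have "F exposed_face_of convex hull (p ` I)"
    using assms by (simp add: exposed_face_of_polyhedron polyhedron_convex_hull)
  then obtain a b where ab: "convex hull (p ` I) \<subseteq> {x. a \<bullet> x \<le> b}"
      "F = convex hull (p ` I) \<inter> {x. a \<bullet> x = b}"
    by (auto simp: exposed_face_of_def)
  define f where "f = (\<lambda>x. (-a) \<bullet> x + b)"
  have f: "affine_functional f" unfolding f_def by (rule affine_functionalI)
  have nonneg: "0 \<le> f (p i)" if "i \<in> I" for i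
    using that ab(1) hull_inc[of "p i" "p ` I" convex] by (auto simp: f_def)
  have "F = convex hull (p ` {i\<in>I. f (p i) = 0})"
  proof -
    have "{x. a \<bullet> x = b} = {x. f x = 0}" by (auto simp: f_def)
    then show ?thesis
      using convex_hull_zero_set[OF assms f, of p] nonneg by (simp add: ab(2))
  qed
  moreover have "{i\<in>I. f (p i) = 0} \<in> face_supports p I"
    using f nonneg by (intro face_supportsI[of f]) auto
  ultimately show "F \<in> (\<lambda>S. convex hull (p ` S)) ` face_supports p I"
    by blast
next
  fix F assume "F \<in> (\<lambda>S. convex hull (p ` S)) ` face_supports p I"
  then obtain S where S: "S \<in> face_supports p I" "F = convex hull (p ` S)" by auto
  then obtain f where f: "affine_functional f" "\<forall>i\<in>I. 0 \<le> f (p i)" "S = {i\<in>I. f (p i) = 0}"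
    by (auto simp: face_supports_def)
  have "convex hull (p ` I) \<inter> {x. f x = 0} face_of convex hull (p ` I)"
    using f by (intro face_of_zero_set) (auto intro: affine_functional_nonneg_on_hull[OF f(1), of "p ` I"])
  then show "F \<in> {F. F face_of convex hull (p ` I)}"
    using convex_hull_zero_set[OF assms f(1), of p] f S by simp
qed

lemma face_supports_imp_face:
  assumes "finite I" "S \<in> face_supports p I"
  shows "convex hull (p ` S) face_of convex hull (p ` I)"
proof -
  have "convex hull (p ` S) \<in> {F. F face_of convex hull (p ` I)}"
    unfolding faces_of_convex_hull[OF assms(1)] using assms(2) by (rule imageI)
  then show ?thesis by simp
qed

lemma face_support_functional:
  assumes "finite I" "S \<in> face_supports p I" "x \<in> convex hull (p ` I)"
  obtains f where "affine_functional f" "\<And>i. i \<in> I \<Longrightarrow> 0 \<le> f (p i)"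
    "\<And>i. i \<in> I \<Longrightarrow> f (p i) = 0 \<longleftrightarrow> i \<in> S" "x \<in> convex hull (p ` S) \<longleftrightarrow> f x = 0"
proof -
  obtain f where f: "affine_functional f" "\<forall>i\<in>I. 0 \<le> f (p i)" "S = {i\<in>I. f (p i) = 0}"
    using assms by (auto simp: face_supports_def)
  have "x \<in> convex hull (p ` S) \<longleftrightarrow> f x = 0"
    using convex_hull_zero_set[OF assms(1) f(1), of p] f assms(3) by auto
  then show ?thesis using f by (intro that[of f]) auto
qed

text \<open>
  A face contains no further points of the family. Hence supports and faces determine each other,
  and inclusion of faces is inclusion of supports.
\<close>

lemma point_in_face_iff:
  assumes "finite I" "S \<in> face_supports p I" "i \<in> I"
  shows "p i \<in> convex hull (p ` S) \<longleftrightarrow> i \<in> S"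
proof -
  have "p i \<in> convex hull (p ` I)" using assms by (intro hull_inc) auto
  then show ?thesis
    by (rule face_support_functional[OF assms(1,2)]) (simp add: assms(3))
qed

lemma face_subset_iff:
  assumes "finite I" "S \<in> face_supports p I" "S' \<in> face_supports p I"
  shows "convex hull (p ` S) \<subseteq> convex hull (p ` S') \<longleftrightarrow> S \<subseteq> S'"
proof
  assume *: "convex hull (p ` S) \<subseteq> convex hull (p ` S')"
  show "S \<subseteq> S'"
  proof
    fix i assume i: "i \<in> S"
    then have "p i \<in> convex hull (p ` S')" using * hull_inc[of "p i" "p ` S" convex] by blast
    then show "i \<in> S'"
      using point_in_face_iff[OF assms(1,3)] face_supports_subset[OF assms(2)] i by blast
  qed
qed (intro hull_mono image_mono)

lemma inj_on_face_hull:
  assumes "finite I"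
  shows "inj_on (\<lambda>S. convex hull (p ` S)) (face_supports p I)"
proof (rule inj_onI)
  fix S S' assume S: "S \<in> face_supports p I" "S' \<in> face_supports p I"
    "convex hull (p ` S) = convex hull (p ` S')"
  then show "S = S'"
    using face_subset_iff[OF assms S(1,2)] face_subset_iff[OF assms S(2,1)] by simp
qed

text \<open>
  Dimensions are computed from chains of supports with this lemma: a chain bounds the dimension of
  its members from below, and the number of points bounds it from above.
\<close>

lemma aff_dim_face_strict_mono:
  assumes "finite I" "S \<in> face_supports p I" "S' \<in> face_supports p I" "S \<subset> S'"
  shows "aff_dim (p ` S) < aff_dim (p ` S')"
proof -
  have "convex hull (p ` S) face_of convex hull (p ` S')"
  proof (rule face_of_subset)
    show "convex hull (p ` S) face_of convex hull (p ` I)"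
      by (rule face_supports_imp_face[OF assms(1,2)])
    show "convex hull (p ` S) \<subseteq> convex hull (p ` S')"
      using assms(4) by (intro hull_mono image_mono) auto
    show "convex hull (p ` S') \<subseteq> convex hull (p ` I)"
      using face_supports_subset[OF assms(3)] by (intro hull_mono image_mono)
  qed
  moreover have "convex hull (p ` S) \<noteq> convex hull (p ` S')"
    using face_subset_iff[OF assms(1,3,2)] assms(4) by auto
  ultimately have "aff_dim (convex hull (p ` S)) < aff_dim (convex hull (p ` S'))"
    by (intro face_of_aff_dim_lt) auto
  then show ?thesis by (simp add: aff_dim_convex_hull)
qed

text \<open>
  The face lattice is isomorphic to the set of supports, ordered by inclusion.
\<close>

lemma combinatorially_equivalent_same_supports:
  assumes "finite I" "face_supports p I = face_supports q I"
  shows "combinatorially_equivalent (convex hull (p ` I)) (convex hull (q ` I))"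
proof -
  let ?A = "\<lambda>S. convex hull (p ` S)" and ?B = "\<lambda>S. convex hull (q ` S)"
  let ?\<S> = "face_supports p I"
  define \<phi> where "\<phi> = (\<lambda>F. ?B (the_inv_into ?\<S> ?A F))"
  have \<phi>: "\<phi> (?A S) = ?B S" if "S \<in> ?\<S>" for S
    unfolding \<phi>_def using the_inv_into_f_f[OF inj_on_face_hull[OF assms(1)] that] by simp
  have sub: "?A S \<subseteq> ?A S' \<longleftrightarrow> \<phi> (?A S) \<subseteq> \<phi> (?A S')" if "S \<in> ?\<S>" "S' \<in> ?\<S>" for S S'
    using face_subset_iff[OF assms(1) that] face_subset_iff[of I S q S'] that \<phi> assms by simp
  have im: "\<phi> ` (?A ` ?\<S>) = ?B ` ?\<S>"
    using \<phi> by (auto simp: image_iff)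
  have "inj_on \<phi> (?A ` ?\<S>)"
  proof (rule inj_onI, clarify)
    fix S S' assume S: "S \<in> ?\<S>" "S' \<in> ?\<S>" "\<phi> (?A S) = \<phi> (?A S')"
    then have "?A S \<subseteq> ?A S'" "?A S' \<subseteq> ?A S"
      using sub by simp_all
    then show "?A S = ?A S'" by blast
  qed
  then have "bij_betw \<phi> (?A ` ?\<S>) (?B ` ?\<S>)"
    using im by (simp add: bij_betw_def)
  moreover have "{F. F face_of convex hull (p ` I)} = ?A ` ?\<S>"
    "{F. F face_of convex hull (q ` I)} = ?B ` ?\<S>"
    using faces_of_convex_hull[OF assms(1), of p] faces_of_convex_hull[OF assms(1), of q]
      assms(2) by simp_all
  ultimately show ?thesis
    unfolding combinatorially_equivalent_def using sub
  proof (intro exI[of _ \<phi>] conjI allI impI)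
    fix F F' assume "F face_of convex hull (p ` I)" "F' face_of convex hull (p ` I)"
    then have "F \<in> ?A ` ?\<S>" "F' \<in> ?A ` ?\<S>"
      using faces_of_convex_hull[OF assms(1), of p] by blast+
    then show "F \<subseteq> F' \<longleftrightarrow> \<phi> F \<subseteq> \<phi> F'"
      using sub by blast
  qed simp
qed

lemma affine_functional_eq_0:
  fixes f :: "'a::euclidean_space \<Rightarrow> real"
  assumes "affine_functional f" "\<And>x. x \<in> S \<Longrightarrow> f x = 0" "aff_dim S = int DIM('a)"
  shows "f x = 0"
proof -
  obtain a b where f: "f = (\<lambda>x. a \<bullet> x + b)"
    using assms by (auto simp: affine_functional_def)
  have "{x. f x = 0} = {x. a \<bullet> x = - b}" by (auto simp: f)
  then have "affine {x. f x = 0}" by (simp add: affine_hyperplane)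
  then have "affine hull S \<subseteq> {x. f x = 0}"
    using assms(2) by (intro hull_minimal) auto
  moreover have "affine hull S = UNIV" using assms(3) aff_dim_eq_full by metis
  ultimately show ?thesis by blast
qed

lemma aff_dim_image_le_card:
  assumes "finite S" shows "aff_dim (p ` S) \<le> int (card S) - 1"
proof -
  have "aff_dim (p ` S) \<le> int (card (p ` S)) - 1"
    by (rule aff_dim_le_card[OF finite_imageI[OF assms]])
  then show ?thesis using card_image_le[OF assms, of p] by simp
qed

text \<open>
  If all subsets of \<open>T\<close> are supports, then adding the points of \<open>T\<close> one by one raises the dimension
  in each step.
\<close>

lemma aff_dim_simplex_support:
  assumes "finite I" "\<And>S. S \<subseteq> T \<Longrightarrow> S \<in> face_supports p I"
  shows "aff_dim (p ` T) = int (card T) - 1"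
proof -
  have "T \<in> face_supports p I" by (simp add: assms(2))
  then have fin: "finite T" using assms(1) face_supports_subset finite_subset by metis
  have "aff_dim (p ` T) \<ge> int (card T) - 1"
    using fin assms(2)
  proof (induction T rule: finite_induct)
    case empty
    then show ?case by simp
  next
    case (insert i T)
    have "T \<in> face_supports p I" "insert i T \<in> face_supports p I" "T \<subset> insert i T"
      using insert.hyps(2) by (auto intro!: insert.prems)
    then have "aff_dim (p ` T) < aff_dim (p ` insert i T)"
      by (intro aff_dim_face_strict_mono[OF assms(1)])
    moreover have "int (card T) - 1 \<le> aff_dim (p ` T)"
      by (rule insert.IH) (rule insert.prems, simp add: subset_insertI2)
    ultimately show ?case using insert.hyps by simp
  qed
  then show ?thesis
    using aff_dim_image_le_card[OF fin, of p] by simp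
qed

lemma aff_dim_simplex_insert:
  assumes "finite I" "\<And>S. S \<subseteq> T \<Longrightarrow> S \<in> face_supports p I" "i \<in> I - T"
  shows "aff_dim (p ` insert i T) = int (card T)"
proof -
  have "T \<in> face_supports p I" by (simp add: assms(2))
  then obtain f where f: "affine_functional f" "\<And>k. k \<in> I \<Longrightarrow> f (p k) = 0 \<longleftrightarrow> k \<in> T"
    using face_supportsE by metis
  obtain a b where ab: "f = (\<lambda>x. a \<bullet> x + b)"
    using f by (auto simp: affine_functional_def)
  have "{x. f x = 0} = {x. a \<bullet> x = - b}" by (auto simp: ab)
  then have "affine {x. f x = 0}" by (simp add: affine_hyperplane)
  moreover have "T \<subseteq> I" using \<open>T \<in> face_supports p I\<close> face_supports_subset by blast
  ultimately have "affine hull (p ` T) \<subseteq> {x. f x = 0}"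
    using f(2) by (intro hull_minimal) auto
  then have "p i \<notin> affine hull (p ` T)"
    using f(2) assms(3) by auto
  then show ?thesis
    using aff_dim_simplex_support[OF assms(1,2)] by (simp add: aff_dim_insert)
qed

text \<open>
  The points of \<open>T\<close> span a hyperplane that does not contain \<open>p i\<close>, so a functional that vanishes
  on \<open>T\<close> is determined by its value at \<open>p i\<close>.
\<close>

lemma affine_functional_multiple:
  fixes p :: "'i \<Rightarrow> 'a::euclidean_space"
  assumes "finite I" "\<And>S. S \<subseteq> T \<Longrightarrow> S \<in> face_supports p I" "card T = DIM('a)"
    "affine_functional f" "\<And>i. i \<in> T \<Longrightarrow> f (p i) = 0"
    "affine_functional g" "\<And>i. i \<in> I \<Longrightarrow> g (p i) = 0 \<longleftrightarrow> i \<in> T" "i \<in> I - T"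
  shows "f x = f (p i) / g (p i) * g x"
proof -
  define h where "h = (\<lambda>x. f x + (- (f (p i) / g (p i))) * g x)"
  have "T \<in> face_supports p I" by (simp add: assms(2))
  then have TI: "T \<subseteq> I" by (rule face_supports_subset)
  have h: "affine_functional h"
    unfolding h_def by (intro affine_functional_add affine_functional_cmul assms(4,6))
  have "g (p i) \<noteq> 0" using assms(7,8) by auto
  then have "h y = 0" if "y \<in> p ` insert i T" for y
    using that assms(5,7) \<open>g (p i) \<noteq> 0\<close> TI by (auto simp: h_def)
  then have "h x = 0"
    using affine_functional_eq_0[OF h, of "p ` insert i T"]
      aff_dim_simplex_insert[OF assms(1,2,8)] assms(3) by simp
  then show ?thesis by (simp add: h_def)
qed

section \<open>Stacking on the level of vertex sets\<close>

text \<open>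
  A simplicial complex is given by the family of its facets.
\<close>

definition simplices :: "'i set set \<Rightarrow> 'i set set" where
  "simplices \<F> = {S. \<exists>T\<in>\<F>. S \<subseteq> T}"

text \<open>
  The facet \<open>T\<close> is replaced by the cone over its boundary with the new vertex \<open>v\<close> as the apex.
\<close>

definition stack_facet :: "'i \<Rightarrow> 'i set \<Rightarrow> 'i set set \<Rightarrow> 'i set set" where
  "stack_facet v T \<F> = (\<F> - {T}) \<union> (\<lambda>i. insert v (T - {i})) ` T"

lemma simplices_mono: "S \<in> simplices \<F> \<Longrightarrow> R \<subseteq> S \<Longrightarrow> R \<in> simplices \<F>"
  by (auto simp: simplices_def)

lemma simplices_facet: "T \<in> \<F> \<Longrightarrow> T \<in> simplices \<F>"
  by (auto simp: simplices_def)

text \<open>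
  Each ridge of a facet lies in a second facet, as in the boundary of a simplicial polytope.
\<close>

definition ridge_closed :: "'i set set \<Rightarrow> bool" where
  "ridge_closed \<F> \<longleftrightarrow> (\<forall>T\<in>\<F>. \<forall>i\<in>T. \<exists>G\<in>\<F>. G \<noteq> T \<and> G \<inter> T = T - {i})"

lemma ridge_closedE:
  assumes "ridge_closed \<F>" "T \<in> \<F>" "i \<in> T"
  obtains G where "G \<in> \<F>" "G \<noteq> T" "G \<inter> T = T - {i}"
  using assms unfolding ridge_closed_def by blast

text \<open>
  The proper subsets of \<open>T\<close> survive the removal of \<open>T\<close> because the facets across the ridges
  of \<open>T\<close> contain them.
\<close>

lemma simplices_stack_facet:
  assumes "T \<in> \<F>" "T \<noteq> {}" "\<And>G. G \<in> \<F> \<Longrightarrow> T \<subseteq> G \<Longrightarrow> G = T" "ridge_closed \<F>"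
    "\<And>G. G \<in> \<F> \<Longrightarrow> v \<notin> G"
  shows "simplices (stack_facet v T \<F>) = (simplices \<F> - {T}) \<union> insert v ` {S. S \<subset> T}"
proof (intro subset_antisym subsetI)
  fix S assume "S \<in> simplices (stack_facet v T \<F>)"
  then consider G where "G \<in> \<F>" "G \<noteq> T" "S \<subseteq> G"
    | i where "i \<in> T" "S \<subseteq> insert v (T - {i})"
    by (auto simp: simplices_def stack_facet_def)
  then show "S \<in> (simplices \<F> - {T}) \<union> insert v ` {S. S \<subset> T}"
  proof cases
    case 1
    then have "S \<noteq> T" using assms(3) by blast
    then show ?thesis using 1 by (auto simp: simplices_def)
  next
    case 2
    show ?thesis
    proof (cases "v \<in> S")
      case True
      then have "S = insert v (S - {v})" "S - {v} \<subset> T" using 2 by auto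
      then show ?thesis by blast
    next
      case False
      then have "S \<subset> T" using 2 by blast
      then show ?thesis using assms(1) by (auto simp: simplices_def)
    qed
  qed
next
  fix S assume "S \<in> (simplices \<F> - {T}) \<union> insert v ` {S. S \<subset> T}"
  then consider G where "G \<in> \<F>" "S \<subseteq> G" "S \<noteq> T" | R where "R \<subset> T" "S = insert v R"
    by (auto simp: simplices_def)
  then show "S \<in> simplices (stack_facet v T \<F>)"
  proof cases
    case 1
    show ?thesis
    proof (cases "G = T")
      case True
      then obtain i where i: "i \<in> T" "S \<subseteq> T - {i}" using 1 by blast
      then obtain G' where "G' \<in> \<F>" "G' \<noteq> T" "G' \<inter> T = T - {i}"
        using ridge_closedE[OF assms(4,1)] by blast
      then have "G' \<in> stack_facet v T \<F>" "S \<subseteq> G'" using i by (auto simp: stack_facet_def)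
      then show ?thesis by (auto simp: simplices_def)
    next
      case False
      then show ?thesis using 1 by (auto simp: simplices_def stack_facet_def)
    qed
  next
    case 2
    then obtain i where i: "i \<in> T" "R \<subseteq> T - {i}" by blast
    then have "insert v (T - {i}) \<in> stack_facet v T \<F>" "S \<subseteq> insert v (T - {i})"
      using 2 by (auto simp: stack_facet_def)
    then show ?thesis by (auto simp: simplices_def)
  qed
qed

text \<open>
  The functional \<open>h G\<close> cuts out the facet \<open>G\<close>. Its sign at \<open>p v\<close> tells that the new point lies
  beyond \<open>T\<close> and beneath all the other facets.
\<close>

locale stacking =
  fixes p :: "'i \<Rightarrow> 'a::euclidean_space" and I :: "'i set" and \<F> :: "'i set set"
    and T :: "'i set" and v :: 'i and h :: "'i set \<Rightarrow> 'a \<Rightarrow> real"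
  assumes finite_I: "finite I"
    and supports: "face_supports p I = insert I (simplices \<F>)"
    and facet: "T \<in> \<F>" and I_not_simplex: "I \<notin> simplices \<F>"
    and antichain: "\<And>G. G \<in> \<F> \<Longrightarrow> T \<subseteq> G \<Longrightarrow> G = T"
    and ridges: "ridge_closed \<F>"
    and card_T: "card T = DIM('a)"
    and new: "v \<notin> I"
    and h_affine: "\<And>G. G \<in> \<F> \<Longrightarrow> affine_functional (h G)"
    and h_nonneg: "\<And>G i. G \<in> \<F> \<Longrightarrow> i \<in> I \<Longrightarrow> 0 \<le> h G (p i)"
    and h_zero: "\<And>G i. G \<in> \<F> \<Longrightarrow> i \<in> I \<Longrightarrow> h G (p i) = 0 \<longleftrightarrow> i \<in> G"
    and h_beyond: "h T (p v) < 0"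
    and h_beneath: "\<And>G. G \<in> \<F> \<Longrightarrow> G \<noteq> T \<Longrightarrow> 0 < h G (p v)"
begin

lemma facet_subset: "G \<in> \<F> \<Longrightarrow> G \<subset> I"
  using supports face_supports_subset[of G p I] I_not_simplex simplices_facet[of G \<F>] by auto

lemma simplex_in_other_facet:
  assumes "S \<in> simplices \<F>" "S \<noteq> T"
  obtains G where "G \<in> \<F>" "G \<noteq> T" "S \<subseteq> G"
proof -
  obtain G where G: "G \<in> \<F>" "S \<subseteq> G" using assms by (auto simp: simplices_def)
  show ?thesis
  proof (cases "G = T")
    case True
    then obtain i where i: "i \<in> T" "S \<subseteq> T - {i}" using G assms by blast
    then obtain G' where "G' \<in> \<F>" "G' \<noteq> T" "G' \<inter> T = T - {i}"
      using ridge_closedE[OF ridges facet] by blast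
    then show ?thesis using i that by blast
  qed (use G that in blast)
qed

lemma simplex_functional:
  assumes "S \<in> simplices \<F>"
  obtains f where "affine_functional f" "\<And>i. i \<in> I \<Longrightarrow> 0 \<le> f (p i)"
    "\<And>i. i \<in> I \<Longrightarrow> f (p i) = 0 \<longleftrightarrow> i \<in> S"
  using face_supportsE[of S p I] assms supports by (metis insertI2)

text \<open>
  A functional that cuts out \<open>S\<close> may be negative at the new vertex. Adding a large multiple of
  \<open>h G\<close>, for a facet \<open>G \<noteq> T\<close> that contains \<open>S\<close>, makes it positive there and does not change the
  zeros among the old vertices.
\<close>

lemma simplex_functional_beneath:
  assumes "S \<in> simplices \<F>" "S \<noteq> T"
  obtains f where "affine_functional f" "\<And>i. i \<in> I \<Longrightarrow> 0 \<le> f (p i)"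
    "\<And>i. i \<in> I \<Longrightarrow> f (p i) = 0 \<longleftrightarrow> i \<in> S" "0 < f (p v)"
proof -
  obtain G where G: "G \<in> \<F>" "G \<noteq> T" "S \<subseteq> G" using simplex_in_other_facet assms by metis
  obtain g where g: "affine_functional g" "\<And>i. i \<in> I \<Longrightarrow> 0 \<le> g (p i)"
    "\<And>i. i \<in> I \<Longrightarrow> g (p i) = 0 \<longleftrightarrow> i \<in> S"
    using simplex_functional[OF assms(1)] by metis
  \<comment> \<open>large enough to make the sum positive at the new vertex\<close>
  define K where "K = (\<bar>g (p v)\<bar> + 1) / h G (p v)"
  have hv: "0 < h G (p v)" using h_beneath G by blast
  have "0 < K" using hv by (simp add: K_def)
  have "K * h G (p v) = \<bar>g (p v)\<bar> + 1" using hv by (simp add: K_def)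
  show ?thesis
  proof (rule that[of "\<lambda>x. g x + K * h G x"])
    show "affine_functional (\<lambda>x. g x + K * h G x)"
      by (intro affine_functional_add affine_functional_cmul g h_affine G)
    show "0 \<le> g (p i) + K * h G (p i)" if "i \<in> I" for i
      using g(2)[OF that] h_nonneg[OF G(1) that] \<open>0 < K\<close> by simp
    show "g (p i) + K * h G (p i) = 0 \<longleftrightarrow> i \<in> S" if "i \<in> I" for i
    proof
      assume "g (p i) + K * h G (p i) = 0"
      moreover have "0 \<le> K * h G (p i)" using h_nonneg[OF G(1) that] \<open>0 < K\<close> by simp
      ultimately have "g (p i) = 0" using g(2)[OF that] by linarith
      then show "i \<in> S" using g(3) that by blast
    next
      assume "i \<in> S"
      then show "g (p i) + K * h G (p i) = 0"
        using g(3)[OF that] h_zero[OF G(1) that] G(3) by auto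
    qed
    show "0 < g (p v) + K * h G (p v)"
      using \<open>K * h G (p v) = \<bar>g (p v)\<bar> + 1\<close> by linarith
  qed
qed

lemma facet_functional_unique:
  assumes "affine_functional f" "\<And>i. i \<in> T \<Longrightarrow> f (p i) = 0" "i \<in> I - T"
  shows "f x = f (p i) / h T (p i) * h T x"
proof (rule affine_functional_multiple[OF finite_I _ card_T assms(1,2) h_affine[OF facet] _ assms(3)])
  show "S \<in> face_supports p I" if "S \<subseteq> T" for S
    using that facet supports by (auto simp: simplices_def)
  show "h T (p i) = 0 \<longleftrightarrow> i \<in> T" if "i \<in> I" for i
    using h_zero[OF facet that] .
qed

text \<open>
  The functional is a multiple of \<open>h T\<close>, which has opposite signs at the new vertex and at the old
  vertices off \<open>T\<close>; so the factor is zero.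
\<close>

lemma nonneg_functional_vanishing_on_facet:
  assumes "affine_functional f" "\<And>i. i \<in> T \<Longrightarrow> f (p i) = 0"
    "\<And>i. i \<in> insert v I \<Longrightarrow> 0 \<le> f (p i)"
  shows "f x = 0"
proof -
  obtain i where i: "i \<in> I - T" using facet_subset[OF facet] by auto
  have "0 < h T (p i)"
    using i h_nonneg[OF facet, of i] h_zero[OF facet, of i] by fastforce
  have "0 \<le> f (p i)" "0 \<le> f (p v)" using assms(3) i by auto
  have *: "f y = f (p i) / h T (p i) * h T y" for y
    by (rule facet_functional_unique[OF assms(1,2) i])
  have "f (p i) = 0"
  proof (rule ccontr)
    assume "f (p i) \<noteq> 0"
    then have "0 < f (p i) / h T (p i)" using \<open>0 \<le> f (p i)\<close> \<open>0 < h T (p i)\<close> by simp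
    then have "f (p v) < 0" using *[of "p v"] h_beyond by (metis mult_pos_neg)
    then show False using \<open>0 \<le> f (p v)\<close> by simp
  qed
  then show ?thesis using *[of x] by simp
qed

text \<open>
  The signs of the facet functionals at \<open>y\<close> say that it lies in the relative interior of the facet \<open>T\<close>. The functionals
  of the facets across the ridges of \<open>T\<close>, suitably scaled, are barycentric coordinates on \<open>T\<close>;
  so \<open>f y\<close> is a combination of the values \<open>f (p i)\<close> with positive coefficients.
\<close>

lemma vanishing_at_interior_point_of_facet:
  assumes f: "affine_functional f" "\<And>i. i \<in> T \<Longrightarrow> 0 \<le> f (p i)"
    and y: "f y = 0" "h T y = 0" "\<And>G. G \<in> \<F> \<Longrightarrow> G \<noteq> T \<Longrightarrow> 0 < h G y"
    and i: "i \<in> T"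
  shows "f (p i) = 0"
proof -
  have TI: "T \<subset> I" by (rule facet_subset[OF facet])
  then have finT: "finite T" using finite_I finite_subset by auto
  have "\<forall>i\<in>T. \<exists>G. G \<in> \<F> \<and> G \<noteq> T \<and> G \<inter> T = T - {i}"
    using ridges facet unfolding ridge_closed_def by blast
  then obtain N where N: "\<And>i. i \<in> T \<Longrightarrow> N i \<in> \<F> \<and> N i \<noteq> T \<and> N i \<inter> T = T - {i}"
    by metis
  have pos: "0 < h (N i) (p i)" if "i \<in> T" for i
    using h_zero[of "N i" i] h_nonneg[of "N i" i] N[OF that] that TI by fastforce
  have zero: "h (N i) (p k) = 0" if "i \<in> T" "k \<in> T" "k \<noteq> i" for i k
    using h_zero[of "N i" k] N[OF that(1)] that TI by blast
  \<comment> \<open>subtracting the interpolation of \<open>f\<close> on \<open>T\<close> leaves a multiple of \<open>h T\<close>, which vanishes at \<open>y\<close>\<close>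
  define g where "g = (\<lambda>x. f x + (\<Sum>i\<in>T. (- f (p i) / h (N i) (p i)) * h (N i) x))"
  have g: "affine_functional g"
    unfolding g_def using N
    by (intro affine_functional_add affine_functional_sum affine_functional_cmul f h_affine) auto
  have g0: "g (p k) = 0" if k: "k \<in> T" for k
  proof -
    have "(\<Sum>i\<in>T - {k}. (- f (p i) / h (N i) (p i)) * h (N i) (p k)) = 0"
    proof (rule sum.neutral, rule ballI)
      fix i assume "i \<in> T - {k}"
      then show "(- f (p i) / h (N i) (p i)) * h (N i) (p k) = 0" using zero[of i k] k by auto
    qed
    then have "(\<Sum>i\<in>T. (- f (p i) / h (N i) (p i)) * h (N i) (p k)) =
        (- f (p k) / h (N k) (p k)) * h (N k) (p k)"
      by (simp only: sum.remove[OF finT k] add_0_right)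
    then show ?thesis using pos[OF k] by (simp add: g_def)
  qed
  obtain k where k: "k \<in> I - T" using TI by auto
  have "g y = 0"
    using facet_functional_unique[OF g g0 k, of y] y(2) by simp
  then have "(\<Sum>i\<in>T. f (p i) / h (N i) (p i) * h (N i) y) = 0"
    using y(1) by (simp add: g_def sum_negf)
  moreover have "0 \<le> f (p i) / h (N i) (p i) * h (N i) y" if "i \<in> T" for i
    using f(2)[OF that] pos[OF that] y(3)[of "N i"] N[OF that] by (simp add: less_imp_le)
  ultimately have "f (p i) / h (N i) (p i) * h (N i) y = 0"
    using sum_nonneg_0[OF finT, of "\<lambda>i. f (p i) / h (N i) (p i) * h (N i) y" i] i by simp
  then show ?thesis
    using pos[OF i] y(3)[of "N i"] N[OF i] by auto
qed

text \<open>
  This is why a face through the new vertex has no further vertices off \<open>T\<close>: the segment from the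
  new vertex to \<open>p u\<close> enters the old polytope through an interior point of \<open>T\<close>, because the
  new vertex lies strictly and \<open>p u\<close> weakly on the inner side of every other facet. A functional that cuts out a face with both ends
  vanishes at that point, hence on \<open>T\<close>, and hence everywhere.
\<close>

lemma functional_vanishing_off_facet_and_at_new_vertex:
  assumes f: "affine_functional f" "\<And>i. i \<in> I \<Longrightarrow> 0 \<le> f (p i)" "f (p v) = 0"
    and u: "u \<in> I - T" "f (p u) = 0"
  shows "f x = 0"
proof -
  have hu: "0 < h T (p u)"
    using h_nonneg[OF facet, of u] h_zero[OF facet, of u] u by fastforce
  \<comment> \<open>the point where the segment from the new vertex to \<open>p u\<close> crosses the stacked facet\<close>
  define s where "s = h T (p u) / (h T (p u) - h T (p v))"
  define t where "t = - h T (p v) / (h T (p u) - h T (p v))"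
  have den: "0 < h T (p u) - h T (p v)" using hu h_beyond by simp
  have st: "s + t = 1" "0 < s" "0 < t"
    using den hu h_beyond by (auto simp: s_def t_def diff_divide_distrib[symmetric] field_simps)
  define y where "y = s *\<^sub>R p v + t *\<^sub>R p u"
  have comb: "g y = s * g (p v) + t * g (p u)" if "affine_functional g" for g
    unfolding y_def using that st(1) by (rule affine_functional_combination2)
  have y0: "f y = 0" using comb[OF f(1)] f(3) u(2) by simp
  have y1: "h T y = 0"
    using comb[OF h_affine[OF facet]] den by (simp add: s_def t_def field_simps)
  have y2: "0 < h G y" if "G \<in> \<F>" "G \<noteq> T" for G
    using comb[OF h_affine[OF that(1)]] h_beneath[OF that] h_nonneg[OF that(1), of u] u(1) st
    by (simp add: add_pos_nonneg)
  have "0 \<le> f (p i)" if "i \<in> T" for i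
    using that f(2) facet_subset[OF facet] by blast
  then have "f (p i) = 0" if "i \<in> T" for i
    by (rule vanishing_at_interior_point_of_facet[OF f(1) _ y0 y1 y2 that])
  moreover have "0 \<le> f (p i)" if "i \<in> insert v I" for i
    using that f(2)[of i] f(3) by (cases "i = v") auto
  ultimately show ?thesis
    by (rule nonneg_functional_vanishing_on_facet[OF f(1)])
qed

lemma functional_vanishing_on_all_vertices:
  assumes "affine_functional f" "\<And>i. i \<in> I \<Longrightarrow> f (p i) = 0"
  shows "f x = 0"
proof -
  obtain i where i: "i \<in> I - T" using facet_subset[OF facet] by auto
  have "f x = f (p i) / h T (p i) * h T x"
    by (rule facet_functional_unique[OF assms(1) _ i]) (use assms(2) facet_subset[OF facet] in blast)
  then show ?thesis using assms(2) i by simp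
qed

text \<open>
  The combinatorial effect of stacking. A face that avoids the new vertex is an old face, and
  only \<open>T\<close> is lost. For a proper subset \<open>R\<close> of \<open>T\<close>, the face with vertices \<open>insert v R\<close> is cut
  out by a functional of \<open>R\<close> that is positive at the new vertex plus the multiple of \<open>h T\<close> that
  cancels this value.
\<close>

theorem face_supports_stack:
  "face_supports p (insert v I) = insert (insert v I) (simplices (stack_facet v T \<F>))"
proof -
  have T_ne: "T \<noteq> {}" using card_T DIM_positive[where 'a='a] by auto
  have v_notin: "v \<notin> G" if "G \<in> \<F>" for G using facet_subset[OF that] new by auto
  have stack: "simplices (stack_facet v T \<F>) = (simplices \<F> - {T}) \<union> insert v ` {S. S \<subset> T}"
    by (rule simplices_stack_facet[OF facet T_ne antichain ridges v_notin])
  have sub: "S \<subseteq> I" "v \<notin> S" if "S \<in> simplices \<F>" for S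
    using that facet_subset new by (auto simp: simplices_def)
  show ?thesis
  proof (intro subset_antisym subsetI)
    fix S assume "S \<in> face_supports p (insert v I)"
    then obtain f where f: "affine_functional f" "\<And>i. i \<in> insert v I \<Longrightarrow> 0 \<le> f (p i)"
      "\<And>i. i \<in> insert v I \<Longrightarrow> f (p i) = 0 \<longleftrightarrow> i \<in> S" and SI: "S \<subseteq> insert v I"
      using face_supportsE[of S p "insert v I"] face_supports_subset[of S p "insert v I"] by metis
    show "S \<in> insert (insert v I) (simplices (stack_facet v T \<F>))"
    proof (cases "\<forall>x. f x = 0")
      case True
      then have "S = insert v I" using f(3) SI by auto
      then show ?thesis by simp
    next
      case nonzero: False
      have R: "S - {v} \<in> face_supports p I"
        using f SI new by (intro face_supportsI[of f]) auto
      have "S - {v} \<noteq> I"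
      proof
        assume "S - {v} = I"
        then have "f (p i) = 0" if "i \<in> I" for i using that f(3)[of i] by blast
        then have "f x = 0" for x by (rule functional_vanishing_on_all_vertices[OF f(1)])
        then show False using nonzero by blast
      qed
      then have R': "S - {v} \<in> simplices \<F>" using R supports by auto
      have R_T: "S - {v} \<noteq> T"
      proof
        assume *: "S - {v} = T"
        have "f (p i) = 0" if "i \<in> T" for i
          using that f(3)[of i] * facet_subset[OF facet] by blast
        then have "f x = 0" for x
          by (rule nonneg_functional_vanishing_on_facet[OF f(1) _ f(2)])
        then show False using nonzero by blast
      qed
      show ?thesis
      proof (cases "v \<in> S")
        case False
        then show ?thesis using R' R_T stack by simp
      next
        case True
        then have "f (p v) = 0" using f(3) by blast
        have "S - {v} \<subseteq> T"
        proof (rule ccontr)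
          assume "\<not> S - {v} \<subseteq> T"
          then obtain u where u: "u \<in> S - {v}" "u \<notin> T" by blast
          then have "u \<in> I - T" "f (p u) = 0" using SI f(3)[of u] by blast+
          have "0 \<le> f (p i)" if "i \<in> I" for i using f(2)[of i] that by simp
          then have "f x = 0" for x
            by (rule functional_vanishing_off_facet_and_at_new_vertex[OF f(1) _ \<open>f (p v) = 0\<close> \<open>u \<in> I - T\<close> \<open>f (p u) = 0\<close>])
          then show False using nonzero by blast
        qed
        then have "S - {v} \<subset> T" using R_T by blast
        moreover have "S = insert v (S - {v})" using True by blast
        ultimately show ?thesis unfolding stack by blast
      qed
    qed
  next
    fix S assume "S \<in> insert (insert v I) (simplices (stack_facet v T \<F>))"
    then consider "S = insert v I" | "S \<in> simplices \<F>" "S \<noteq> T" | R where "R \<subset> T" "S = insert v R"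
      unfolding stack by blast
    then show "S \<in> face_supports p (insert v I)"
    proof cases
      case 1
      then show ?thesis
        by (intro face_supportsI[of "\<lambda>x. 0"]) (auto intro: affine_functional_const)
    next
      case 2
      then obtain f where f: "affine_functional f" "\<And>i. i \<in> I \<Longrightarrow> 0 \<le> f (p i)"
        "\<And>i. i \<in> I \<Longrightarrow> f (p i) = 0 \<longleftrightarrow> i \<in> S" "0 < f (p v)"
        using simplex_functional_beneath by metis
      show ?thesis
      proof (rule face_supportsI[OF f(1)])
        show "0 \<le> f (p i)" if "i \<in> insert v I" for i
          using that f(2)[of i] f(4) by (cases "i = v") auto
        show "f (p i) = 0 \<longleftrightarrow> i \<in> S" if "i \<in> insert v I" for i
          using that f(3)[of i] f(4) sub(2)[OF 2(1)] by (cases "i = v") auto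
        show "S \<subseteq> insert v I" using sub(1)[OF 2(1)] by blast
      qed
    next
      case 3
      then have R: "R \<in> simplices \<F>" "R \<noteq> T" using facet by (auto simp: simplices_def)
      then obtain f where f: "affine_functional f" "\<And>i. i \<in> I \<Longrightarrow> 0 \<le> f (p i)"
        "\<And>i. i \<in> I \<Longrightarrow> f (p i) = 0 \<longleftrightarrow> i \<in> R" "0 < f (p v)"
        using simplex_functional_beneath by metis
      define K where "K = f (p v) / (- h T (p v))"
      have K: "0 < K" "f (p v) + K * h T (p v) = 0"
        using f(4) h_beyond by (auto simp: K_def divide_pos_neg field_simps)
      show ?thesis
      proof (rule face_supportsI[of "\<lambda>x. f x + K * h T x"])
        show "affine_functional (\<lambda>x. f x + K * h T x)"
          by (intro affine_functional_add affine_functional_cmul f h_affine facet)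
        have nn: "0 \<le> K * h T (p i)" if "i \<in> I" for i
          using h_nonneg[OF facet that] K(1) by simp
        show "0 \<le> f (p i) + K * h T (p i)" if "i \<in> insert v I" for i
          using that f(2)[of i] K(2) nn[of i] by (cases "i = v") auto
        show "f (p i) + K * h T (p i) = 0 \<longleftrightarrow> i \<in> S" if "i \<in> insert v I" for i
        proof (cases "i = v")
          case True
          then show ?thesis using K 3 by simp
        next
          case False
          then have i: "i \<in> I" using that by simp
          have "f (p i) + K * h T (p i) = 0 \<longleftrightarrow> f (p i) = 0 \<and> h T (p i) = 0"
            using f(2)[OF i] nn[OF i] K(1) by (auto simp: add_nonneg_eq_0_iff)
          then show ?thesis
            using f(3)[OF i] h_zero[OF facet i] 3 False by auto
        qed
        show "S \<subseteq> insert v I" using 3 facet_subset[OF facet] by blast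
      qed
    qed
  qed
qed

end

section \<open>Stacked simplicial complexes\<close>

text \<open>
  The boundary complexes of stacked 4-polytopes. The vertices are numbered in the order in which
  they arise, so the vertex set after \<open>n\<close> steps is \<open>{..<n + 5}\<close> and the next vertex is \<open>n + 5\<close>.
\<close>

inductive stacked_complex :: "nat \<Rightarrow> nat set set \<Rightarrow> bool" where
  simplex: "stacked_complex 0 {S. S \<subseteq> {..<5} \<and> card S = 4}"
| stack: "stacked_complex n \<F> \<Longrightarrow> T \<in> \<F> \<Longrightarrow> stacked_complex (Suc n) (stack_facet (n + 5) T \<F>)"

lemma exists_stacked_complex: "\<exists>\<F>. stacked_complex n \<F> \<and> \<F> \<noteq> {}"
proof (induction n)
  case 0
  have "{..<4::nat} \<in> {S. S \<subseteq> {..<5} \<and> card S = 4}" by auto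
  then show ?case using stacked_complex.simplex by blast
next
  case (Suc n)
  then obtain \<F> T where "stacked_complex n \<F>" "T \<in> \<F>" by blast
  moreover have "stack_facet (n + 5) T \<F> \<noteq> {}" if "T \<noteq> {}"
    using that by (auto simp: stack_facet_def)
  moreover have "T \<noteq> {}" if "stacked_complex n \<F>" "T \<in> \<F>" for n and \<F> :: "nat set set" and T
    using that by (induction arbitrary: T rule: stacked_complex.induct) (auto simp: stack_facet_def)
  ultimately show ?case using stacked_complex.stack by blast
qed

lemma stacked_complex_facet:
  assumes "stacked_complex n \<F>" "T \<in> \<F>"
  shows "card T = 4" "T \<subseteq> {..<n + 5}"
proof -
  have "card T = 4 \<and> T \<subseteq> {..<n + 5}"
    using assms
  proof (induction arbitrary: T rule: stacked_complex.induct)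
    case (stack n \<F> T0)
    have T0: "card T0 = 4" "T0 \<subseteq> {..<n + 5}" using stack.IH[OF stack.hyps(2)] by auto
    have fin: "finite T0" using T0(2) finite_subset by blast
    consider "T \<in> \<F>" | i where "i \<in> T0" "T = insert (n + 5) (T0 - {i})"
      using stack.prems by (auto simp: stack_facet_def)
    then show ?case
    proof cases
      case 1
      then show ?thesis using stack.IH[OF 1] by auto
    next
      case 2
      have "n + 5 \<notin> T0" using T0 by auto
      then have "card T = 4" using 2 T0 fin by (simp add: card_Diff_singleton)
      moreover have "T \<subseteq> {..<Suc n + 5}" using 2 T0 by auto
      ultimately show ?thesis by simp
    qed
  qed auto
  then show "card T = 4" "T \<subseteq> {..<n + 5}" by auto
qed

lemma stacked_complex_finite:
  assumes "stacked_complex n \<F>"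
  shows "finite \<F>" "finite (simplices \<F>)" "T \<in> \<F> \<Longrightarrow> finite T" "S \<in> simplices \<F> \<Longrightarrow> finite S"
    "S \<in> simplices \<F> \<Longrightarrow> S \<subseteq> {..<n + 5}" "S \<in> simplices \<F> \<Longrightarrow> card S \<le> 4"
proof -
  show sub: "S \<subseteq> {..<n + 5}" if "S \<in> simplices \<F>" for S
    using that stacked_complex_facet[OF assms] by (auto simp: simplices_def)
  show fin: "finite S" if "S \<in> simplices \<F>" for S
    using sub[OF that] finite_subset by blast
  show "finite (simplices \<F>)"
    using sub by (intro finite_subset[of "simplices \<F>" "Pow {..<n + 5}"]) auto
  then show "finite \<F>"
    by (rule finite_subset[rotated]) (auto simp: simplices_def)
  show "finite T" if "T \<in> \<F>" for T
    using fin simplices_facet that by blast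
  show "card S \<le> 4" if S: "S \<in> simplices \<F>"
  proof -
    obtain T where "T \<in> \<F>" "S \<subseteq> T" using S by (auto simp: simplices_def)
    then show ?thesis
      using stacked_complex_facet[OF assms] card_mono[of T S] fin[OF simplices_facet] by metis
  qed
qed

lemma facet_antichain:
  assumes "stacked_complex n \<F>" "T \<in> \<F>" "G \<in> \<F>" "T \<subseteq> G"
  shows "G = T"
  using card_subset_eq[of G T] stacked_complex_facet[OF assms(1)] stacked_complex_finite[OF assms(1)]
    assms by metis

lemma facet_iff_card:
  assumes "stacked_complex n \<F>"
  shows "S \<in> simplices \<F> \<and> card S = 4 \<longleftrightarrow> S \<in> \<F>"
proof
  assume *: "S \<in> simplices \<F> \<and> card S = 4"
  then obtain T where T: "T \<in> \<F>" "S \<subseteq> T" by (auto simp: simplices_def)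
  then have "S = T"
    using card_subset_eq[of T S] stacked_complex_facet[OF assms] stacked_complex_finite[OF assms] *
    by metis
  then show "S \<in> \<F>" using T by simp
qed (use stacked_complex_facet[OF assms] simplices_facet in auto)

lemma ridge_closed_if_two_facets:
  assumes "stacked_complex n \<F>"
    and "\<And>R. R \<in> simplices \<F> \<Longrightarrow> card R = 3 \<Longrightarrow> card {T \<in> \<F>. R \<subseteq> T} = 2"
  shows "ridge_closed \<F>"
  unfolding ridge_closed_def
proof (intro ballI)
  fix T i assume T: "T \<in> \<F>" "i \<in> T"
  let ?R = "T - {i}"
  have "card ?R = 3" using T stacked_complex_facet[OF assms(1)] by (simp add: card_Diff_singleton)
  moreover have "?R \<in> simplices \<F>" using T by (auto simp: simplices_def)
  ultimately have "card {G \<in> \<F>. ?R \<subseteq> G} = 2" using assms(2) by blast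
  moreover have "T \<in> {G \<in> \<F>. ?R \<subseteq> G}" using T by auto
  ultimately have "card ({G \<in> \<F>. ?R \<subseteq> G} - {T}) = 1" by (simp add: card_Diff_singleton)
  then obtain G where G: "G \<in> \<F>" "?R \<subseteq> G" "G \<noteq> T"
    by (metis (no_types, lifting) card_1_singleton_iff DiffE insertI1 mem_Collect_eq One_nat_def)
  then have "i \<notin> G" using facet_antichain[OF assms(1) T(1) G(1)] by blast
  then show "\<exists>G\<in>\<F>. G \<noteq> T \<and> G \<inter> T = T - {i}" using G by blast
qed

text \<open>
  If the ridge lies in the facet \<open>T\<close> that is removed, then exactly one of the new facets takes the
  place of \<open>T\<close>. A ridge \<open>insert (n + 5) S\<close> lies in one new facet for each of the two elements
  of \<open>T - S\<close>.
\<close>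

lemma stacked_complex_two_facets:
  assumes "stacked_complex n \<F>" "R \<in> simplices \<F>" "card R = 3"
  shows "card {T \<in> \<F>. R \<subseteq> T} = 2"
  using assms
proof (induction arbitrary: R rule: stacked_complex.induct)
  case simplex
  have RI: "R \<subseteq> {..<5}" using simplex by (auto simp: simplices_def)
  have finR: "finite R" using RI finite_subset by blast
  have "{T \<in> {S. S \<subseteq> {..<5} \<and> card S = 4}. R \<subseteq> T} = (\<lambda>i. insert i R) ` ({..<5} - R)"
  proof (intro subset_antisym subsetI)
    fix T assume "T \<in> {T \<in> {S. S \<subseteq> {..<5} \<and> card S = 4}. R \<subseteq> T}"
    then have T: "T \<subseteq> {..<5}" "card T = 4" "R \<subseteq> T" by auto
    have "card (T - R) = 1" using T simplex.prems(2) finR by (simp add: card_Diff_subset)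
    then obtain i where "T - R = {i}" by (auto simp: card_1_singleton_iff)
    then have "i \<in> {..<5} - R" "T = insert i R" using T by blast+
    then show "T \<in> (\<lambda>i. insert i R) ` ({..<5} - R)" by blast
  next
    fix T assume "T \<in> (\<lambda>i. insert i R) ` ({..<5} - R)"
    then show "T \<in> {T \<in> {S. S \<subseteq> {..<5} \<and> card S = 4}. R \<subseteq> T}"
      using RI finR simplex.prems(2) by auto
  qed
  moreover have "inj_on (\<lambda>i. insert i R) ({..<5} - R)" by (rule inj_onI) blast
  moreover have "card ({..<5} - R) = 2"
    using RI finR simplex.prems(2) by (simp add: card_Diff_subset)
  ultimately show ?case by (simp add: card_image)
next
  case (stack n \<F> T)
  let ?N = "n + 5"
  have T: "card T = 4" "T \<subseteq> {..<n + 5}" "finite T"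
    using stacked_complex_facet[OF stack.hyps] stacked_complex_finite(3)[OF stack.hyps(1)] stack.hyps
    by auto
  have N: "?N \<notin> G" if "G \<in> \<F>" for G
    using stacked_complex_facet(2)[OF stack.hyps(1) that] by auto
  have ridge: "ridge_closed \<F>"
    by (rule ridge_closed_if_two_facets[OF stack.hyps(1) stack.IH])
  have Tne: "T \<noteq> {}" using T by auto
  have "simplices (stack_facet ?N T \<F>) = (simplices \<F> - {T}) \<union> insert ?N ` {S. S \<subset> T}"
    by (rule simplices_stack_facet[OF stack.hyps(2) Tne facet_antichain[OF stack.hyps] ridge N])
  then have "R \<in> (simplices \<F> - {T}) \<union> insert ?N ` {S. S \<subset> T}"
    using stack.prems(1) by simp
  then consider "R \<in> simplices \<F>" "\<not> R \<subseteq> T" | "R \<in> simplices \<F>" "R \<subseteq> T"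
    | S where "S \<subset> T" "R = insert ?N S" by blast
  then show ?case
  proof cases
    case 1
    then have "?N \<notin> R" using N by (auto simp: simplices_def)
    then have "{G \<in> stack_facet ?N T \<F>. R \<subseteq> G} = {G \<in> \<F>. R \<subseteq> G}"
      using 1 by (auto simp: stack_facet_def)
    then show ?thesis using stack.IH[OF 1(1) stack.prems(2)] by simp
  next
    case 2
    have "?N \<notin> R" using 2 N[OF stack.hyps(2)] by blast
    have "card (T - R) = 1"
      using T stack.prems(2) 2 finite_subset[OF 2(2)] by (simp add: card_Diff_subset)
    then obtain j where "T - R = {j}" by (auto simp: card_1_singleton_iff)
    then have j: "j \<in> T" "R = T - {j}" using 2 by blast+
    have "{G \<in> stack_facet ?N T \<F>. R \<subseteq> G} = insert (insert ?N R) ({G \<in> \<F>. R \<subseteq> G} - {T})"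
    proof (intro subset_antisym subsetI)
      fix G assume "G \<in> {G \<in> stack_facet ?N T \<F>. R \<subseteq> G}"
      then consider "G \<in> \<F>" "G \<noteq> T" "R \<subseteq> G"
        | i where "i \<in> T" "G = insert ?N (T - {i})" "R \<subseteq> G"
        by (auto simp: stack_facet_def)
      then show "G \<in> insert (insert ?N R) ({G \<in> \<F>. R \<subseteq> G} - {T})"
      proof cases
        case (2 i)
        then have "i = j" using j \<open>?N \<notin> R\<close> by blast
        then show ?thesis using 2 j by blast
      qed blast
    next
      fix G assume "G \<in> insert (insert ?N R) ({G \<in> \<F>. R \<subseteq> G} - {T})"
      then show "G \<in> {G \<in> stack_facet ?N T \<F>. R \<subseteq> G}"
        using j by (auto simp: stack_facet_def)
    qed
    moreover have "card ({G \<in> \<F>. R \<subseteq> G} - {T}) = 1"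
      using stack.IH[OF 2(1) stack.prems(2)] stack.hyps(2) 2(2) by (simp add: card_Diff_singleton)
    moreover have "insert ?N R \<notin> {G \<in> \<F>. R \<subseteq> G} - {T}" using N by blast
    ultimately show ?thesis
      using stacked_complex_finite(1)[OF stack.hyps(1)] by simp
  next
    case 3
    have finS: "finite S" using 3 T finite_subset by blast
    have NS: "?N \<notin> S" using 3 N[OF stack.hyps(2)] by blast
    then have "card S = 2" using stack.prems(2) 3 finS by simp
    then have "card (T - S) = 2" using T 3 finS by (simp add: card_Diff_subset psubset_imp_subset)
    moreover have "{G \<in> stack_facet ?N T \<F>. R \<subseteq> G} = (\<lambda>i. insert ?N (T - {i})) ` (T - S)"
      using 3 N NS by (auto simp: stack_facet_def)
    moreover have "inj_on (\<lambda>i. insert ?N (T - {i})) (T - S)"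
    proof (rule inj_onI)
      fix x y assume xy: "x \<in> T - S" "y \<in> T - S"
        and eq: "insert ?N (T - {x}) = insert ?N (T - {y})"
      have "x \<notin> insert ?N (T - {x})" using xy N[OF stack.hyps(2)] by auto
      then show "x = y" unfolding eq using xy by blast
    qed
    ultimately show ?thesis by (simp add: card_image)
  qed
qed

lemma stacked_complex_ridge_closed: "stacked_complex n \<F> \<Longrightarrow> ridge_closed \<F>"
  by (rule ridge_closed_if_two_facets[OF _ stacked_complex_two_facets])

lemma simplices_stack:
  assumes "stacked_complex n \<F>" "T \<in> \<F>"
  shows "simplices (stack_facet (n + 5) T \<F>) =
    (simplices \<F> - {T}) \<union> insert (n + 5) ` {S. S \<subset> T}"
proof (rule simplices_stack_facet[OF assms(2) _ facet_antichain[OF assms] stacked_complex_ridge_closed[OF assms(1)]])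
  show "T \<noteq> {}" using stacked_complex_facet(1)[OF assms] by auto
  show "n + 5 \<notin> G" if "G \<in> \<F>" for G
    using stacked_complex_facet(2)[OF assms(1) that] by auto
qed

lemma stacked_complex_vertex:
  assumes "stacked_complex n \<F>" "i < n + 5"
  shows "{i} \<in> simplices \<F>"
  using assms
proof (induction arbitrary: i rule: stacked_complex.induct)
  case simplex
  define j :: nat where "j = (if i = 0 then 1 else 0)"
  have "j < 5" "j \<noteq> i" by (auto simp: j_def)
  then have "{..<5} - {j} \<in> {S. S \<subseteq> {..<5::nat} \<and> card S = 4}" "{i} \<subseteq> {..<5} - {j}"
    using simplex by (auto simp: card_Diff_singleton)
  then show ?case unfolding simplices_def by blast
next
  case (stack n \<F> T)
  have T: "card T = 4" using stacked_complex_facet[OF stack.hyps] by simp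
  show ?case
  proof (cases "i = n + 5")
    case True
    then have "{i} = insert (n + 5) {}" "{} \<subset> T" using T by auto
    then show ?thesis unfolding simplices_stack[OF stack.hyps] by blast
  next
    case False
    then have "{i} \<in> simplices \<F>" using stack by simp
    moreover have "{i} \<noteq> T" using T by auto
    ultimately show ?thesis unfolding simplices_stack[OF stack.hyps] by blast
  qed
qed

definition simplex_count :: "nat set set \<Rightarrow> nat \<Rightarrow> nat" where
  "simplex_count \<F> k = card {S \<in> simplices \<F>. card S = k}"

text \<open>
  The new simplices are the cones over the \<open>k\<close>-element proper subsets of \<open>T\<close>, and \<open>T\<close> is lost.
\<close>

lemma simplex_count_stack:
  assumes "stacked_complex n \<F>" "T \<in> \<F>"
  shows "simplex_count (stack_facet (n + 5) T \<F>) (Suc k) =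
    simplex_count \<F> (Suc k) - (if k = 3 then 1 else 0) + (if k \<le> 3 then 4 choose k else 0)"
proof -
  have T: "card T = 4" "finite T" "n + 5 \<notin> T"
    using stacked_complex_facet[OF assms] stacked_complex_finite(3)[OF assms(1)] assms by auto
  let ?A = "{S \<in> simplices \<F> - {T}. card S = Suc k}"
  let ?B = "{S. S \<subset> T \<and> card S = k}"
  have card_ins: "card (insert (n + 5) S) = Suc (card S)" if "S \<subset> T" for S
  proof -
    have "finite S" "n + 5 \<notin> S" using that T finite_subset by blast+
    then show ?thesis by simp
  qed
  have split: "{S \<in> simplices (stack_facet (n + 5) T \<F>). card S = Suc k} = ?A \<union> insert (n + 5) ` ?B"
    (is "?L = _")
  proof -
    have "?L = ?A \<union> insert (n + 5) ` {S \<in> {S. S \<subset> T}. card (insert (n + 5) S) = Suc k}"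
      unfolding simplices_stack[OF assms] by blast
    also have "{S \<in> {S. S \<subset> T}. card (insert (n + 5) S) = Suc k} = ?B"
      by (simp add: card_ins cong: conj_cong)
    finally show ?thesis .
  qed
  have "n + 5 \<notin> S" if "S \<in> simplices \<F>" for S
    using stacked_complex_finite(5)[OF assms(1) that] by auto
  then have disj: "?A \<inter> insert (n + 5) ` ?B = {}"
    by blast
  have finA: "finite ?A"
    using stacked_complex_finite(2)[OF assms(1)] by auto
  have finB: "finite ?B"
    using T by (intro finite_subset[of ?B "Pow T"]) auto
  have "inj_on (insert (n + 5)) ?B"
  proof (rule inj_onI)
    fix S R assume "S \<in> ?B" "R \<in> ?B" and eq: "insert (n + 5) S = insert (n + 5) R"
    then have "n + 5 \<notin> S" "n + 5 \<notin> R" using T(3) by blast+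
    then show "S = R" using eq by (metis insert_ident)
  qed
  then have "card (?A \<union> insert (n + 5) ` ?B) = card ?A + card ?B"
    using finA finB disj by (simp add: card_Un_disjoint card_image)
  moreover have "card ?B = (if k \<le> 3 then 4 choose k else 0)"
  proof (cases "k \<le> 3")
    case True
    then have "?B = {S. S \<subseteq> T \<and> card S = k}" using T by auto
    then show ?thesis using n_subsets[OF T(2), of k] T True by simp
  next
    case False
    have "card S < 4" if "S \<subset> T" for S using psubset_card_mono[OF T(2) that] T(1) by simp
    moreover have "4 \<le> k" using False by simp
    ultimately have "?B = {}" by (metis (mono_tags, lifting) equals0I leD mem_Collect_eq)
    then show ?thesis using False by (simp only: card.empty if_False)
  qed
  moreover have "card ?A = simplex_count \<F> (Suc k) - (if k = 3 then 1 else 0)"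
  proof (cases "k = 3")
    case True
    have "?A = {S \<in> simplices \<F>. card S = Suc k} - {T}" by auto
    moreover have "T \<in> {S \<in> simplices \<F>. card S = Suc k}"
      using T True simplices_facet[OF assms(2)] by auto
    ultimately show ?thesis
      using True by (simp add: simplex_count_def card_Diff_singleton)
  next
    case False
    then have "?A = {S \<in> simplices \<F>. card S = Suc k}" using T by auto
    then show ?thesis using False by (simp add: simplex_count_def)
  qed
  ultimately show ?thesis by (simp add: simplex_count_def split)
qed

lemma stacked_complex_counts:
  assumes "stacked_complex n \<F>"
  shows "simplex_count \<F> 2 = 10 + 4 * n" "simplex_count \<F> 3 = 10 + 6 * n" "card \<F> = 5 + 3 * n"
proof -
  have "simplex_count \<F> 2 = 10 + 4 * n \<and> simplex_count \<F> 3 = 10 + 6 * n \<and>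
      simplex_count \<F> 4 = 5 + 3 * n"
    using assms
  proof (induction rule: stacked_complex.induct)
    case simplex
    have "{S \<in> simplices {S. S \<subseteq> {..<5::nat} \<and> card S = 4}. card S = k} =
        {S. S \<subseteq> {..<5} \<and> card S = k}" if "k \<le> 4" for k
    proof (intro subset_antisym subsetI)
      fix S :: "nat set" assume "S \<in> {S. S \<subseteq> {..<5} \<and> card S = k}"
      then have S: "S \<subseteq> {..<5}" "card S = k" by auto
      then have "S \<noteq> {..<5}" using that by auto
      then obtain j where "j < 5" "j \<notin> S" using S by auto
      then have "S \<subseteq> {..<5} - {j}" "{..<5} - {j} \<in> {S. S \<subseteq> {..<5::nat} \<and> card S = 4}"
        using S by (auto simp: card_Diff_singleton)
      then show "S \<in> {S \<in> simplices {S. S \<subseteq> {..<5::nat} \<and> card S = 4}. card S = k}"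
        using S unfolding simplices_def by blast
    qed (auto simp: simplices_def)
    then have "simplex_count {S. S \<subseteq> {..<5::nat} \<and> card S = 4} k = 5 choose k" if "k \<le> 4" for k
      using that n_subsets[of "{..<5::nat}" k] by (simp add: simplex_count_def)
    then show ?case by (simp add: numeral_eq_Suc)
  next
    case (stack n \<F> T)
    show ?case
      using stack.IH simplex_count_stack[OF stack.hyps, of 1]
        simplex_count_stack[OF stack.hyps, of 2] simplex_count_stack[OF stack.hyps, of 3]
      by (simp add: numeral_eq_Suc)
  qed
  moreover have "{S \<in> simplices \<F>. card S = 4} = \<F>" using facet_iff_card[OF assms] by auto
  ultimately show "simplex_count \<F> 2 = 10 + 4 * n" "simplex_count \<F> 3 = 10 + 6 * n"
    "card \<F> = 5 + 3 * n" by (auto simp: simplex_count_def)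
qed

section \<open>Realizing stacked complexes by stacked polytopes\<close>

text \<open>
  The boundary complex of the convex hull of the points \<open>p\<close> is the complex with facets \<open>\<F>\<close>.
\<close>

definition realizes :: "nat \<Rightarrow> nat set set \<Rightarrow> (nat \<Rightarrow> real ^ 4) \<Rightarrow> bool" where
  "realizes n \<F> p \<longleftrightarrow> face_supports p {..<n + 5} = insert {..<n + 5} (simplices \<F>)"

lemma face_supports_cong:
  fixes p q :: "'i \<Rightarrow> 'b::euclidean_space"
  assumes "\<And>i. i \<in> I \<Longrightarrow> p i = q i"
  shows "face_supports p I = face_supports q I"
proof -
  have "{i \<in> I. f (p i) = 0} = {i \<in> I. f (q i) = 0}" for f :: "'b \<Rightarrow> real"
    using assms by auto
  then show ?thesis using assms by (simp add: face_supports_def)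
qed

lemma realizes_supports:
  assumes "realizes n \<F> p" "S \<in> simplices \<F>"
  shows "S \<in> face_supports p {..<n + 5}"
  using assms by (simp add: realizes_def)

lemma whole_not_simplex:
  assumes "stacked_complex n \<F>"
  shows "{..<n + 5} \<notin> simplices \<F>"
proof
  assume "{..<n + 5} \<in> simplices \<F>"
  then have "card {..<n + 5} \<le> 4" by (rule stacked_complex_finite(6)[OF assms])
  then show False by simp
qed

lemma realizes_stack:
  assumes "stacked_complex n \<F>" "realizes n \<F> p" "T \<in> \<F>"
    and h: "\<And>G. G \<in> \<F> \<Longrightarrow> affine_functional (h G)"
      "\<And>G i. G \<in> \<F> \<Longrightarrow> i < n + 5 \<Longrightarrow> 0 \<le> h G (p i)"
      "\<And>G i. G \<in> \<F> \<Longrightarrow> i < n + 5 \<Longrightarrow> h G (p i) = 0 \<longleftrightarrow> i \<in> G"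
      "h T v < 0" "\<And>G. G \<in> \<F> \<Longrightarrow> G \<noteq> T \<Longrightarrow> 0 < h G v"
  shows "stacking (p(n + 5 := v)) {..<n + 5} \<F> T (n + 5) h"
    "realizes (Suc n) (stack_facet (n + 5) T \<F>) (p(n + 5 := v))"
proof -
  show st: "stacking (p(n + 5 := v)) {..<n + 5} \<F> T (n + 5) h"
  proof
    have "face_supports (p(n + 5 := v)) {..<n + 5} = face_supports p {..<n + 5}"
      by (rule face_supports_cong) auto
    then show "face_supports (p(n + 5 := v)) {..<n + 5} = insert {..<n + 5} (simplices \<F>)"
      using assms(2) by (simp add: realizes_def)
    show "G = T" if "G \<in> \<F>" "T \<subseteq> G" for G
      using facet_antichain[OF assms(1,3)] that by blast
    show "card T = DIM(real ^ 4)"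
      using stacked_complex_facet(1)[OF assms(1,3)] by simp
    show "ridge_closed \<F>" by (rule stacked_complex_ridge_closed[OF assms(1)])
    show "{..<n + 5} \<notin> simplices \<F>" by (rule whole_not_simplex[OF assms(1)])
    show "0 \<le> h G ((p(n + 5 := v)) i)" if "G \<in> \<F>" "i \<in> {..<n + 5}" for G i
      using h(2)[OF that(1), of i] that(2) by auto
    show "h G ((p(n + 5 := v)) i) = 0 \<longleftrightarrow> i \<in> G" if "G \<in> \<F>" "i \<in> {..<n + 5}" for G i
      using h(3)[OF that(1), of i] that(2) by auto
  qed (use h assms in auto)
  have "{..<Suc n + 5} = insert (n + 5) {..<n + 5}" by auto
  then show "realizes (Suc n) (stack_facet (n + 5) T \<F>) (p(n + 5 := v))"
    unfolding realizes_def using stacking.face_supports_stack[OF st] by simp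
qed

lemma realizes_aff_dim_simplex:
  assumes "realizes n \<F> p" "S \<in> simplices \<F>"
  shows "aff_dim (p ` S) = int (card S) - 1"
  by (rule aff_dim_simplex_support[OF finite_lessThan realizes_supports[OF assms(1) simplices_mono[OF assms(2)]]])

lemma realizes_aff_dim:
  assumes "stacked_complex n \<F>" "realizes n \<F> p"
  shows "aff_dim (p ` {..<n + 5}) = 4"
proof -
  have "{0} \<in> simplices \<F>" by (rule stacked_complex_vertex[OF assms(1)]) simp
  then obtain T where T: "T \<in> \<F>" by (auto simp: simplices_def)
  have "T \<noteq> {..<n + 5}" using whole_not_simplex[OF assms(1)] simplices_facet[OF T] by auto
  then obtain i where i: "i \<in> {..<n + 5} - T"
    using stacked_complex_facet(2)[OF assms(1) T] by blast
  have "aff_dim (p ` insert i T) = int (card T)"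
  proof (rule aff_dim_simplex_insert[OF _ _ i])
    show "S \<in> face_supports p {..<n + 5}" if "S \<subseteq> T" for S
      using realizes_supports[OF assms(2)] simplices_mono[OF simplices_facet[OF T] that] .
  qed simp
  moreover have "aff_dim (p ` insert i T) \<le> aff_dim (p ` {..<n + 5})"
    using i stacked_complex_facet(2)[OF assms(1) T] by (intro aff_dim_subset image_mono) auto
  moreover have "aff_dim (p ` {..<n + 5}) \<le> 4"
    using aff_dim_le_DIM[of "p ` {..<n + 5}"] by simp
  ultimately show ?thesis using stacked_complex_facet(1)[OF assms(1) T] by simp
qed

lemma simplices_boundary_of_simplex:
  "simplices {S. S \<subseteq> {..<5::nat} \<and> card S = 4} = {S. S \<subset> {..<5}}"
proof (intro subset_antisym subsetI)
  fix S :: "nat set" assume "S \<in> {S. S \<subset> {..<5}}"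
  then obtain j where "j < 5" "j \<notin> S" "S \<subseteq> {..<5}" by blast
  then have "S \<subseteq> {..<5} - {j}" "{..<5} - {j} \<in> {S. S \<subseteq> {..<5::nat} \<and> card S = 4}"
    by (auto simp: card_Diff_singleton)
  then show "S \<in> simplices {S. S \<subseteq> {..<5::nat} \<and> card S = 4}"
    unfolding simplices_def by blast
next
  fix S assume "S \<in> simplices {S. S \<subseteq> {..<5::nat} \<and> card S = 4}"
  then obtain T where "S \<subseteq> T" "T \<subseteq> {..<5}" "card T = 4" by (auto simp: simplices_def)
  moreover have "card {..<5::nat} = 5" by simp
  ultimately show "S \<in> {S. S \<subset> {..<5}}" by (cases "S = {..<5}") auto
qed

lemma realizes_simplex_iff:
  "realizes 0 {S. S \<subseteq> {..<5} \<and> card S = 4} p \<longleftrightarrow> face_supports p {..<5} = Pow {..<5}"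
proof -
  have "insert {..<5} {S. S \<subset> {..<5::nat}} = Pow {..<5}" by auto
  then show ?thesis by (simp add: realizes_def simplices_boundary_of_simplex)
qed

text \<open>
  A simplex has all the subsets of its vertex set as faces.
\<close>

lemma face_supports_affine_independent:
  assumes "finite I" "inj_on p I" "\<not> affine_dependent (p ` I)"
  shows "face_supports p I = Pow I"
proof (intro subset_antisym subsetI)
  fix S assume "S \<in> Pow I"
  then have S: "S \<subseteq> I" by simp
  have "convex hull (p ` S) face_of convex hull (p ` I)"
    unfolding face_of_convex_hull_affine_independent[OF assms(3)]
    using image_mono[OF S, of p] by blast
  then have "convex hull (p ` S) \<in> (\<lambda>S. convex hull (p ` S)) ` face_supports p I"
    using faces_of_convex_hull[OF assms(1), of p] by (metis mem_Collect_eq)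
  then obtain S' where S': "S' \<in> face_supports p I" "convex hull (p ` S) = convex hull (p ` S')"
    by blast
  have S'I: "S' \<subseteq> I" by (rule face_supports_subset[OF S'(1)])
  have "S' = S"
  proof (intro subset_antisym subsetI)
    fix i assume "i \<in> S"
    then have "p i \<in> convex hull (p ` S')"
      unfolding S'(2)[symmetric] by (intro hull_inc imageI)
    then show "i \<in> S'"
      using point_in_face_iff[OF assms(1) S'(1)] \<open>i \<in> S\<close> S by blast
  next
    fix i assume i: "i \<in> S'"
    then have "p i \<in> convex hull (p ` S)" unfolding S'(2) by (intro hull_inc imageI)
    then have *: "p i \<in> affine hull (p ` S)" using convex_hull_subset_affine_hull by blast
    show "i \<in> S"
    proof (rule ccontr)
      assume "i \<notin> S"
      then have "p ` S \<subseteq> p ` I - {p i}"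
        using assms(2) S S'I i by (auto dest: inj_onD)
      then have "p i \<in> affine hull (p ` I - {p i})" using * hull_mono by blast
      then show False using assms(3) i S'I unfolding affine_dependent_def by blast
    qed
  qed
  then show "S \<in> face_supports p I" using S'(1) by simp
qed (use face_supports_subset in auto)

lemma supporting_functional:
  assumes "finite I" "P = convex hull (p ` I)" "G \<in> face_supports p I"
    "P \<subseteq> {x. a \<bullet> x \<le> b}" "convex hull (p ` G) = P \<inter> {x. a \<bullet> x = b}"
  shows "i \<in> I \<Longrightarrow> 0 \<le> (- a) \<bullet> p i + b" "i \<in> I \<Longrightarrow> (- a) \<bullet> p i + b = 0 \<longleftrightarrow> i \<in> G"
proof -
  assume i: "i \<in> I"
  then have P: "p i \<in> P" unfolding assms(2) by (intro hull_inc imageI)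
  then show "0 \<le> (- a) \<bullet> p i + b" using assms(4) by auto
  have "(- a) \<bullet> p i + b = 0 \<longleftrightarrow> p i \<in> convex hull (p ` G)"
    using P unfolding assms(5) by auto
  then show "(- a) \<bullet> p i + b = 0 \<longleftrightarrow> i \<in> G"
    using point_in_face_iff[OF assms(1,3) i] by simp
qed

text \<open>
  The hyperplanes that witness that the new vertex is beyond one facet and beneath the others are
  just the facet functionals that the combinatorial description of stacking asks for.
\<close>

theorem stacked_polytope_realizes:
  fixes P :: "(real ^ 4) set"
  assumes "stacked_polytope 4 n P"
  shows "\<exists>\<F> p. stacked_complex n \<F> \<and> realizes n \<F> p \<and> P = convex hull (p ` {..<n + 5})"
  using assms
proof (induction rule: stacked_polytope.induct)
  case (simplex P)
  then obtain C where C: "\<not> affine_dependent C" "int (card C) = int 4 + 1" "P = convex hull C"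
    unfolding simplex_def by auto
  then have "finite C" "card C = 5" by (auto simp: aff_independent_finite)
  then obtain p where p: "bij_betw p {..<5::nat} C"
    using ex_bij_betw_nat_finite[of C] by (auto simp: atLeast0LessThan)
  then have pC: "p ` {..<5} = C" "inj_on p {..<5}" by (auto simp: bij_betw_def)
  then have "face_supports p {..<5} = Pow {..<5}"
    using face_supports_affine_independent[of "{..<5}" p] C(1) by simp
  then have "realizes 0 {S. S \<subseteq> {..<5} \<and> card S = 4} p" by (simp add: realizes_simplex_iff)
  then show ?case using stacked_complex.simplex C(3) pC(1) by (metis add_0)
next
  case (stack n P F v)
  then obtain \<F> p where IH: "stacked_complex n \<F>" "realizes n \<F> p"
    "P = convex hull (p ` {..<n + 5})" by blast
  let ?I = "{..<n + 5}"
  have face: "convex hull (p ` S) face_of P" if "S \<in> simplices \<F>" for S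
    unfolding IH(3) by (rule face_supports_imp_face[OF _ realizes_supports[OF IH(2) that]]) simp
  have dim: "aff_dim (convex hull (p ` S)) = int (card S) - 1" if "S \<in> simplices \<F>" for S
    using realizes_aff_dim_simplex[OF IH(2) that] by (simp add: aff_dim_convex_hull)
  have dimP: "aff_dim P = 4"
    using realizes_aff_dim[OF IH(1,2)] by (simp add: IH(3) aff_dim_convex_hull)
  have "F \<in> {F. F face_of convex hull (p ` ?I)}"
    using stack.hyps(2) by (simp add: facet_of_def IH(3))
  then have "F \<in> (\<lambda>S. convex hull (p ` S)) ` face_supports p ?I"
    unfolding faces_of_convex_hull[OF finite_lessThan] .
  then obtain T where T: "T \<in> face_supports p ?I" "F = convex hull (p ` T)" by blast
  have dimF: "aff_dim F = 3" using stack.hyps(2) dimP by (simp add: facet_of_def)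
  have "T \<noteq> ?I" using dimF dimP T(2) IH(3) by auto
  then have T': "T \<in> simplices \<F>" using T(1) IH(2) by (simp add: realizes_def)
  then have "card T = 4" using dim[OF T'] dimF T(2) by simp
  then have TF: "T \<in> \<F>" using facet_iff_card[OF IH(1)] T' by blast
  have "\<exists>f. affine_functional f \<and> (\<forall>i<n + 5. 0 \<le> f (p i)) \<and> (\<forall>i<n + 5. f (p i) = 0 \<longleftrightarrow> i \<in> G) \<and>
      (if G = T then f v < 0 else 0 < f v)" if G: "G \<in> \<F>" for G
  proof -
    have G': "G \<in> simplices \<F>" "card G = 4" using G facet_iff_card[OF IH(1)] by auto
    have supp: "G \<in> face_supports p ?I" by (rule realizes_supports[OF IH(2) G'(1)])
    have "\<exists>a b. P \<subseteq> {x. a \<bullet> x \<le> b} \<and> convex hull (p ` G) = P \<inter> {x. a \<bullet> x = b} \<and>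
        (if G = T then (- a) \<bullet> v + b < 0 else 0 < (- a) \<bullet> v + b)"
    proof (cases "G = T")
      case True
      then show ?thesis using stack.hyps(4) unfolding beyond_def T(2) by auto
    next
      case False
      have "convex hull (p ` G) facet_of P"
        unfolding facet_of_def using face[OF G'(1)] dim[OF G'(1)] G'(2) dimP by auto
      moreover have "convex hull (p ` G) \<noteq> F"
        unfolding T(2) using inj_onD[OF inj_on_face_hull[OF finite_lessThan] _ supp T(1)] False
        by blast
      ultimately have "beneath P (convex hull (p ` G)) v" by (rule stack.hyps(5))
      then show ?thesis using False unfolding beneath_def by auto
    qed
    then obtain a b where ab: "P \<subseteq> {x. a \<bullet> x \<le> b}" "convex hull (p ` G) = P \<inter> {x. a \<bullet> x = b}"
      "if G = T then (- a) \<bullet> v + b < 0 else 0 < (- a) \<bullet> v + b" by blast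
    have sf: "\<And>i. i \<in> ?I \<Longrightarrow> 0 \<le> (- a) \<bullet> p i + b"
      "\<And>i. i \<in> ?I \<Longrightarrow> (- a) \<bullet> p i + b = 0 \<longleftrightarrow> i \<in> G"
      using supporting_functional[OF finite_lessThan IH(3) supp ab(1,2)] by blast+
    show ?thesis
    proof (intro exI[of _ "\<lambda>x. (- a) \<bullet> x + b"] conjI allI impI)
      show "affine_functional (\<lambda>x. (- a) \<bullet> x + b)" by (rule affine_functionalI)
    qed (use sf ab(3) in \<open>simp_all only: lessThan_iff\<close>)
  qed
  then have "\<forall>G\<in>\<F>. \<exists>f. affine_functional f \<and> (\<forall>i<n + 5. 0 \<le> f (p i)) \<and>
      (\<forall>i<n + 5. f (p i) = 0 \<longleftrightarrow> i \<in> G) \<and> (if G = T then f v < 0 else 0 < f v)" by blast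
  then obtain h where h: "\<forall>G\<in>\<F>. affine_functional (h G) \<and> (\<forall>i<n + 5. 0 \<le> h G (p i)) \<and>
      (\<forall>i<n + 5. h G (p i) = 0 \<longleftrightarrow> i \<in> G) \<and> (if G = T then h G v < 0 else 0 < h G v)"
    by (rule bchoice[THEN exE])
  have "realizes (Suc n) (stack_facet (n + 5) T \<F>) (p(n + 5 := v))"
  proof (rule realizes_stack(2)[OF IH(1,2) TF, of h])
    show "h T v < 0" using h TF by auto
    show "0 < h G v" if "G \<in> \<F>" "G \<noteq> T" for G using h that by auto
  qed (use h in auto)
  moreover have "convex hull (insert v P) = convex hull ((p(n + 5 := v)) ` {..<Suc n + 5})"
  proof -
    have "{..<Suc n + 5} = insert (n + 5) ?I" by auto
    then have "(p(n + 5 := v)) ` {..<Suc n + 5} = insert v (p ` ?I)" by auto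
    then show ?thesis unfolding IH(3) by (metis hull_insert)
  qed
  ultimately show ?case using stacked_complex.stack[OF IH(1) TF] by blast
qed

section \<open>Rationality of affine functionals\<close>

definition rational_point :: "real ^ 'n \<Rightarrow> bool" where
  "rational_point x \<longleftrightarrow> (\<forall>i. x $ i \<in> \<rat>)"

lemma rational_point_add: "rational_point x \<Longrightarrow> rational_point y \<Longrightarrow> rational_point (x + y)"
  by (auto simp: rational_point_def)

lemma rational_point_diff: "rational_point x \<Longrightarrow> rational_point y \<Longrightarrow> rational_point (x - y)"
  by (auto simp: rational_point_def)

lemma rational_point_scale: "c \<in> \<rat> \<Longrightarrow> rational_point x \<Longrightarrow> rational_point (c *\<^sub>R x)"
  by (auto simp: rational_point_def)

lemma rational_point_sum: "(\<And>i. i \<in> I \<Longrightarrow> rational_point (x i)) \<Longrightarrow> rational_point (sum x I)"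
  by (auto simp: rational_point_def sum_component)

lemma rational_det:
  fixes A :: "real ^ 'n ^ 'n"
  assumes "\<And>i j. A $ i $ j \<in> \<rat>"
  shows "det A \<in> \<rat>"
  unfolding det_def using assms by (intro Rats_sum Rats_mult Rats_prod) auto

text \<open>
  The coefficients of the functional solve a linear system with rational data, so they are rational
  by Cramer's rule.
\<close>

lemma rational_affine_functional:
  fixes f :: "real ^ 'n \<Rightarrow> real" and y :: "'n \<Rightarrow> real ^ 'n"
  assumes f: "affine_functional f" "f x0 \<in> \<rat>" "\<And>k. f (y k) \<in> \<rat>"
    and y: "rational_point x0" "\<And>k. rational_point (y k)"
    and independent: "\<And>g x. affine_functional g \<Longrightarrow> g x0 = 0 \<Longrightarrow> (\<And>k. g (y k) = 0) \<Longrightarrow> g x = 0"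
    and x: "rational_point x"
  shows "f x \<in> \<rat>"
proof -
  obtain a b where ab: "f = (\<lambda>x. a \<bullet> x + b)"
    using f(1) by (auto simp: affine_functional_def)
  \<comment> \<open>the coefficients \<open>a\<close> of \<open>f\<close> solve a linear system with this matrix\<close>
  define A :: "real ^ 'n ^ 'n" where "A = (\<chi> i. y i - x0)"
  have mult: "(A *v z) $ i = z \<bullet> (y i - x0)" for z i
    by (simp add: A_def matrix_vector_mult_def inner_vec_def mult.commute)
  have "z = 0" if "A *v z = 0" for z
  proof -
    have "z \<bullet> (y i - x0) = 0" for i using mult[of z i] that by simp
    then have zero: "z \<bullet> x + (- (z \<bullet> x0)) = 0" for x
      using independent[OF affine_functionalI[of z "- (z \<bullet> x0)"], of x]
      by (simp add: inner_diff_right)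
    have "z \<bullet> z = 0" using zero[of z] zero[of 0] by simp
    then show "z = 0" by simp
  qed
  then have "invertible A"
    using matrix_left_invertible_ker[of A] invertible_left_inverse[of A] by blast
  then have det0: "det A \<noteq> 0" by (simp add: invertible_det_nz)
  have A_rat: "A $ i $ j \<in> \<rat>" for i j
    using y by (auto simp: A_def rational_point_def)
  have Aa: "(A *v a) $ i \<in> \<rat>" for i
  proof -
    have "(A *v a) $ i = f (y i) - f x0" by (simp add: mult ab inner_diff_right)
    then show ?thesis using f by auto
  qed
  have a_rat: "a $ k \<in> \<rat>" for k
  proof -
    have "a $ k = det (\<chi> i j. if j = k then (A *v a) $ i else A $ i $ j) / det A"
      using det0 by (simp add: cramer_lemma)
    moreover have "det (\<chi> i j. if j = k then (A *v a) $ i else A $ i $ j) \<in> \<rat>"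
      by (rule rational_det) (use A_rat Aa in auto)
    ultimately show ?thesis using rational_det[of A] A_rat by (auto intro: Rats_divide)
  qed
  have "f x = f x0 + (\<Sum>k\<in>UNIV. a $ k * (x $ k - x0 $ k))"
    by (simp add: ab inner_vec_def algebra_simps sum_subtractf)
  also have "\<dots> \<in> \<rat>"
    using f(2) a_rat x y(1) by (intro Rats_add Rats_sum Rats_mult Rats_diff) (auto simp: rational_point_def)
  finally show ?thesis .
qed

section \<open>Systems of truncating functionals\<close>

text \<open>
  The half-space \<open>a i \<ge> 0\<close> cuts off the vertex \<open>q i\<close>; the value \<open>-1\<close> there is a normalization. On
  the segment from \<open>q i\<close> to \<open>q k\<close>, the functional \<open>a i\<close> vanishes at the point that divides it in
  the ratio \<open>1 : a i (q k)\<close> (as weights of \<open>q k\<close> and \<open>q i\<close>), and \<open>a k\<close> at the ratio \<open>a k (q i) : 1\<close>.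
  The two points coincide exactly if \<open>a i (q k) * a k (q i) = 1\<close>, and if the product is larger, then
  the two cuts leave a part of the segment between them. So the conditions say that exactly
  one point remains of each edge, while the cuts at the ends of a diagonal do not meet. The latter
  condition keeps the truncations at different vertices independent of each other.
\<close>

locale truncation_system =
  fixes n :: nat and \<F> :: "nat set set" and q :: "nat \<Rightarrow> real ^ 4"
    and a :: "nat \<Rightarrow> real ^ 4 \<Rightarrow> real"
  assumes complex: "stacked_complex n \<F>"
    and realizes: "realizes n \<F> q"
    and a_affine: "\<And>i. i < n + 5 \<Longrightarrow> affine_functional (a i)"
    and a_self: "\<And>i. i < n + 5 \<Longrightarrow> a i (q i) = - 1"
    and a_pos: "\<And>i k. i < n + 5 \<Longrightarrow> k < n + 5 \<Longrightarrow> i \<noteq> k \<Longrightarrow> 0 < a i (q k)"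
    and a_edge: "\<And>i k. i \<noteq> k \<Longrightarrow> {i, k} \<in> simplices \<F> \<Longrightarrow> a i (q k) * a k (q i) = 1"
    and a_nonedge: "\<And>i k. i < n + 5 \<Longrightarrow> k < n + 5 \<Longrightarrow> i \<noteq> k \<Longrightarrow> {i, k} \<notin> simplices \<F> \<Longrightarrow>
        1 < a i (q k) * a k (q i)"
    and q_rational: "\<And>i. i < n + 5 \<Longrightarrow> rational_point (q i)"
    and a_rational: "\<And>i x. i < n + 5 \<Longrightarrow> rational_point x \<Longrightarrow> a i x \<in> \<rat>"
begin

abbreviation I :: "nat set" where "I \<equiv> {..<n + 5}"

definition edges :: "nat set set" where
  "edges = {e \<in> simplices \<F>. card e = 2}"

text \<open>
  The common zero of \<open>a i\<close> and \<open>a k\<close> on the edge \<open>{i, k}\<close>. The order of the vertices serves to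
  choose one of two formulas for the same point.
\<close>

definition edge_point :: "nat set \<Rightarrow> real ^ 4" where
  "edge_point e = (let i = Min e; k = Max e in
     (1 / (1 + a k (q i))) *\<^sub>R q i + (a k (q i) / (1 + a k (q i))) *\<^sub>R q k)"

lemma edge_vertices:
  assumes "{i, k} \<in> simplices \<F>"
  shows "i < n + 5" "k < n + 5"
  using stacked_complex_finite(5)[OF complex assms] by auto

lemma edgeE:
  assumes "e \<in> edges"
  obtains i k where "e = {i, k}" "i \<noteq> k" "{i, k} \<in> simplices \<F>" "i < n + 5" "k < n + 5"
  using assms edge_vertices by (auto simp: edges_def card_2_iff)

lemma edge_point_eq:
  assumes "i \<noteq> k" "{i, k} \<in> simplices \<F>"
  shows "edge_point {i, k} =
    (1 / (1 + a k (q i))) *\<^sub>R q i + (a k (q i) / (1 + a k (q i))) *\<^sub>R q k"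
proof (cases "i < k")
  case True
  then show ?thesis by (simp add: edge_point_def)
next
  case False
  then have "k < i" using assms(1) by simp
  have pos: "0 < a i (q k)" "0 < a k (q i)"
    using a_pos edge_vertices[OF assms(2)] assms(1) by auto
  have prod: "a i (q k) * a k (q i) = 1" by (rule a_edge[OF assms])
  then have inv: "a i (q k) = 1 / a k (q i)" using pos by (simp add: field_simps)
  have "1 / (1 + a i (q k)) = a k (q i) / (1 + a k (q i))"
    "a i (q k) / (1 + a i (q k)) = 1 / (1 + a k (q i))"
    using pos by (simp_all add: inv field_simps)
  moreover have "edge_point {i, k} =
      (1 / (1 + a i (q k))) *\<^sub>R q k + (a i (q k) / (1 + a i (q k))) *\<^sub>R q i"
    using \<open>k < i\<close> by (simp add: edge_point_def)
  ultimately show ?thesis by (simp add: add.commute)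
qed

lemma edge_point_combination:
  assumes "i \<noteq> k" "{i, k} \<in> simplices \<F>"
  obtains s t where "edge_point {i, k} = s *\<^sub>R q i + t *\<^sub>R q k" "s + t = 1" "0 < s" "0 < t"
    "s = 1 / (1 + a k (q i))" "t = a k (q i) / (1 + a k (q i))"
proof -
  have "0 < a k (q i)" using a_pos edge_vertices[OF assms(2)] assms(1) by auto
  then have "1 / (1 + a k (q i)) + a k (q i) / (1 + a k (q i)) = 1"
    by (simp add: add_divide_distrib[symmetric])
  with \<open>0 < a k (q i)\<close> show ?thesis
    by (intro that[OF edge_point_eq[OF assms]]) auto
qed

lemma edge_point_functional:
  assumes "i \<noteq> k" "{i, k} \<in> simplices \<F>"
  obtains s t where "0 < s" "0 < t" "\<And>f. affine_functional f \<Longrightarrow> f (edge_point {i, k}) = s * f (q i) + t * f (q k)"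
  using edge_point_combination[OF assms] affine_functional_combination2 by metis

lemma edge_point_in_hull:
  assumes "e \<in> edges" "e \<subseteq> S"
  shows "edge_point e \<in> convex hull (q ` S)"
proof -
  obtain i k where ik: "e = {i, k}" "i \<noteq> k" "{i, k} \<in> simplices \<F>" by (rule edgeE[OF assms(1)])
  obtain s t where st: "edge_point {i, k} = s *\<^sub>R q i + t *\<^sub>R q k" "s + t = 1" "0 < s" "0 < t"
    by (rule edge_point_combination[OF ik(2,3)])
  have "q i \<in> convex hull (q ` S)" "q k \<in> convex hull (q ` S)"
    using assms(2) ik(1) by (auto intro!: hull_inc)
  then show ?thesis
    unfolding ik(1) st(1) using st(2-4) by (intro convexD) auto
qed

lemma edge_subset: "e \<in> edges \<Longrightarrow> e \<subseteq> I"
  by (metis (no_types, lifting) edges_def mem_Collect_eq stacked_complex_finite(5)[OF complex])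

lemma edge_point_rational:
  assumes "e \<in> edges"
  shows "rational_point (edge_point e)"
proof -
  obtain i k where ik: "e = {i, k}" "i \<noteq> k" "{i, k} \<in> simplices \<F>" "i < n + 5" "k < n + 5"
    by (rule edgeE[OF assms])
  have "a k (q i) \<in> \<rat>" by (rule a_rational[OF ik(5) q_rational[OF ik(4)]])
  then show ?thesis
    unfolding ik(1) edge_point_eq[OF ik(2,3)]
    by (intro rational_point_add rational_point_scale q_rational ik) auto
qed

lemma functional_nonneg_at_edge_point:
  assumes "affine_functional f" "\<And>i. i < n + 5 \<Longrightarrow> 0 \<le> f (q i)"
    "\<And>i. i < n + 5 \<Longrightarrow> f (q i) = 0 \<longleftrightarrow> i \<in> S" "e \<in> edges"
  shows "0 \<le> f (edge_point e)" "f (edge_point e) = 0 \<longleftrightarrow> e \<subseteq> S"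
proof -
  obtain i k where ik: "e = {i, k}" "i \<noteq> k" "{i, k} \<in> simplices \<F>" "i < n + 5" "k < n + 5"
    by (rule edgeE[OF assms(4)])
  obtain s t where st: "0 < s" "0 < t" "f (edge_point {i, k}) = s * f (q i) + t * f (q k)"
    using edge_point_functional[OF ik(2,3)] assms(1) by metis
  have nn: "0 \<le> s * f (q i)" "0 \<le> t * f (q k)"
    using st assms(2) ik by simp_all
  show "0 \<le> f (edge_point e)" unfolding ik(1) st(3) using nn by simp
  have "f (edge_point e) = 0 \<longleftrightarrow> f (q i) = 0 \<and> f (q k) = 0"
    unfolding ik(1) st(3) using nn st by (simp add: add_nonneg_eq_0_iff)
  then show "f (edge_point e) = 0 \<longleftrightarrow> e \<subseteq> S" using assms(3) ik by auto
qed

lemma a_edge_point: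
  assumes "j < n + 5" "e \<in> edges"
  shows "0 \<le> a j (edge_point e)" "a j (edge_point e) = 0 \<longleftrightarrow> j \<in> e"
proof -
  obtain i k where ik: "e = {i, k}" "i \<noteq> k" "{i, k} \<in> simplices \<F>" "i < n + 5" "k < n + 5"
    by (rule edgeE[OF assms(2)])
  have "0 < a k (q i)" using a_pos ik by auto
  have zero: "a x (edge_point {x, y}) = 0" if edge: "x \<noteq> y" "{x, y} \<in> simplices \<F>" for x y
  proof -
    have xy: "x < n + 5" "y < n + 5" using edge_vertices[OF edge(2)] by auto
    obtain s t where st: "edge_point {x, y} = s *\<^sub>R q x + t *\<^sub>R q y" "s + t = 1" "0 < s" "0 < t"
      "s = 1 / (1 + a y (q x))" "t = a y (q x) / (1 + a y (q x))"
      by (rule edge_point_combination[OF edge])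
    have "a x (edge_point {x, y}) = s * a x (q x) + t * a x (q y)"
      unfolding st(1) by (rule affine_functional_combination2[OF a_affine[OF xy(1)] st(2)])
    also have "\<dots> = (a x (q y) * a y (q x) - 1) / (1 + a y (q x))"
      by (simp add: st(5,6) a_self[OF xy(1)] diff_divide_distrib mult.commute)
    finally show ?thesis using a_edge[OF edge] by simp
  qed
  have "a j (edge_point e) = 0" if "j \<in> e"
  proof (cases "j = i")
    case True
    then show ?thesis using zero[of i k] ik by simp
  next
    case False
    then have "j = k" using that ik(1) by simp
    then show ?thesis using zero[of k i] ik by (simp add: insert_commute)
  qed
  moreover have "0 < a j (edge_point e)" if "j \<notin> e"
  proof -
    obtain s t where st: "0 < s" "0 < t" "a j (edge_point {i, k}) = s * a j (q i) + t * a j (q k)"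
      using edge_point_functional[OF ik(2,3)] a_affine[OF assms(1)] by metis
    have "0 < a j (q i)" "0 < a j (q k)" using a_pos assms(1) ik that by auto
    then show ?thesis unfolding ik(1) st(3) using st by (simp add: add_pos_pos)
  qed
  ultimately show "0 \<le> a j (edge_point e)" "a j (edge_point e) = 0 \<longleftrightarrow> j \<in> e"
    by (cases "j \<in> e"; auto)+
qed

end

section \<open>Existence of rational truncation systems\<close>

text \<open>
  In the standard simplex with barycentric coordinates \<open>\<mu>\<close> the functionals \<open>1 - 2 \<mu> i\<close> cut all the
  edges at their midpoints.
\<close>

lemma truncation_system_simplex:
  "\<exists>q a. truncation_system 0 {S. S \<subseteq> {..<5} \<and> card S = 4} q a"
proof -
  obtain \<beta> :: "nat \<Rightarrow> 4" where \<beta>: "bij_betw \<beta> {..<4} UNIV"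
    using ex_bij_betw_nat_finite[of "UNIV :: 4 set"] by (auto simp: atLeast0LessThan)
  have inj: "\<beta> i = \<beta> k \<longleftrightarrow> i = k" if "i < 4" "k < 4" for i k
    using \<beta> that by (auto simp: bij_betw_def dest: inj_onD)
  define q :: "nat \<Rightarrow> real ^ 4" where "q i = (if i < 4 then axis (\<beta> i) 1 else 0)" for i
  define \<mu> :: "nat \<Rightarrow> real ^ 4 \<Rightarrow> real"
    where "\<mu> i x = (if i < 4 then x $ \<beta> i else 1 - (\<Sum>k\<in>UNIV. x $ k))" for i x
  have \<mu>_affine: "affine_functional (\<mu> i)" for i
  proof (cases "i < 4")
    case True
    then have "\<mu> i = (\<lambda>x. axis (\<beta> i) 1 \<bullet> x + 0)"
      by (auto simp: \<mu>_def inner_axis' fun_eq_iff)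
    then show ?thesis by (simp only: affine_functionalI)
  next
    case False
    then have "\<mu> i = (\<lambda>x. (- 1) \<bullet> x + 1)"
      by (auto simp: \<mu>_def inner_vec_def fun_eq_iff sum_negf)
    then show ?thesis by (simp only: affine_functionalI)
  qed
  have \<mu>_q: "\<mu> i (q k) = (if i = k then 1 else 0)" if "i < 5" "k < 5" for i k
  proof -
    have "i = 4" if "\<not> i < 4" using that \<open>i < 5\<close> by simp
    moreover have "k = 4" if "\<not> k < 4" using that \<open>k < 5\<close> by simp
    moreover have "(\<Sum>j\<in>UNIV. axis (\<beta> k) (1::real) $ j) = 1"
      by (simp add: axis_def)
    ultimately show ?thesis
      using inj[of i k] by (auto simp: \<mu>_def q_def axis_def)
  qed
  have "S \<in> face_supports q {..<5}" if S: "S \<subseteq> {..<5}" for S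
  proof (rule face_supportsI[of "\<lambda>x. \<Sum>i\<in>{..<5} - S. \<mu> i x"])
    show "affine_functional (\<lambda>x. \<Sum>i\<in>{..<5} - S. \<mu> i x)"
      by (intro affine_functional_sum \<mu>_affine)
    have eq: "(\<Sum>i\<in>{..<5} - S. \<mu> i (q k)) = (if k \<in> S then 0 else 1)" if "k \<in> {..<5}" for k
    proof -
      have "(\<Sum>i\<in>{..<5} - S. \<mu> i (q k)) = (\<Sum>i\<in>{..<5} - S. if i = k then 1 else 0)"
        using that by (intro sum.cong) (auto simp: \<mu>_q)
      then show ?thesis using that by simp
    qed
    show "0 \<le> (\<Sum>i\<in>{..<5} - S. \<mu> i (q k))" if "k \<in> {..<5}" for k
      using eq[OF that] by simp
    show "(\<Sum>i\<in>{..<5} - S. \<mu> i (q k)) = 0 \<longleftrightarrow> k \<in> S" if "k \<in> {..<5}" for k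
      using eq[OF that] by simp
  qed (rule S)
  then have supp: "face_supports q {..<5} = Pow {..<5}"
    using face_supports_subset by blast
  define a where "a i x = 1 + (- 2) * \<mu> i x" for i x
  have a_q: "a i (q k) = (if i = k then - 1 else 1)" if "i < 5" "k < 5" for i k
    using \<mu>_q[OF that] by (simp add: a_def)
  have "truncation_system 0 {S. S \<subseteq> {..<5} \<and> card S = 4} q a"
  proof
    show "stacked_complex 0 {S. S \<subseteq> {..<5} \<and> card S = 4}" by (rule stacked_complex.simplex)
    show "realizes 0 {S. S \<subseteq> {..<5} \<and> card S = 4} q" by (simp add: realizes_simplex_iff supp)
    show "affine_functional (a i)" for i
      unfolding a_def by (intro affine_functional_add affine_functional_cmul affine_functional_const \<mu>_affine)
    show "a i (q i) = - 1" if "i < 0 + 5" for i using a_q[of i i] that by simp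
    show "0 < a i (q k)" if "i < 0 + 5" "k < 0 + 5" "i \<noteq> k" for i k
      using a_q[of i k] that by simp
    show "a i (q k) * a k (q i) = 1"
      if "i \<noteq> k" "{i, k} \<in> simplices {S. S \<subseteq> {..<5} \<and> card S = 4}" for i k
    proof -
      have "i < 5" "k < 5" using that(2) by (auto simp: simplices_boundary_of_simplex)
      then show ?thesis using a_q that(1) by simp
    qed
    show "1 < a i (q k) * a k (q i)"
      if "i < 0 + 5" "k < 0 + 5" "i \<noteq> k" "{i, k} \<notin> simplices {S. S \<subseteq> {..<5} \<and> card S = 4}" for i k
    proof -
      have "{i, k} \<subseteq> {..<5}" using that by simp
      moreover have "{i, k} \<noteq> {..<5}"
      proof
        assume "{i, k} = {..<5}"
        then have "card {i, k} = 5" by simp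
        then show False using that(3) by simp
      qed
      ultimately have "{i, k} \<in> simplices {S. S \<subseteq> {..<5} \<and> card S = 4}"
        unfolding simplices_boundary_of_simplex by blast
      then show ?thesis using that(4) by contradiction
    qed
    show "rational_point (q i)" for i by (auto simp: rational_point_def q_def axis_def)
    show "a i x \<in> \<rat>" if "rational_point x" for i x
    proof -
      have "(\<Sum>k\<in>UNIV. x $ k) \<in> \<rat>" "x $ \<beta> i \<in> \<rat>"
        using that by (auto simp: rational_point_def)
      then have "\<mu> i x \<in> \<rat>" by (auto simp: \<mu>_def)
      then show ?thesis unfolding a_def by (intro Rats_add Rats_mult) auto
    qed
  qed
  then show ?thesis by blast
qed

context truncation_system
begin

lemma facet_functionals:
  "\<exists>h. \<forall>G\<in>\<F>. affine_functional (h G) \<and> (\<forall>i<n + 5. 0 \<le> h G (q i)) \<and>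
    (\<forall>i<n + 5. h G (q i) = 0 \<longleftrightarrow> i \<in> G)"
proof -
  have "\<exists>f. affine_functional f \<and> (\<forall>i<n + 5. 0 \<le> f (q i)) \<and> (\<forall>i<n + 5. f (q i) = 0 \<longleftrightarrow> i \<in> G)"
    if "G \<in> \<F>" for G
    using face_supportsE[OF realizes_supports[OF realizes simplices_facet[OF that]]] lessThan_iff
    by metis
  then have "\<forall>G\<in>\<F>. \<exists>f. affine_functional f \<and> (\<forall>i<n + 5. 0 \<le> f (q i)) \<and>
      (\<forall>i<n + 5. f (q i) = 0 \<longleftrightarrow> i \<in> G)" by blast
  then show ?thesis by (rule bchoice)
qed

lemma facet_pair_edge:
  assumes "T \<in> \<F>" "i \<in> T" "k \<in> T" "i \<noteq> k"
  shows "{i, k} \<in> edges"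
  using assms by (auto simp: edges_def simplices_def)

lemma finite_edges: "finite edges"
  using stacked_complex_finite(2)[OF complex] by (simp add: edges_def)

text \<open>
  The centroid of the edge points of a facet lies in the interior of the facet and strictly inside
  all the truncating half-spaces: a tetrahedron has an edge that avoids a given vertex, and one that
  is not contained in a given other facet.
\<close>

lemma inner_point_of_facet:
  assumes T: "T \<in> \<F>"
  shows "\<exists>c. rational_point c \<and> (\<forall>i<n + 5. 0 < a i c) \<and>
    (\<forall>f. affine_functional f \<longrightarrow> (\<forall>i\<in>T. f (q i) = 0) \<longrightarrow> f c = 0) \<and>
    (\<forall>f i. affine_functional f \<longrightarrow> (\<forall>i\<in>T. 0 \<le> f (q i)) \<longrightarrow> i \<in> T \<longrightarrow> 0 < f (q i) \<longrightarrow> 0 < f c)"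
proof -
  define E where "E = {e \<in> edges. e \<subseteq> T}"
  have T4: "card T = 4" "T \<subseteq> I" "finite T"
    using stacked_complex_facet[OF complex T] stacked_complex_finite(3)[OF complex T] by auto
  have finE: "finite E" using finite_edges by (simp add: E_def)
  have pair: "{i, k} \<in> E" if "i \<in> T" "k \<in> T" "i \<noteq> k" for i k
    using facet_pair_edge[OF T that] that by (auto simp: E_def)
  have other: "\<exists>k l. k \<in> T \<and> l \<in> T \<and> k \<noteq> l \<and> k \<noteq> i \<and> l \<noteq> i" for i
  proof -
    have "card (T - {i}) \<ge> 3" using T4 by (cases "i \<in> T") (auto simp: card_Diff_singleton)
    then have "2 \<le> card (T - {i})" by simp
    then obtain A where A: "A \<subseteq> T - {i}" "card A = 2" by (rule obtain_subset_with_card_n)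
    then obtain k l where "A = {k, l}" "k \<noteq> l" by (auto simp: card_2_iff)
    then show ?thesis using A(1) by blast
  qed
  obtain k0 l0 where kl0: "k0 \<in> T" "l0 \<in> T" "k0 \<noteq> l0" using other by blast
  have cardE: "0 < card E" using pair[OF kl0] finE by (auto simp: card_gt_0_iff)
  define c where "c = (\<Sum>e\<in>E. (1 / real (card E)) *\<^sub>R edge_point e)"
  have c: "f c = (\<Sum>e\<in>E. f (edge_point e)) / real (card E)" if "affine_functional f" for f
  proof -
    have "f c = (\<Sum>e\<in>E. 1 / real (card E) * f (edge_point e))"
      unfolding c_def by (rule affine_functional_combination[OF that finE]) (use cardE in simp)
    then show ?thesis by (simp add: sum_divide_distrib)
  qed
  have pos: "0 < f c" if f: "affine_functional f" "\<And>e. e \<in> E \<Longrightarrow> 0 \<le> f (edge_point e)"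
    "e \<in> E" "0 < f (edge_point e)" for f e
  proof -
    have "0 < (\<Sum>e\<in>E. f (edge_point e))"
      using f by (intro sum_pos2[OF finE, of e]) auto
    then show ?thesis using c[OF f(1)] cardE by simp
  qed
  show ?thesis
  proof (intro exI[of _ c] conjI allI impI)
    show "rational_point c"
      unfolding c_def
      by (intro rational_point_sum rational_point_scale edge_point_rational) (auto simp: E_def)
    show "0 < a i c" if i: "i < n + 5" for i
    proof -
      obtain k l where kl: "k \<in> T" "l \<in> T" "k \<noteq> l" "k \<noteq> i" "l \<noteq> i" using other by blast
      have kl': "{k, l} \<in> edges" using pair[OF kl(1-3)] by (simp add: E_def)
      show ?thesis
      proof (rule pos[OF a_affine[OF i] _ pair[OF kl(1-3)]])
        show "0 \<le> a i (edge_point e)" if "e \<in> E" for e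
          using a_edge_point(1)[OF i, of e] that by (simp add: E_def)
        have "a i (edge_point {k, l}) \<noteq> 0" using a_edge_point(2)[OF i kl'] kl by simp
        then show "0 < a i (edge_point {k, l})" using a_edge_point(1)[OF i kl'] by simp
      qed
    qed
    show "f c = 0" if f: "affine_functional f" "\<forall>i\<in>T. f (q i) = 0" for f
    proof -
      have "f (edge_point e) = 0" if e: "e \<in> E" for e
      proof -
        have "e \<in> edges" using e by (simp add: E_def)
        then obtain i k where ik: "e = {i, k}" "i \<noteq> k" "{i, k} \<in> simplices \<F>"
          by (rule edgeE)
        obtain s t where "f (edge_point {i, k}) = s * f (q i) + t * f (q k)"
          using edge_point_functional[OF ik(2,3)] f(1) by metis
        moreover have "i \<in> T" "k \<in> T" using e ik(1) by (auto simp: E_def)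
        ultimately show ?thesis using f(2) ik(1) by simp
      qed
      then show ?thesis using c[OF f(1)] by simp
    qed
    show "0 < f c" if f: "affine_functional f" "\<forall>i\<in>T. 0 \<le> f (q i)" "i \<in> T" "0 < f (q i)" for f i
    proof -
      obtain k where k: "k \<in> T" "k \<noteq> i" using other[of i] by blast
      have comb: "\<exists>s t. 0 < s \<and> 0 < t \<and> f (edge_point {x, y}) = s * f (q x) + t * f (q y)"
        if "{x, y} \<in> E" "x \<noteq> y" for x y
      proof -
        have "{x, y} \<in> simplices \<F>" using that by (simp add: E_def edges_def)
        then show ?thesis using edge_point_functional[OF that(2)] f(1) by metis
      qed
      have ik: "{i, k} \<in> E" using pair f(3) k by auto
      show ?thesis
      proof (rule pos[OF f(1) _ ik])
        show "0 \<le> f (edge_point e)" if e: "e \<in> E" for e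
        proof -
          have "e \<in> edges" using e by (simp add: E_def)
          then obtain x y where xy: "e = {x, y}" "x \<noteq> y"
            by (rule edgeE)
          then obtain s t where "0 < s" "0 < t" "f (edge_point {x, y}) = s * f (q x) + t * f (q y)"
            using comb[of x y] \<open>e \<in> E\<close> by blast
          moreover have "x \<in> T" "y \<in> T" using e xy by (auto simp: E_def)
          ultimately show ?thesis using f(2) xy by simp
        qed
        obtain s t where "0 < s" "0 < t" "f (edge_point {i, k}) = s * f (q i) + t * f (q k)"
          using comb[OF ik] k by blast
        then show "0 < f (edge_point {i, k})" using f(2) k(1) f(4) by (simp add: add_pos_nonneg)
      qed
    qed
  qed
qed

text \<open>
  The new vertex \<open>v\<close> is placed slightly beyond \<open>T\<close>, near the centroid \<open>c\<close> of the edge points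
  of \<open>T\<close>, in the direction away from an old vertex \<open>q j\<close>. The half-spaces at the vertices of \<open>T\<close>
  prescribe one point on each of the four new edges, and a hyperplane in dimension four can be made to
  pass through these four points: the functional \<open>l\<close> is determined by its values at the five
  vertices \<open>v\<close> and \<open>q i\<close>, \<open>i \<in> T\<close>. As \<open>v\<close> approaches \<open>c\<close>, this hyperplane approaches the one
  of \<open>T\<close> and the values of \<open>l\<close> at all the other vertices tend to infinity, so the inequalities for
  the diagonals at \<open>v\<close> hold. Rational parameters \<open>\<epsilon>\<close> give rational data.
\<close>

theorem truncation_system_stack:
  assumes T: "T \<in> \<F>"
  shows "\<exists>q' a'. truncation_system (Suc n) (stack_facet (n + 5) T \<F>) q' a'"
proof -
  have T4: "card T = 4" "T \<subseteq> I" "finite T"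
    using stacked_complex_facet[OF complex T] stacked_complex_finite(3)[OF complex T] by auto
  have "T \<noteq> I" using whole_not_simplex[OF complex] simplices_facet[OF T] by auto
  then obtain j where j: "j < n + 5" "j \<notin> T" using T4(2) by blast
  obtain h where "\<forall>G\<in>\<F>. affine_functional (h G) \<and> (\<forall>i<n + 5. 0 \<le> h G (q i)) \<and>
      (\<forall>i<n + 5. h G (q i) = 0 \<longleftrightarrow> i \<in> G)"
    using facet_functionals by (rule exE)
  then have h: "\<And>G. G \<in> \<F> \<Longrightarrow> affine_functional (h G)"
    "\<And>G i. G \<in> \<F> \<Longrightarrow> i < n + 5 \<Longrightarrow> 0 \<le> h G (q i)"
    "\<And>G i. G \<in> \<F> \<Longrightarrow> i < n + 5 \<Longrightarrow> h G (q i) = 0 \<longleftrightarrow> i \<in> G"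
    by simp_all
  have h_pos: "0 < h G (q i)" if "G \<in> \<F>" "i < n + 5" "i \<notin> G" for G i
    using h(2,3)[OF that(1,2)] that(3) by (simp add: order_less_le)
  obtain c where c: "rational_point c" "\<forall>i<n + 5. 0 < a i c"
    "\<forall>f. affine_functional f \<longrightarrow> (\<forall>i\<in>T. f (q i) = 0) \<longrightarrow> f c = 0"
    "\<forall>f i. affine_functional f \<longrightarrow> (\<forall>i\<in>T. 0 \<le> f (q i)) \<longrightarrow> i \<in> T \<longrightarrow> 0 < f (q i) \<longrightarrow> 0 < f c"
    using inner_point_of_facet[OF T] by (elim exE conjE) (rule that)
  have c_T: "h T c = 0"
  proof (rule c(3)[rule_format, OF h(1)[OF T]])
    show "h T (q i) = 0" if "i \<in> T" for i using h(3)[OF T, of i] that T4(2) by auto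
  qed
  have c_G: "0 < h G c" if "G \<in> \<F>" "G \<noteq> T" for G
  proof -
    have "\<not> T \<subseteq> G" using facet_antichain[OF complex T that(1)] that(2) by blast
    then obtain i where i: "i \<in> T" "i \<notin> G" by blast
    have "\<forall>k\<in>T. 0 \<le> h G (q k)" using T4(2) h(2)[OF that(1)] by auto
    moreover have "0 < h G (q i)" using T4(2) h_pos[OF that(1) _ i(2)] i(1) by auto
    ultimately show ?thesis
      by (intro c(4)[rule_format, OF h(1)[OF that(1)] _ i(1)]) auto
  qed
  have "\<exists>G. G \<in> \<F> \<and> G \<noteq> T \<and> G \<inter> T = T - {i}" if "i \<in> T" for i
    using ridge_closedE[OF stacked_complex_ridge_closed[OF complex] T that] by metis
  then obtain N where N: "\<And>i. i \<in> T \<Longrightarrow> N i \<in> \<F> \<and> N i \<noteq> T \<and> N i \<inter> T = T - {i}"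
    by metis
  have N_in: "N i \<in> \<F>" if "i \<in> T" for i using N[OF that] by simp
  have N_pos: "0 < h (N i) (q i)" if "i \<in> T" for i
    using h_pos[OF N_in[OF that], of i] N[OF that] that T4(2) by blast
  have N_zero: "h (N i) (q k) = 0" if "i \<in> T" "k \<in> T" "k \<noteq> i" for i k
    using h(3)[OF N_in[OF that(1)], of k] N[OF that(1)] that T4(2) by blast
  \<comment> \<open>extensions of the barycentric coordinates of the facet\<close>
  define \<mu> where "\<mu> i x = 1 / h (N i) (q i) * h (N i) x" for i x
  have \<mu>_affine: "affine_functional (\<mu> i)" if "i \<in> T" for i
    unfolding \<mu>_def by (intro affine_functional_cmul h(1) N_in that)
  have \<mu>_q: "\<mu> i (q k) = (if k = i then 1 else 0)" if "i \<in> T" "k \<in> T" for i k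
    using N_pos[OF that(1)] N_zero[OF that] by (simp add: \<mu>_def)
  have \<mu>_c: "0 < \<mu> i c" if "i \<in> T" for i
    using c_G[OF N_in[OF that]] N[OF that] N_pos[OF that] by (simp add: \<mu>_def)
  define v where "v \<epsilon> = c + \<epsilon> *\<^sub>R (c - q j)" for \<epsilon> :: real
  \<comment> \<open>the functional \<open>u \<epsilon>\<close> has the right values on \<open>T\<close>, and \<open>\<kappa> \<epsilon>\<close> corrects the value at the new vertex\<close>
  define u where "u \<epsilon> x = (\<Sum>i\<in>T. 1 / a i (v \<epsilon>) * \<mu> i x)" for \<epsilon> x
  define \<kappa> where "\<kappa> \<epsilon> = (1 + u \<epsilon> (v \<epsilon>)) / (\<epsilon> * h T (q j))" for \<epsilon>
  define l where "l \<epsilon> x = u \<epsilon> x + \<kappa> \<epsilon> * h T x" for \<epsilon> x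
  let ?F = "at_right (0::real)"
  have hTj: "0 < h T (q j)" by (rule h_pos[OF T j])
  have f_v: "f (v \<epsilon>) = (1 + \<epsilon>) * f c - \<epsilon> * f (q j)" if "affine_functional f" for f \<epsilon>
  proof -
    have "v \<epsilon> = (1 + \<epsilon>) *\<^sub>R c + (- \<epsilon>) *\<^sub>R q j"
      by (simp add: v_def algebra_simps)
    then show ?thesis using affine_functional_combination2[OF that, of "1 + \<epsilon>" "- \<epsilon>" c "q j"] by simp
  qed
  have v_lim: "(v \<longlongrightarrow> c) ?F"
  proof -
    have "((\<lambda>\<epsilon>. c + \<epsilon> *\<^sub>R (c - q j)) \<longlongrightarrow> c + 0 *\<^sub>R (c - q j)) ?F"
      by (intro tendsto_intros)
    then show ?thesis by (simp add: v_def[abs_def])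
  qed
  have lim: "((\<lambda>\<epsilon>. f (v \<epsilon>)) \<longlongrightarrow> f c) ?F" if "affine_functional f" for f
    by (rule tendsto_affine_functional[OF that v_lim])
  have ev_pos: "eventually (\<lambda>\<epsilon>. 0 < f (v \<epsilon>)) ?F" if "affine_functional f" "0 < f c" for f
    by (rule order_tendstoD(1)[OF lim[OF that(1)] that(2)])
  have u_lim: "((\<lambda>\<epsilon>. u \<epsilon> x) \<longlongrightarrow> (\<Sum>i\<in>T. 1 / a i c * \<mu> i x)) ?F" for x
    unfolding u_def using T4(2) c(2) by (intro tendsto_intros lim a_affine) (auto simp: less_imp_neq[symmetric])
  have uv_lim: "((\<lambda>\<epsilon>. u \<epsilon> (v \<epsilon>)) \<longlongrightarrow> (\<Sum>i\<in>T. 1 / a i c * \<mu> i c)) ?F" (is "(_ \<longlongrightarrow> ?U) _")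
    unfolding u_def using T4(2) c(2)
    by (intro tendsto_intros lim a_affine \<mu>_affine) (auto simp: less_imp_neq[symmetric])
  have U: "0 \<le> ?U"
    using c(2) \<mu>_c T4(2) by (intro sum_nonneg mult_nonneg_nonneg) (auto intro!: less_imp_le)
  have l_lim: "filterlim (\<lambda>\<epsilon>. l \<epsilon> (q w)) at_top ?F" if w: "w < n + 5" "w \<notin> T" for w
  proof -
    have "0 < h T (q w) / h T (q j)" using h_pos[OF T w] hTj by simp
    then have pos: "0 < (1 + ?U) * (h T (q w) / h T (q j))" using U by (intro mult_pos_pos) auto
    have "((\<lambda>\<epsilon>. (1 + u \<epsilon> (v \<epsilon>)) * (h T (q w) / h T (q j))) \<longlongrightarrow>
        (1 + ?U) * (h T (q w) / h T (q j))) ?F"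
      by (intro tendsto_mult tendsto_add tendsto_const uv_lim)
    then have "filterlim (\<lambda>\<epsilon>. (1 + u \<epsilon> (v \<epsilon>)) * (h T (q w) / h T (q j)) * inverse \<epsilon>) at_top ?F"
      by (rule filterlim_tendsto_pos_mult_at_top[OF _ pos filterlim_inverse_at_top_right])
    then have "filterlim (\<lambda>\<epsilon>. u \<epsilon> (q w) +
        (1 + u \<epsilon> (v \<epsilon>)) * (h T (q w) / h T (q j)) * inverse \<epsilon>) at_top ?F"
      by (rule filterlim_tendsto_add_at_top[OF u_lim])
    moreover have "l \<epsilon> (q w) = u \<epsilon> (q w) + (1 + u \<epsilon> (v \<epsilon>)) * (h T (q w) / h T (q j)) * inverse \<epsilon>" for \<epsilon>
      by (simp add: l_def \<kappa>_def divide_inverse mult_ac)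
    ultimately show ?thesis by simp
  qed
  have ev1: "eventually (\<lambda>\<epsilon>. \<forall>i\<in>I. 0 < a i (v \<epsilon>)) ?F"
    by (intro eventually_ball_finite ballI ev_pos a_affine c(2)[rule_format]) auto
  have ev2: "eventually (\<lambda>\<epsilon>. \<forall>G\<in>\<F> - {T}. 0 < h G (v \<epsilon>)) ?F"
    using stacked_complex_finite(1)[OF complex]
    by (intro eventually_ball_finite ballI ev_pos h(1) c_G) auto
  have ev3: "eventually (\<lambda>\<epsilon>. \<forall>w\<in>I - T. 0 < l \<epsilon> (q w)) ?F"
    using l_lim unfolding filterlim_at_top_dense by (intro eventually_ball_finite ballI) auto
  have ev4: "eventually (\<lambda>\<epsilon>. \<forall>w\<in>I - T. 1 < l \<epsilon> (q w) * a w (v \<epsilon>)) ?F"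
  proof (intro eventually_ball_finite ballI)
    fix w assume w: "w \<in> I - T"
    then have "filterlim (\<lambda>\<epsilon>. l \<epsilon> (q w) * a w (v \<epsilon>)) at_top ?F"
      using filterlim_at_top_mult_tendsto_pos[OF lim[OF a_affine, of w] c(2)[rule_format, of w] l_lim[of w]] by simp
    then show "eventually (\<lambda>\<epsilon>. 1 < l \<epsilon> (q w) * a w (v \<epsilon>)) ?F"
      unfolding filterlim_at_top_dense by blast
  qed simp
  have "eventually (\<lambda>\<epsilon>. (\<forall>i\<in>I. 0 < a i (v \<epsilon>)) \<and> (\<forall>G\<in>\<F> - {T}. 0 < h G (v \<epsilon>)) \<and>
      (\<forall>w\<in>I - T. 0 < l \<epsilon> (q w)) \<and> (\<forall>w\<in>I - T. 1 < l \<epsilon> (q w) * a w (v \<epsilon>))) ?F"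
    using ev1 ev2 ev3 ev4 by (intro eventually_conj)
  then obtain b where b: "0 < b" "\<And>\<epsilon>. 0 < \<epsilon> \<Longrightarrow> \<epsilon> < b \<Longrightarrow>
      (\<forall>i\<in>I. 0 < a i (v \<epsilon>)) \<and> (\<forall>G\<in>\<F> - {T}. 0 < h G (v \<epsilon>)) \<and>
      (\<forall>w\<in>I - T. 0 < l \<epsilon> (q w)) \<and> (\<forall>w\<in>I - T. 1 < l \<epsilon> (q w) * a w (v \<epsilon>))"
    unfolding eventually_at_right_field by blast
  obtain \<epsilon> where \<epsilon>: "\<epsilon> \<in> \<rat>" "0 < \<epsilon>" "\<epsilon> < b" using Rats_dense_in_real[OF b(1)] by blast
  have av: "0 < a i (v \<epsilon>)" if "i < n + 5" for i using b(2)[OF \<epsilon>(2,3)] that by simp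
  have hv: "0 < h G (v \<epsilon>)" if "G \<in> \<F>" "G \<noteq> T" for G using b(2)[OF \<epsilon>(2,3)] that by simp
  have lw: "0 < l \<epsilon> (q w)" "1 < l \<epsilon> (q w) * a w (v \<epsilon>)" if "w < n + 5" "w \<notin> T" for w
    using b(2)[OF \<epsilon>(2,3)] that by simp_all
  have hTv: "h T (v \<epsilon>) = - \<epsilon> * h T (q j)" using f_v[OF h(1)[OF T], of \<epsilon>] c_T by simp
  then have hTv_neg: "h T (v \<epsilon>) < 0" using hTj \<epsilon>(2) by simp
  have u_affine: "affine_functional (u \<epsilon>)"
    unfolding u_def by (intro affine_functional_sum affine_functional_cmul \<mu>_affine)
  have l_affine: "affine_functional (l \<epsilon>)"
    unfolding l_def by (intro affine_functional_add affine_functional_cmul u_affine h(1) T)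
  have l_v: "l \<epsilon> (v \<epsilon>) = - 1"
    using hTj \<epsilon>(2) by (simp add: l_def \<kappa>_def hTv)
  have l_T: "l \<epsilon> (q i) = 1 / a i (v \<epsilon>)" if i: "i \<in> T" for i
  proof -
    have "u \<epsilon> (q i) = (\<Sum>k\<in>T. if i = k then 1 / a i (v \<epsilon>) else 0)"
      unfolding u_def using i by (intro sum.cong) (auto simp: \<mu>_q)
    moreover have "h T (q i) = 0" using h(3)[OF T, of i] i T4(2) by blast
    ultimately show ?thesis using i T4(3) by (simp add: l_def)
  qed
  let ?q = "q(n + 5 := v \<epsilon>)" and ?a = "a(n + 5 := l \<epsilon>)"
  let ?F' = "stack_facet (n + 5) T \<F>"
  have real': "stacking ?q {..<n + 5} \<F> T (n + 5) h" "realizes (Suc n) ?F' ?q"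
    using realizes_stack[OF complex realizes T h hTv_neg hv] by blast+
  have v_rational: "rational_point (v \<epsilon>)"
    unfolding v_def using c(1) q_rational[OF j(1)] \<epsilon>(1)
    by (intro rational_point_add rational_point_scale rational_point_diff)
  have l_rational: "l \<epsilon> x \<in> \<rat>" if x: "rational_point x" for x
  proof -
    obtain y :: "4 \<Rightarrow> nat" where y: "bij_betw y UNIV T"
      using finite_same_card_bij[of "UNIV :: 4 set" T] T4 by auto
    then have yT: "y k \<in> T" for k by (auto simp: bij_betw_def)
    show ?thesis
    proof (rule rational_affine_functional[OF l_affine _ _ v_rational _ _ x, of "\<lambda>k. q (y k)"])
      show "l \<epsilon> (v \<epsilon>) \<in> \<rat>" by (simp add: l_v)
      show "l \<epsilon> (q (y k)) \<in> \<rat>" for k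
        using l_T[OF yT] a_rational[OF _ v_rational, of "y k"] yT[of k] T4(2) by auto
      show "rational_point (q (y k))" for k using yT[of k] T4(2) q_rational by auto
      fix g x assume g: "affine_functional g" "g (v \<epsilon>) = 0" "\<And>k. g (q (y k)) = 0"
      have gT: "g (q i) = 0" if "i \<in> T" for i
        using that g(3) y by (metis bij_betw_imp_surj_on imageE)
      have "g x = g (q j) / h T (q j) * h T x" for x
      proof -
        have "g x = g (?q j) / h T (?q j) * h T x"
          by (rule stacking.facet_functional_unique[OF real'(1) g(1)]) (use gT T4(2) j in auto)
        then show ?thesis using j by simp
      qed
      from this[of "v \<epsilon>"] this[of x] show "g x = 0" using g(2) hTv_neg hTj by simp
    qed
  qed
  have simp': "{i, k} \<in> simplices ?F' \<longleftrightarrow> {i, k} \<in> simplices \<F>" if "i < n + 5" "k < n + 5" for i k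
  proof -
    have "card {i, k} \<le> 2" by (simp add: card_insert_if)
    then have "{i, k} \<noteq> T" using T4(1) by auto
    moreover have "n + 5 \<notin> {i, k}" using that by auto
    ultimately show ?thesis unfolding simplices_stack[OF complex T] by blast
  qed
  have simp'': "{n + 5, k} \<in> simplices ?F' \<longleftrightarrow> k \<in> T" if "k < n + 5" for k
  proof -
    have "n + 5 \<notin> S" if "S \<in> simplices \<F>" for S
      using stacked_complex_finite(5)[OF complex that] by auto
    then have "{n + 5, k} \<in> simplices ?F' \<longleftrightarrow> (\<exists>S. S \<subset> T \<and> {n + 5, k} = insert (n + 5) S)"
      unfolding simplices_stack[OF complex T] by blast
    also have "\<dots> \<longleftrightarrow> k \<in> T"
    proof
      assume "\<exists>S. S \<subset> T \<and> {n + 5, k} = insert (n + 5) S"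
      then obtain S where "S \<subset> T" "{n + 5, k} = insert (n + 5) S" by blast
      moreover have "k \<noteq> n + 5" using that by simp
      ultimately show "k \<in> T" by blast
    next
      assume "k \<in> T"
      moreover have "{k} \<noteq> T" using T4(1) by auto
      ultimately show "\<exists>S. S \<subset> T \<and> {n + 5, k} = insert (n + 5) S"
        by (intro exI[of _ "{k}"]) auto
    qed
    finally show ?thesis .
  qed
  have "truncation_system (Suc n) ?F' ?q ?a"
  proof
    show "stacked_complex (Suc n) ?F'" by (rule stacked_complex.stack[OF complex T])
    show "realizes (Suc n) ?F' ?q" by (rule real'(2))
    show "affine_functional (?a i)" if "i < Suc n + 5" for i
      using that a_affine[of i] l_affine by (cases "i = n + 5") auto
    show "?a i (?q i) = - 1" if "i < Suc n + 5" for i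
      using that a_self[of i] l_v by (cases "i = n + 5") auto
    have l_pos: "0 < l \<epsilon> (q k)" if "k < n + 5" for k
      using l_T[of k] lw(1)[of k] av[of k] that by (cases "k \<in> T") auto
    show "0 < ?a i (?q k)" if "i < Suc n + 5" "k < Suc n + 5" "i \<noteq> k" for i k
      using that a_pos[of i k] l_pos[of k] av[of i] by (cases "i = n + 5"; cases "k = n + 5") auto
    have new: "if k \<in> T then l \<epsilon> (q k) * a k (v \<epsilon>) = 1 else 1 < l \<epsilon> (q k) * a k (v \<epsilon>)"
      if "k < n + 5" for k
      using l_T[of k] lw(2)[of k] av[of k] that by auto
    show "?a i (?q k) * ?a k (?q i) = 1" if "i \<noteq> k" "{i, k} \<in> simplices ?F'" for i k
    proof -
      have ik: "i < Suc n + 5" "k < Suc n + 5" "i \<noteq> k"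
        using that(1) stacked_complex_finite(5)[OF stacked_complex.stack[OF complex T] that(2)] by auto
      consider "i < n + 5" "k < n + 5" | "i = n + 5" "k < n + 5" | "i < n + 5" "k = n + 5"
        using ik by linarith
      then show ?thesis
      proof cases
        case 1
        then show ?thesis using simp'[OF 1] that a_edge by auto
      next
        case 2
        then show ?thesis using simp''[OF 2(2)] that new[OF 2(2)] by auto
      next
        case 3
        then have "i \<in> T" using simp''[OF 3(1)] that by (simp add: insert_commute)
        then show ?thesis using 3 new[OF 3(1)] by (auto simp: mult.commute)
      qed
    qed
    show "1 < ?a i (?q k) * ?a k (?q i)"
      if "i < Suc n + 5" "k < Suc n + 5" "i \<noteq> k" "{i, k} \<notin> simplices ?F'" for i k
    proof -
      have ik: "i < Suc n + 5" "k < Suc n + 5" "i \<noteq> k" using that by auto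
      then consider "i < n + 5" "k < n + 5" | "i = n + 5" "k < n + 5" | "i < n + 5" "k = n + 5"
        by linarith
      then show ?thesis
      proof cases
        case 1
        then show ?thesis using simp'[OF 1] that a_nonedge by auto
      next
        case 2
        then show ?thesis using simp''[OF 2(2)] that new[OF 2(2)] by auto
      next
        case 3
        then have "i \<notin> T" using simp''[OF 3(1)] that by (simp add: insert_commute)
        then show ?thesis using 3 new[OF 3(1)] by (auto simp: mult.commute)
      qed
    qed
    show "rational_point (?q i)" if "i < Suc n + 5" for i
      using that q_rational[of i] v_rational by (cases "i = n + 5") auto
    show "?a i x \<in> \<rat>" if "i < Suc n + 5" "rational_point x" for i x
      using that a_rational[of i x] l_rational[of x] by (cases "i = n + 5") auto
  qed
  then show ?thesis by blast
qed

end

theorem exists_truncation_system: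
  assumes "stacked_complex n \<F>"
  shows "\<exists>q a. truncation_system n \<F> q a"
  using assms
proof (induction rule: stacked_complex.induct)
  case simplex
  show ?case by (rule truncation_system_simplex)
next
  case (stack n \<F> T)
  then show ?case using truncation_system.truncation_system_stack by blast
qed

section \<open>The faces of the truncated polytope\<close>

context truncation_system
begin

definition Q :: "(real ^ 4) set" where "Q = convex hull (q ` I)"

definition D :: "(real ^ 4) set" where "D = Q \<inter> {x. \<forall>i<n + 5. 0 \<le> a i x}"

abbreviation supports :: "nat set set" where "supports \<equiv> insert I (simplices \<F>)"

lemma supports_eq: "face_supports q I = supports"
  using realizes by (simp add: realizes_def)

lemma support_faces: "S \<in> supports \<Longrightarrow> S \<in> face_supports q I"
  by (subst supports_eq)

lemma support_subset: "S \<in> supports \<Longrightarrow> S \<subseteq> I"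
  using face_supports_subset supports_eq by metis

lemma inj_on_q: "inj_on q I"
proof (rule inj_onI)
  fix i k assume ik: "i \<in> I" "k \<in> I" "q i = q k"
  have "{i} \<in> face_supports q I"
    using stacked_complex_vertex[OF complex, of i] ik(1) by (simp add: supports_eq)
  then have "q k \<in> convex hull (q ` {i}) \<longleftrightarrow> k \<in> {i}"
    by (rule point_in_face_iff[OF finite_lessThan _ ik(2)])
  then show "i = k" using ik(3) by simp
qed

lemma convex_D: "convex D"
proof -
  have "convex {x. 0 \<le> a i x}" if "i < n + 5" for i
  proof (rule convexI)
    fix x y and s t :: real
    assume "x \<in> {x. 0 \<le> a i x}" "y \<in> {x. 0 \<le> a i x}" "0 \<le> s" "0 \<le> t" "s + t = 1"
    then show "s *\<^sub>R x + t *\<^sub>R y \<in> {x. 0 \<le> a i x}"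
      using affine_functional_combination2[OF a_affine[OF that], of s t x y] by simp
  qed
  then have "convex (\<Inter>i\<in>I. {x. 0 \<le> a i x})" by (intro convex_INT) auto
  moreover have "D = convex hull (q ` I) \<inter> (\<Inter>i\<in>I. {x. 0 \<le> a i x})" by (auto simp: D_def Q_def)
  ultimately show ?thesis by (simp add: convex_Int)
qed

lemma compact_D: "compact D"
proof -
  have "closed {x. 0 \<le> a i x}" if i: "i < n + 5" for i
  proof -
    obtain c b where "a i = (\<lambda>x. c \<bullet> x + b)"
      using a_affine[OF i] by (auto simp: affine_functional_def)
    then have "{x. 0 \<le> a i x} = {x. c \<bullet> x \<ge> - b}" by auto
    then show ?thesis by (simp add: closed_halfspace_ge)
  qed
  then have "closed (\<Inter>i\<in>I. {x. 0 \<le> a i x})" by (intro closed_INT) auto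
  moreover have "compact (convex hull (q ` I))" by (simp add: finite_imp_compact_convex_hull)
  moreover have "D = convex hull (q ` I) \<inter> (\<Inter>i\<in>I. {x. 0 \<le> a i x})" by (auto simp: D_def Q_def)
  ultimately show ?thesis by (simp add: compact_Int_closed)
qed

lemma edge_point_in_face:
  assumes "e \<in> edges" "S \<in> supports"
  shows "edge_point e \<in> convex hull (q ` S) \<longleftrightarrow> e \<subseteq> S"
proof -
  have S: "S \<in> face_supports q I" using assms(2) by (simp add: supports_eq)
  have "edge_point e \<in> convex hull (q ` I)" by (rule edge_point_in_hull[OF assms(1) edge_subset[OF assms(1)]])
  then show ?thesis
  proof (rule face_support_functional[OF finite_lessThan S])
    fix f assume f: "affine_functional f" "\<And>i. i \<in> I \<Longrightarrow> 0 \<le> f (q i)"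
      "\<And>i. i \<in> I \<Longrightarrow> f (q i) = 0 \<longleftrightarrow> i \<in> S"
      "edge_point e \<in> convex hull (q ` S) \<longleftrightarrow> f (edge_point e) = 0"
    have "f (edge_point e) = 0 \<longleftrightarrow> e \<subseteq> S"
      by (rule functional_nonneg_at_edge_point(2)[OF f(1) _ _ assms(1)]) (use f in auto)
    then show ?thesis using f(4) by simp
  qed
qed

lemma edge_point_in_D: "e \<in> edges \<Longrightarrow> edge_point e \<in> D"
  using edge_point_in_hull[of e I] edge_subset[of e] a_edge_point(1)
  by (auto simp: D_def Q_def)

text \<open>
  The cuts at two vertices meet within \<open>Q\<close> only if these form an edge, and then in its edge point. If
  \<open>y\<close> is a convex combination of the vertices with weights \<open>\<beta>\<close>, then the two equations bound
  \<open>\<beta> i\<close> and \<open>\<beta> k\<close> from below by multiples of each other, and the product of the two factors is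
  at least \<open>1\<close>. This forces equality everywhere, and the other weights vanish.
\<close>

lemma two_tight_functionals:
  assumes y: "y \<in> Q" and ik: "i < n + 5" "k < n + 5" "i \<noteq> k" and tight: "a i y = 0" "a k y = 0"
  shows "{i, k} \<in> simplices \<F>" "y = edge_point {i, k}"
proof -
  obtain \<beta> where \<beta>: "\<forall>w\<in>I. 0 \<le> \<beta> w" "sum \<beta> I = 1" "y = (\<Sum>w\<in>I. \<beta> w *\<^sub>R q w)"
    using y convex_hull_indexed_family[of I q] by (auto simp: Q_def)
  let ?J = "I - {i, k}"
  define R where "R x = (\<Sum>w\<in>?J. \<beta> w * a x (q w))" for x
  have I: "I = insert i (insert k ?J)" using ik by auto
  have split: "sum g I = g i + g k + sum g ?J" for g :: "nat \<Rightarrow> 'x::ab_group_add"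
    by (subst I) (use ik in \<open>simp add: add.assoc\<close>)
  have eval: "a x y = \<beta> i * a x (q i) + \<beta> k * a x (q k) + R x" if "x < n + 5" for x
  proof -
    have "a x y = (\<Sum>w\<in>I. \<beta> w * a x (q w))"
      unfolding \<beta>(3) by (rule affine_functional_combination[OF a_affine[OF that] finite_lessThan \<beta>(2)])
    then show ?thesis using split[of "\<lambda>w. \<beta> w * a x (q w)"] by (simp add: R_def)
  qed
  define M where "M = a i (q k)"
  define M' where "M' = a k (q i)"
  have M: "0 < M" "0 < M'" "1 \<le> M * M'"
    using a_pos[of i k] a_pos[of k i] a_edge[of i k] a_nonedge[of i k] ik
    by (cases "{i, k} \<in> simplices \<F>"; force simp: M_def M'_def)+
  have \<beta>i: "\<beta> i = M * \<beta> k + R i"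
    using eval[OF ik(1)] tight(1) a_self[OF ik(1)] by (simp add: M_def mult.commute)
  have \<beta>k: "\<beta> k = M' * \<beta> i + R k"
    using eval[OF ik(2)] tight(2) a_self[OF ik(2)] by (simp add: M'_def mult.commute)
  have term_nonneg: "0 \<le> \<beta> w * a x (q w)" if "w \<in> ?J" "x \<in> {i, k}" for w x
  proof -
    have "0 \<le> \<beta> w" "0 < a x (q w)" using that \<beta>(1) a_pos[of x w] ik by auto
    then show ?thesis by simp
  qed
  have R: "0 \<le> R i" "0 \<le> R k"
    unfolding R_def by (rule sum_nonneg, rule term_nonneg; simp)+
  have nn: "0 \<le> \<beta> i" "0 \<le> \<beta> k" using \<beta>(1) ik by auto
  have "\<beta> i = M * (M' * \<beta> i + R k) + R i" using \<beta>i \<beta>k by simp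
  then have "(M * M' - 1) * \<beta> i + M * R k + R i = 0" by (simp add: algebra_simps)
  moreover have "0 \<le> (M * M' - 1) * \<beta> i" "0 \<le> M * R k" using M R nn by auto
  ultimately have z: "(M * M' - 1) * \<beta> i = 0" "M * R k = 0" "R i = 0" using R by linarith+
  have rest: "\<beta> w = 0" if w: "w \<in> ?J" for w
  proof -
    have "\<beta> w * a i (q w) = 0"
      using sum_nonneg_0[of ?J "\<lambda>w. \<beta> w * a i (q w)" w] z(3) term_nonneg[of _ i] w
      by (simp add: R_def)
    moreover have "0 < a i (q w)" using a_pos[of i w] ik w by auto
    ultimately show ?thesis by simp
  qed
  then have sum1: "\<beta> i + \<beta> k = 1" and y': "y = \<beta> i *\<^sub>R q i + \<beta> k *\<^sub>R q k"
    using \<beta>(2,3) split[of \<beta>] split[of "\<lambda>w. \<beta> w *\<^sub>R q w"] by simp_all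
  have "R k = 0" using z(2) M(1) by simp
  then have \<beta>k': "\<beta> k = M' * \<beta> i" using \<beta>k by simp
  have "\<beta> i \<noteq> 0" using sum1 \<beta>k' by auto
  then have MM: "M * M' = 1" using z(1) by simp
  then show edge: "{i, k} \<in> simplices \<F>"
    using a_nonedge[OF ik] by (force simp: M_def M'_def)
  have "\<beta> i * (1 + M') = 1" using sum1 \<beta>k' by (simp add: algebra_simps)
  then have "\<beta> i = 1 / (1 + M')" using M(2) by (simp add: field_simps)
  moreover from this have "\<beta> k = M' / (1 + M')" using \<beta>k' by simp
  ultimately show "y = edge_point {i, k}"
    using y' edge_point_eq[OF ik(3) edge] by (simp add: M'_def)
qed

lemma edge_slice:
  assumes "i \<noteq> k" "{i, k} \<in> simplices \<F>"
  shows "convex hull (q ` {i, k}) \<inter> D = {edge_point {i, k}}"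
proof
  have e: "{i, k} \<in> edges" using assms by (simp add: edges_def)
  show "{edge_point {i, k}} \<subseteq> convex hull (q ` {i, k}) \<inter> D"
    using edge_point_in_D[OF e] edge_point_in_hull[OF e, of "{i, k}"] by simp
  have ik: "i < n + 5" "k < n + 5" using edge_vertices[OF assms(2)] by auto
  have pos: "0 < a i (q k)" "a i (q k) * a k (q i) = 1"
    using a_pos a_edge[OF assms] ik assms by auto
  show "convex hull (q ` {i, k}) \<inter> D \<subseteq> {edge_point {i, k}}"
  proof
    fix y assume y: "y \<in> convex hull (q ` {i, k}) \<inter> D"
    then have "y \<in> convex hull {q i, q k}" by simp
    then obtain s t where st: "0 \<le> s" "0 \<le> t" "s + t = 1" "y = s *\<^sub>R q i + t *\<^sub>R q k"
      unfolding convex_hull_2 by blast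
    have i: "a i y = t * a i (q k) - s"
      unfolding st(4) using affine_functional_combination2[OF a_affine[OF ik(1)] st(3)] a_self[OF ik(1)]
      by simp
    have k: "a k y = s * a k (q i) - t"
      unfolding st(4) using affine_functional_combination2[OF a_affine[OF ik(2)] st(3)] a_self[OF ik(2)]
      by simp
    have nonneg: "0 \<le> a i y" "0 \<le> a k y" using y ik by (auto simp: D_def)
    have "a i (q k) * a k y = s * (a i (q k) * a k (q i)) - t * a i (q k)"
      by (simp add: k algebra_simps)
    then have eq: "a i (q k) * a k y = - a i y" using pos(2) i by simp
    moreover have "0 \<le> a i (q k) * a k y" using pos(1) nonneg by simp
    ultimately have "a i y = 0" using nonneg by simp
    moreover from this have "a k y = 0" using eq pos(1) by simp
    moreover have "y \<in> Q" using y by (simp add: D_def)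
    ultimately show "y \<in> {edge_point {i, k}}"
      using two_tight_functionals(2)[OF _ ik assms(1)] by simp
  qed
qed

lemma edge_in_support:
  assumes "S \<in> supports" "v \<in> S" "S \<noteq> {v}"
  obtains e where "e \<in> edges" "v \<in> e" "e \<subseteq> S"
proof (cases "S = I")
  case True
  then have "{v} \<in> simplices \<F>" using stacked_complex_vertex[OF complex] assms(2) by simp
  then obtain T where T: "T \<in> \<F>" "v \<in> T" by (auto simp: simplices_def)
  have "T \<noteq> {v}" using stacked_complex_facet(1)[OF complex T(1)] by auto
  then obtain w where "w \<in> T" "w \<noteq> v" using T(2) by blast
  then have "{v, w} \<in> edges" using facet_pair_edge[OF T(1,2)] by blast
  then show ?thesis using that[of "{v, w}"] edge_subset True by blast
next
  case False
  then have S: "S \<in> simplices \<F>" using assms(1) by simp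
  obtain w where "w \<in> S" "w \<noteq> v" using assms(2,3) by blast
  then have "{v, w} \<in> edges" using simplices_mono[OF S, of "{v, w}"] assms(2)
    by (auto simp: edges_def)
  then show ?thesis using that[of "{v, w}"] \<open>w \<in> S\<close> assms(2) by blast
qed

lemma simplex_face_of_D:
  assumes "S \<in> supports"
  shows "convex hull (q ` S) \<inter> D face_of D"
proof -
  have "convex hull (q ` S) face_of Q"
    unfolding Q_def by (rule face_supports_imp_face[OF finite_lessThan support_faces[OF assms]])
  then have "convex hull (q ` S) \<inter> D face_of Q \<inter> D" by (rule face_of_slice[OF _ convex_D])
  moreover have "Q \<inter> D = D" by (auto simp: D_def)
  ultimately show ?thesis by simp
qed

lemma tight_face_of_D:
  assumes "K \<subseteq> I"
  shows "D \<inter> {x. \<forall>i\<in>K. a i x = 0} face_of D"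
proof -
  have fin: "finite K" using assms finite_subset by blast
  have nonneg: "0 \<le> a i x" if "x \<in> D" "i \<in> K" for x i using that assms by (auto simp: D_def)
  have "D \<inter> {x. (\<Sum>i\<in>K. a i x) = 0} face_of D"
    using assms nonneg
    by (intro face_of_zero_set convex_D affine_functional_sum a_affine sum_nonneg) auto
  moreover have "(\<Sum>i\<in>K. a i x) = 0 \<longleftrightarrow> (\<forall>i\<in>K. a i x = 0)" if "x \<in> D" for x
    using nonneg[OF that] by (intro sum_nonneg_eq_0_iff fin)
  then have "D \<inter> {x. (\<Sum>i\<in>K. a i x) = 0} = D \<inter> {x. \<forall>i\<in>K. a i x = 0}" by blast
  ultimately show ?thesis by simp
qed

text \<open>
  Each point of \<open>Q\<close> lies in the relative interior of a face: of a smallest face that contains it.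
\<close>

lemma minimal_support:
  assumes "x \<in> Q"
  obtains S where "S \<in> supports" "x \<in> rel_interior (convex hull (q ` S))"
proof -
  define P where "P S \<longleftrightarrow> S \<in> supports \<and> x \<in> convex hull (q ` S)" for S
  have "P I" using assms by (simp add: P_def Q_def)
  then obtain S where S: "P S" "\<And>S'. P S' \<Longrightarrow> card S \<le> card S'"
    using ex_has_least_nat[of P I card] by blast
  let ?C = "convex hull (q ` S)"
  have supp: "S \<in> supports" "S \<subseteq> I" using S(1) support_subset by (auto simp: P_def)
  then have finS: "finite S" using finite_subset by blast
  have "x \<in> rel_interior ?C"
  proof (rule ccontr)
    assume "x \<notin> rel_interior ?C"
    moreover have "polyhedron ?C" using finS by (simp add: polyhedron_convex_hull)
    moreover have "x \<in> ?C" using S(1) by (simp add: P_def)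
    ultimately obtain F where F: "F facet_of ?C" "x \<in> F"
      using rel_boundary_of_polyhedron[of ?C] by blast
    have CQ: "?C face_of convex hull (q ` I)"
      by (rule face_supports_imp_face[OF finite_lessThan support_faces[OF supp(1)]])
    have "F face_of convex hull (q ` I)"
      using face_of_trans[OF facet_of_imp_face_of[OF F(1)] CQ] .
    then have "F \<in> (\<lambda>S. convex hull (q ` S)) ` face_supports q I"
      using faces_of_convex_hull[OF finite_lessThan, of q "n + 5"] by (metis mem_Collect_eq)
    then obtain S' where S': "S' \<in> supports" "F = convex hull (q ` S')"
      unfolding supports_eq by (elim imageE)
    have "F \<subseteq> ?C" "F \<noteq> ?C" using F(1) facet_of_imp_subset facet_of_irrefl by blast+
    then have "S' \<subseteq> S" "S' \<noteq> S"
      using face_subset_iff[OF finite_lessThan, of S' q "n + 5" S] S' supp(1)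
      by (auto simp: supports_eq)
    then have "card S' < card S" using finS by (simp add: psubset_card_mono psubset_eq)
    moreover have "P S'" using S' F(2) by (simp add: P_def)
    ultimately show False using S(2) by force
  qed
  then show ?thesis using that supp(1) by blast
qed

text \<open>
  As for any polyhedron, a face of \<open>D\<close> is given by the constraints that are tight at a point \<open>x\<close> of
  its relative interior, here the face of \<open>Q\<close> around \<open>x\<close> and the truncations that are tight at \<open>x\<close>:
  if all of these hold for \<open>y\<close> as well, then the segment from \<open>y\<close> to \<open>x\<close> can be prolonged
  within \<open>D\<close>.
\<close>

lemma face_of_D_cut_out:
  assumes C: "C face_of D" "x \<in> rel_interior C"
    and S: "S \<in> supports" "x \<in> rel_interior (convex hull (q ` S))"
  shows "C = convex hull (q ` S) \<inter> D \<inter> {y. \<forall>i\<in>{i. i < n + 5 \<and> a i x = 0}. a i y = 0}"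
    (is "C = ?C'")
proof
  let ?K = "{i. i < n + 5 \<and> a i x = 0}"
  have xC: "x \<in> C" using C(2) rel_interior_subset by blast
  have CD: "C \<subseteq> D" by (rule face_of_imp_subset[OF C(1)])
  have xS: "x \<in> convex hull (q ` S)" using S(2) rel_interior_subset by blast
  have C'_eq: "?C' = (convex hull (q ` S) \<inter> D) \<inter> (D \<inter> {y. \<forall>i\<in>?K. a i y = 0})" by blast
  have "?C' face_of D"
    unfolding C'_eq by (intro face_of_Int simplex_face_of_D[OF S(1)] tight_face_of_D) auto
  moreover have "x \<in> ?C'" using xC CD xS by auto
  ultimately show "C \<subseteq> ?C'"
    using subset_of_face_of[of ?C' D C] CD C(2) by blast
  show "?C' \<subseteq> C"
  proof
    fix y assume y: "y \<in> ?C'"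
    show "y \<in> C"
    proof (cases "y = x")
      case True
      then show ?thesis using xC by simp
    next
      case False
      let ?S = "convex hull (q ` S)"
      have "\<exists>e>1. (1 - e) *\<^sub>R y + e *\<^sub>R x \<in> ?S"
      proof -
        have "?S \<noteq> {}" using xS by blast
        then show ?thesis
          using S(2) y convex_rel_interior_iff[OF convex_convex_hull, where z = x] by blast
      qed
      then obtain e0 where e0: "1 < e0" "(1 - e0) *\<^sub>R y + e0 *\<^sub>R x \<in> ?S" by blast
      have lim: "((\<lambda>e. (1 - e) * a i y + e * a i x) \<longlongrightarrow> (1 - 1) * a i y + 1 * a i x) (at_right (1::real))" for i
        by (intro tendsto_intros)
      have "eventually (\<lambda>e. \<forall>i\<in>I - ?K. 0 < (1 - e) * a i y + e * a i x) (at_right 1)"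
      proof (intro eventually_ball_finite ballI)
        fix i assume i: "i \<in> I - ?K"
        have "0 \<le> a i x" using xC CD i by (auto simp: D_def)
        then have "0 < a i x" using i by auto
        then show "eventually (\<lambda>e. 0 < (1 - e) * a i y + e * a i x) (at_right 1)"
          using order_tendstoD(1)[OF lim[of i], of 0] by simp
      qed simp
      then obtain b where b: "1 < b"
        "\<And>e. 1 < e \<Longrightarrow> e < b \<Longrightarrow> \<forall>i\<in>I - ?K. 0 < (1 - e) * a i y + e * a i x"
        unfolding eventually_at_right_field by blast
      \<comment> \<open>beyond \<open>x\<close> by so little that the face of \<open>Q\<close> and the strict truncations are not left\<close>
      define e where "e = min e0 ((1 + b) / 2)"
      have e: "1 < e" "e \<le> e0" "e < b" using e0 b(1) by (auto simp: e_def min_def)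
      define z where "z = (1 - e) *\<^sub>R y + e *\<^sub>R x"
      have zS: "z \<in> ?S"
      proof -
        define s where "s = (e - 1) / (e0 - 1)"
        have s: "0 \<le> s" "s \<le> 1" "s * (e0 - 1) = e - 1" using e e0 by (auto simp: s_def)
        have "z = (1 - s) *\<^sub>R x + s *\<^sub>R ((1 - e0) *\<^sub>R y + e0 *\<^sub>R x)"
        proof -
          have "1 - e = s * (1 - e0)" "e = (1 - s) + s * e0" using s(3) by (simp_all add: algebra_simps)
          then show ?thesis by (simp add: z_def scaleR_add_left scaleR_add_right)
        qed
        then show ?thesis
          using s xS e0(2) by (simp add: convex_alt[THEN iffD1, OF convex_convex_hull, rule_format])
      qed
      have "0 \<le> a i z" if i: "i < n + 5" for i
      proof -
        have az: "a i z = (1 - e) * a i y + e * a i x"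
          unfolding z_def by (rule affine_functional_combination2[OF a_affine[OF i]]) simp
        show ?thesis
        proof (cases "i \<in> ?K")
          case True
          then show ?thesis using az y by auto
        next
          case False
          then show ?thesis using b(2)[OF e(1,3)] i az by (auto intro!: less_imp_le)
        qed
      qed
      moreover have "z \<in> Q"
        using zS hull_mono[OF image_mono[OF support_subset[OF S(1)], of q], of convex]
        unfolding Q_def by blast
      ultimately have zD: "z \<in> D" by (simp add: D_def)
      have x_eq: "x = (1 - 1 / e) *\<^sub>R y + (1 / e) *\<^sub>R z"
      proof -
        have "(1 / e) *\<^sub>R z = ((1 - e) / e) *\<^sub>R y + x" using e(1) by (simp add: z_def scaleR_add_right)
        moreover have "(1 - e) / e = - (1 - 1 / e)" using e(1) by (simp add: field_simps)
        ultimately show ?thesis by (simp only: scaleR_minus_left) simp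
      qed
      have "y \<noteq> z"
      proof
        assume "y = z"
        moreover have "z - y = e *\<^sub>R (x - y)" by (simp add: z_def algebra_simps)
        ultimately show False using e(1) False by simp
      qed
      then have "x \<in> open_segment y z"
        unfolding in_segment using x_eq e(1) by (intro conjI exI[of _ "1 / e"]) auto
      then show ?thesis
        using C(1) y zD xC unfolding face_of_def by blast
    qed
  qed
qed

text \<open>
  At most one truncation matters, since a point at which two of them are tight is an edge
  point, which is also the slice of an edge of \<open>Q\<close>.
\<close>

theorem faces_of_D:
  assumes "C face_of D" "C \<noteq> {}"
  obtains S where "S \<in> supports" "C = convex hull (q ` S) \<inter> D"
  | S v where "S \<in> supports" "v \<in> S" "C = convex hull (q ` S) \<inter> D \<inter> {y. a v y = 0}"
proof -
  have "rel_interior C \<noteq> {}"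
    using rel_interior_eq_empty[OF face_of_imp_convex[OF assms(1)]] assms(2) by simp
  then obtain x where x: "x \<in> rel_interior C" by blast
  have xD: "x \<in> D" using x rel_interior_subset face_of_imp_subset[OF assms(1)] by blast
  then have "x \<in> Q" by (simp add: D_def)
  then obtain S where S: "S \<in> supports" "x \<in> rel_interior (convex hull (q ` S))"
    by (rule minimal_support)
  let ?K = "{i. i < n + 5 \<and> a i x = 0}"
  have C: "C = convex hull (q ` S) \<inter> D \<inter> {y. \<forall>i\<in>?K. a i y = 0}"
    by (rule face_of_D_cut_out[OF assms(1) x S])
  consider "?K = {}" | v where "?K = {v}" | i k where "i \<in> ?K" "k \<in> ?K" "i \<noteq> k" by blast
  then show ?thesis
  proof cases
    case 1
    then have "{y. \<forall>i\<in>?K. a i y = 0} = UNIV" by blast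
    then have "C = convex hull (q ` S) \<inter> D" using C by (simp only: Int_UNIV_right)
    then show ?thesis by (rule that(1)[OF S(1)])
  next
    case (2 v)
    then have v: "v < n + 5" "a v x = 0" by blast+
    have "v \<in> S"
    proof (rule ccontr)
      assume "v \<notin> S"
      then have "0 < a v y" if "y \<in> q ` S" for y
        using that a_pos[OF v(1)] support_subset[OF S(1)] by auto
      then have "0 < a v x"
        using S(2) rel_interior_subset by (blast intro: affine_functional_pos_on_hull[OF a_affine[OF v(1)]])
      then show False using v(2) by simp
    qed
    moreover have "{y. \<forall>i\<in>?K. a i y = 0} = {y. a v y = 0}" unfolding 2 by simp
    then have "C = convex hull (q ` S) \<inter> D \<inter> {y. a v y = 0}" using C by (simp only:)
    ultimately show ?thesis by (rule that(2)[OF S(1)])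
  next
    case (3 i k)
    then have ik: "i < n + 5" "k < n + 5" "a i x = 0" "a k x = 0" by blast+
    have edge: "{i, k} \<in> simplices \<F>"
      by (rule two_tight_functionals(1)[OF \<open>x \<in> Q\<close> ik(1,2) 3(3) ik(3,4)])
    have "C \<subseteq> {edge_point {i, k}}"
    proof
      fix y assume "y \<in> C"
      then have "y \<in> D" "a i y = 0" "a k y = 0" unfolding C using ik by auto
      then show "y \<in> {edge_point {i, k}}"
        using two_tight_functionals(2)[OF _ ik(1,2) 3(3)] by (simp add: D_def)
    qed
    then have "C = {edge_point {i, k}}" using assms(2) by (simp add: subset_singleton_iff)
    then have "C = convex hull (q ` {i, k}) \<inter> D" by (simp only: edge_slice[OF 3(3) edge])
    moreover have "{i, k} \<in> supports" using edge by (rule insertI2)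
    ultimately show ?thesis using that(1) by (simp only:)
  qed
qed

lemma vertex_not_in_D:
  assumes "v < n + 5"
  shows "q v \<notin> D"
  using a_self[OF assms] assms by (auto simp: D_def)

text \<open>
  An extreme point is a face of one of the two kinds above, and such a face contains an edge point
  unless its face of \<open>Q\<close> is a vertex, which is cut off.
\<close>

theorem D_eq_hull_edge_points: "D = convex hull (edge_point ` edges)"
proof
  show "convex hull (edge_point ` edges) \<subseteq> D"
    using edge_point_in_D convex_D by (intro hull_minimal) auto
  have "x \<in> edge_point ` edges" if x: "x extreme_point_of D" for x
  proof -
    have "{x} face_of D" "{x} \<noteq> {}" using x by (auto simp: face_of_singleton)
    then have "\<exists>e\<in>edges. edge_point e \<in> {x}"
    proof (rule faces_of_D)
      fix S assume S: "S \<in> supports" "{x} = convex hull (q ` S) \<inter> D"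
      have "S \<noteq> {}" using S(2) by auto
      then obtain v where v: "v \<in> S" by blast
      have "S \<noteq> {v}" using S(2) vertex_not_in_D[of v] support_subset[OF S(1)] v by auto
      then obtain e where "e \<in> edges" "e \<subseteq> S" using edge_in_support[OF S(1) v] by blast
      then show ?thesis
        unfolding S(2) using edge_point_in_hull edge_point_in_D by blast
    next
      fix S v assume S: "S \<in> supports" "v \<in> S" "{x} = convex hull (q ` S) \<inter> D \<inter> {y. a v y = 0}"
      have v: "v < n + 5" using support_subset[OF S(1)] S(2) by auto
      have x': "x \<in> convex hull (q ` S)" "x \<in> D" using S(3) by blast+
      have "S \<noteq> {v}"
      proof
        assume "S = {v}"
        then have "x = q v" using x'(1) by simp
        then show False using x'(2) vertex_not_in_D[OF v] by simp
      qed
      then obtain e where e: "e \<in> edges" "v \<in> e" "e \<subseteq> S"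
        by (rule edge_in_support[OF S(1,2)])
      have "a v (edge_point e) = 0" using a_edge_point(2)[OF v e(1)] e(2) by simp
      then have "edge_point e \<in> {x}"
        unfolding S(3) using edge_point_in_hull[OF e(1,3)] edge_point_in_D[OF e(1)] by simp
      then show ?thesis using e(1) by blast
    qed
    then show ?thesis by blast
  qed
  then have "convex hull {x. x extreme_point_of D} \<subseteq> convex hull (edge_point ` edges)"
    by (intro hull_mono) auto
  then show "D \<subseteq> convex hull (edge_point ` edges)"
    using Krein_Milman_Minkowski[OF compact_D convex_D] by simp
qed

definition edges_in :: "nat set \<Rightarrow> nat set set" where
  "edges_in S = {e \<in> edges. e \<subseteq> S}"

definition star_in :: "nat \<Rightarrow> nat set \<Rightarrow> nat set set" where
  "star_in v S = {e \<in> edges. v \<in> e \<and> e \<subseteq> S}"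

lemma support_of_face:
  assumes "C face_of D"
  shows "{e \<in> edges. edge_point e \<in> C} \<in> face_supports edge_point edges"
    "C = convex hull (edge_point ` {e \<in> edges. edge_point e \<in> C})"
proof -
  have "C \<in> (\<lambda>A. convex hull (edge_point ` A)) ` face_supports edge_point edges"
    using assms faces_of_convex_hull[OF finite_edges, of edge_point]
    unfolding D_eq_hull_edge_points by (metis mem_Collect_eq)
  then obtain A where A: "A \<in> face_supports edge_point edges" "C = convex hull (edge_point ` A)"
    by (elim imageE)
  have "{e \<in> edges. edge_point e \<in> C} = A"
    unfolding A(2) using point_in_face_iff[OF finite_edges A(1)] face_supports_subset[OF A(1)] by blast
  then show "{e \<in> edges. edge_point e \<in> C} \<in> face_supports edge_point edges"
    "C = convex hull (edge_point ` {e \<in> edges. edge_point e \<in> C})"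
    using A by simp_all
qed

text \<open>
  The face lattice of the truncated polytope: besides the truncated faces of \<open>Q\<close> it has the vertex
  figures of the faces of \<open>Q\<close>.
\<close>

theorem face_supports_D:
  "face_supports edge_point edges =
    edges_in ` supports \<union> {star_in v S | v S. S \<in> supports \<and> v \<in> S}"
proof (intro subset_antisym subsetI)
  fix A assume A: "A \<in> face_supports edge_point edges"
  define C where "C = convex hull (edge_point ` A)"
  have "C face_of D"
    unfolding C_def D_eq_hull_edge_points by (rule face_supports_imp_face[OF finite_edges A])
  have A_eq: "A = {e \<in> edges. edge_point e \<in> C}"
    unfolding C_def using point_in_face_iff[OF finite_edges A] face_supports_subset[OF A] by blast
  show "A \<in> edges_in ` supports \<union> {star_in v S | v S. S \<in> supports \<and> v \<in> S}"
  proof (cases "C = {}")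
    case True
    have "{0} \<in> simplices \<F>" by (rule stacked_complex_vertex[OF complex]) simp
    then have "{} \<in> supports" by (auto simp: simplices_def)
    moreover have "A = edges_in {}" using A_eq True by (auto simp: edges_in_def edges_def)
    ultimately show ?thesis by blast
  next
    case False
    from \<open>C face_of D\<close> this show ?thesis
    proof (rule faces_of_D)
      fix S assume S: "S \<in> supports" "C = convex hull (q ` S) \<inter> D"
      have "A = edges_in S"
        using edge_point_in_face[OF _ S(1)] edge_point_in_D
        by (auto simp: A_eq S(2) edges_in_def)
      then show ?thesis using S(1) by blast
    next
      fix S v assume S: "S \<in> supports" "v \<in> S" "C = convex hull (q ` S) \<inter> D \<inter> {y. a v y = 0}"
      have v: "v < n + 5" using support_subset[OF S(1)] S(2) by auto
      have "A = star_in v S"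
        using edge_point_in_face[OF _ S(1)] edge_point_in_D a_edge_point(2)[OF v]
        by (auto simp: A_eq S(3) star_in_def)
      then show ?thesis using S(1,2) by blast
    qed
  qed
next
  fix A assume "A \<in> edges_in ` supports \<union> {star_in v S | v S. S \<in> supports \<and> v \<in> S}"
  then consider S where "S \<in> supports" "A = edges_in S"
    | v S where "S \<in> supports" "v \<in> S" "A = star_in v S" by blast
  then show "A \<in> face_supports edge_point edges"
  proof cases
    case 1
    have "A = {e \<in> edges. edge_point e \<in> convex hull (q ` S) \<inter> D}"
      using edge_point_in_face[OF _ 1(1)] edge_point_in_D by (auto simp: 1(2) edges_in_def)
    then show ?thesis using support_of_face(1)[OF simplex_face_of_D[OF 1(1)]] by simp
  next
    case 2
    have v: "v < n + 5" using support_subset[OF 2(1)] 2(2) by auto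
    have "(convex hull (q ` S) \<inter> D) \<inter> (D \<inter> {y. \<forall>i\<in>{v}. a i y = 0}) face_of D"
      using v by (intro face_of_Int simplex_face_of_D[OF 2(1)] tight_face_of_D) auto
    moreover have "A = {e \<in> edges. edge_point e \<in>
        (convex hull (q ` S) \<inter> D) \<inter> (D \<inter> {y. \<forall>i\<in>{v}. a i y = 0})}"
      using edge_point_in_face[OF _ 2(1)] edge_point_in_D a_edge_point(2)[OF v]
      by (auto simp: 2(3) star_in_def)
    ultimately show ?thesis using support_of_face(1) by (simp only:)
  qed
qed

end

section \<open>Dimensions and numbers of faces\<close>

context truncation_system
begin

abbreviation face_dim :: "nat set set \<Rightarrow> int" where
  "face_dim A \<equiv> aff_dim (edge_point ` A)"

lemma edges_in_support: "S \<in> supports \<Longrightarrow> edges_in S \<in> face_supports edge_point edges"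
  unfolding face_supports_D by blast

lemma star_in_support:
  "S \<in> supports \<Longrightarrow> v \<in> S \<Longrightarrow> star_in v S \<in> face_supports edge_point edges"
  unfolding face_supports_D by blast

lemma face_dim_less:
  assumes "A \<in> face_supports edge_point edges" "B \<in> face_supports edge_point edges" "A \<subset> B"
  shows "face_dim A < face_dim B"
  by (rule aff_dim_face_strict_mono[OF finite_edges assms])

lemma simplex_edge: "S \<in> simplices \<F> \<Longrightarrow> i \<in> S \<Longrightarrow> k \<in> S \<Longrightarrow> i \<noteq> k \<Longrightarrow> {i, k} \<in> edges"
  using simplices_mono[of S \<F> "{i, k}"] by (auto simp: edges_def)

lemma edges_in_simplex:
  assumes "S \<in> simplices \<F>"
  shows "edges_in S = {e. e \<subseteq> S \<and> card e = 2}"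
  using simplices_mono[OF assms] by (auto simp: edges_in_def edges_def)

lemma star_in_simplex:
  assumes "S \<in> simplices \<F>" "v \<in> S"
  shows "star_in v S = (\<lambda>w. {v, w}) ` (S - {v})"
proof (intro subset_antisym subsetI)
  fix e assume "e \<in> star_in v S"
  then have e: "e \<in> edges" "v \<in> e" "e \<subseteq> S" by (auto simp: star_in_def)
  then obtain i k where "e = {i, k}" "i \<noteq> k" by (auto simp: edges_def card_2_iff)
  then show "e \<in> (\<lambda>w. {v, w}) ` (S - {v})" using e(2,3) by auto
qed (use simplex_edge[OF assms(1,2)] assms(2) in \<open>auto simp: star_in_def\<close>)

lemma card_star_in_simplex:
  assumes "S \<in> simplices \<F>" "v \<in> S"
  shows "finite (star_in v S)" "card (star_in v S) = card S - 1"
proof -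
  have fin: "finite S" by (rule stacked_complex_finite(4)[OF complex assms(1)])
  have "inj_on (\<lambda>w. {v, w}) (S - {v})" by (rule inj_onI) (auto simp: doubleton_eq_iff)
  then show "finite (star_in v S)" "card (star_in v S) = card S - 1"
    using fin assms(2) by (simp_all add: star_in_simplex[OF assms] card_image card_Diff_singleton)
qed

lemma card_edges_in_simplex:
  assumes "S \<in> simplices \<F>"
  shows "finite (edges_in S)" "card (edges_in S) = card S choose 2"
proof -
  have fin: "finite S" by (rule stacked_complex_finite(4)[OF complex assms])
  show "card (edges_in S) = card S choose 2"
    unfolding edges_in_simplex[OF assms] by (rule n_subsets[OF fin])
  show "finite (edges_in S)" using finite_edges by (simp add: edges_in_def)
qed

lemma facet_containing_vertex:
  assumes "v \<in> I"
  obtains T where "T \<in> \<F>" "v \<in> T"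
  using stacked_complex_vertex[OF complex, of v] assms by (auto simp: simplices_def)

text \<open>
  The facet across a ridge through \<open>v\<close> has a vertex off \<open>T\<close>.
\<close>

lemma edge_leaving_facet:
  assumes "T \<in> \<F>" "v \<in> T"
  obtains w where "w \<notin> T" "{v, w} \<in> edges"
proof -
  have T: "card T = 4" by (rule stacked_complex_facet(1)[OF complex assms(1)])
  then have "T \<noteq> {v}" by auto
  then obtain u where u: "u \<in> T" "u \<noteq> v" using assms(2) by blast
  obtain G where G: "G \<in> \<F>" "G \<noteq> T" "G \<inter> T = T - {u}"
    by (rule ridge_closedE[OF stacked_complex_ridge_closed[OF complex] assms(1) u(1)])
  have "\<not> G \<subseteq> T" using facet_antichain[OF complex G(1) assms(1)] G(2) by blast
  then obtain w where w: "w \<in> G" "w \<notin> T" by blast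
  have "v \<in> G" using G(3) u assms(2) by blast
  then have "{v, w} \<in> edges" using facet_pair_edge[OF G(1) _ w(1)] w assms(2) by blast
  then show ?thesis using that w(2) by blast
qed

lemma third_vertex:
  assumes "3 \<le> card S"
  obtains w where "w \<in> S" "w \<noteq> u" "w \<noteq> v"
proof -
  have "\<not> S \<subseteq> {u, v}"
  proof
    assume "S \<subseteq> {u, v}"
    then have "card S \<le> card {u, v}" by (intro card_mono) auto
    also have "\<dots> \<le> 2" by (simp add: card_insert_if)
    finally show False using assms by simp
  qed
  then show ?thesis using that by blast
qed

lemma facet_in_large_support:
  assumes "S \<in> supports" "3 \<le> card S" "v \<in> S"
  obtains R where "R \<in> simplices \<F>" "R \<subseteq> S" "v \<in> R" "3 \<le> card R"
proof (cases "S = I")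
  case True
  then obtain T where T: "T \<in> \<F>" "v \<in> T" using facet_containing_vertex assms(3) by blast
  have "card T = 4" "T \<subseteq> S" using stacked_complex_facet[OF complex T(1)] True by simp_all
  then show ?thesis using that[OF simplices_facet[OF T(1)] _ T(2)] by simp
next
  case False
  then show ?thesis using that[of S] assms by simp
qed

text \<open>
  The edges in a vertex figure have only \<open>v\<close> in common, and those in a truncated face have no common
  vertex. This distinguishes the faces of the two kinds and recovers \<open>v\<close> from its vertex figure.
\<close>

lemma star_avoids:
  assumes "S \<in> supports" "v \<in> S" "3 \<le> card S" "u \<noteq> v"
  obtains e where "e \<in> star_in v S" "u \<notin> e"
proof -
  obtain R where R: "R \<in> simplices \<F>" "R \<subseteq> S" "v \<in> R" "3 \<le> card R"
    by (rule facet_in_large_support[OF assms(1,3,2)])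
  obtain w where w: "w \<in> R" "w \<noteq> u" "w \<noteq> v" by (rule third_vertex[OF R(4)])
  have "{v, w} \<in> edges" using simplex_edge[OF R(1,3) w(1)] w(3) by blast
  then show ?thesis using that[of "{v, w}"] w assms(4) R by (auto simp: star_in_def)
qed

lemma edges_in_avoids:
  assumes "S \<in> supports" "3 \<le> card S"
  obtains e where "e \<in> edges_in S" "v \<notin> e"
proof -
  obtain x where x: "x \<in> S" using assms(2) by fastforce
  obtain R where R: "R \<in> simplices \<F>" "R \<subseteq> S" "x \<in> R" "3 \<le> card R"
    by (rule facet_in_large_support[OF assms x])
  obtain w where w: "w \<in> R" "w \<noteq> v" by (rule third_vertex[OF R(4)])
  obtain u where u: "u \<in> R" "u \<noteq> v" "u \<noteq> w" by (rule third_vertex[OF R(4)])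
  have "{w, u} \<in> edges" using simplex_edge[OF R(1) w(1) u(1)] u(3) by blast
  then show ?thesis using that[of "{w, u}"] w u R by (auto simp: edges_in_def)
qed

lemma star_in_eqD:
  assumes "S \<in> supports" "v \<in> S" "3 \<le> card S" "star_in v S \<subseteq> star_in u S'"
  shows "u = v"
proof (rule ccontr)
  assume "u \<noteq> v"
  then obtain e where "e \<in> star_in v S" "u \<notin> e" by (rule star_avoids[OF assms(1-3)])
  then show False using assms(4) by (auto simp: star_in_def)
qed

lemma edges_in_not_sub_star:
  assumes "S \<in> supports" "3 \<le> card S"
  shows "\<not> edges_in S \<subseteq> star_in v S'"
proof
  assume *: "edges_in S \<subseteq> star_in v S'"
  obtain e where "e \<in> edges_in S" "v \<notin> e" by (rule edges_in_avoids[OF assms])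
  then show False using * by (auto simp: star_in_def)
qed

lemma star_in_subset_edges_in_iff:
  assumes "S \<in> simplices \<F>" "v \<in> S" "2 \<le> card S"
  shows "star_in v S \<subseteq> edges_in S' \<longleftrightarrow> S \<subseteq> S'"
proof
  assume *: "star_in v S \<subseteq> edges_in S'"
  have ex: "w \<in> S'" if "w \<in> S" "w \<noteq> v" for w
    using * that by (auto simp: star_in_simplex[OF assms(1,2)] edges_in_def)
  have "S \<noteq> {v}" using assms(3) by auto
  then obtain w where w: "w \<in> S" "w \<noteq> v" using assms(2) by blast
  then have "{v, w} \<in> star_in v S" by (auto simp: star_in_simplex[OF assms(1,2)])
  then have "v \<in> S'" using * by (auto simp: edges_in_def)
  then show "S \<subseteq> S'" using ex by blast
qed (auto simp: star_in_def edges_in_def)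

lemma star_in_sub_edges_in: "star_in v S \<subseteq> edges_in S"
  by (auto simp: star_in_def edges_in_def)

lemma edges_in_eqD:
  assumes "S \<in> simplices \<F>" "2 \<le> card S" "edges_in S \<subseteq> edges_in S'"
  shows "S \<subseteq> S'"
proof -
  have "S \<noteq> {}" using assms(2) by auto
  then obtain v where v: "v \<in> S" by blast
  show ?thesis
    using star_in_subset_edges_in_iff[OF assms(1) v assms(2)] star_in_sub_edges_in assms(3) by blast
qed

lemma edges_in_small: "S \<in> simplices \<F> \<Longrightarrow> card S \<le> 1 \<Longrightarrow> edges_in S = {}"
  using card_edges_in_simplex[of S] by (simp add: binomial_eq_0)

lemma edges_in_pair: "S \<in> simplices \<F> \<Longrightarrow> card S = 2 \<Longrightarrow> edges_in S = {S}"
  using card_subset_eq[of S] stacked_complex_finite(4)[OF complex, of S]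
  by (auto simp: edges_in_simplex)

lemma edges_in_I: "edges_in I = edges"
  using edge_subset by (auto simp: edges_in_def)

lemma star_in_pair:
  assumes "S \<in> simplices \<F>" "card S = 2" "v \<in> S"
  shows "star_in v S = {S}"
proof -
  have "{S} = edges_in S" using edges_in_pair[OF assms(1,2)] by simp
  then show ?thesis using assms(3) by (auto simp: star_in_def edges_in_def)
qed

lemma face_dim_le_card: "finite A \<Longrightarrow> face_dim A \<le> int (card A) - 1"
  by (rule aff_dim_image_le_card)

lemma remove_vertex:
  assumes "S \<in> simplices \<F>" "v \<in> S" "2 \<le> card S"
  obtains R where "R \<in> simplices \<F>" "R \<subset> S" "v \<in> R" "card R = card S - 1"
proof -
  have "S \<noteq> {v}" using assms(3) by auto
  then obtain w where w: "w \<in> S" "w \<noteq> v" using assms(2) by blast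
  have "S - {w} \<in> simplices \<F>" by (rule simplices_mono[OF assms(1)]) blast
  moreover have "card (S - {w}) = card S - 1" using w(1) by (simp add: card_Diff_singleton)
  moreover have "S - {w} \<subset> S" "v \<in> S - {w}" using w assms(2) by blast+
  ultimately show ?thesis using that by blast
qed

text \<open>
  The chain of the vertex figures at \<open>v\<close> of smaller and smaller simplices bounds the dimension
  from below, and the number of edges at \<open>v\<close> bounds it from above.
\<close>

lemma face_dim_star_in:
  assumes "S \<in> simplices \<F>" "v \<in> S"
  shows "face_dim (star_in v S) = int (card S) - 2"
proof -
  have ge: "int k - 1 \<le> face_dim (star_in v S)"
    if "S \<in> simplices \<F>" "v \<in> S" "card S = Suc k" for k S
    using that
  proof (induction k arbitrary: S)
    case 0
    then show ?case by (simp add: aff_dim_geq)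
  next
    case (Suc k)
    obtain R where R: "R \<in> simplices \<F>" "R \<subset> S" "v \<in> R" "card R = card S - 1"
      by (rule remove_vertex[OF Suc.prems(1,2)]) (use Suc.prems(3) in simp)
    have "card (star_in v R) < card (star_in v S)"
      using card_star_in_simplex(2)[OF R(1,3)] card_star_in_simplex(2)[OF Suc.prems(1,2)] R(4) Suc.prems(3)
      by simp
    moreover have "star_in v R \<subseteq> star_in v S" using R(2) by (auto simp: star_in_def)
    ultimately have "star_in v R \<subset> star_in v S" by auto
    then have "face_dim (star_in v R) < face_dim (star_in v S)"
      using R Suc.prems by (intro face_dim_less star_in_support) auto
    moreover have "int k - 1 \<le> face_dim (star_in v R)"
      using Suc.IH[OF R(1,3)] R(4) Suc.prems(3) by simp
    ultimately show ?case by simp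
  qed
  have "card S \<noteq> 0" using assms stacked_complex_finite(4)[OF complex assms(1)] by auto
  then obtain k where k: "card S = Suc k" by (cases "card S") auto
  have "face_dim (star_in v S) \<le> int (card S - 1) - 1"
    using face_dim_le_card[OF card_star_in_simplex(1)[OF assms]] card_star_in_simplex(2)[OF assms] by simp
  then show ?thesis using ge[OF assms k] k by simp
qed

lemma face_dim_edges_in_triangle:
  assumes "S \<in> simplices \<F>" "card S = 3"
  shows "face_dim (edges_in S) = 2"
proof -
  have "S \<noteq> {}" using assms(2) by auto
  then obtain v where v: "v \<in> S" by blast
  have "star_in v S \<subset> edges_in S"
    using star_in_sub_edges_in edges_in_not_sub_star[of S v S] assms by auto
  then have "face_dim (star_in v S) < face_dim (edges_in S)"
    using assms v by (intro face_dim_less star_in_support edges_in_support) auto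
  moreover have "face_dim (edges_in S) \<le> 2"
    using face_dim_le_card[OF card_edges_in_simplex(1)[OF assms(1)]] card_edges_in_simplex(2)[OF assms(1)] assms(2)
    by (simp add: choose_two)
  ultimately show ?thesis using face_dim_star_in[OF assms(1) v] assms(2) by simp
qed

lemma face_dim_edges_in_facet_ge:
  assumes "T \<in> \<F>"
  shows "3 \<le> face_dim (edges_in T)"
proof -
  have T: "T \<in> simplices \<F>" "card T = 4" using facet_iff_card[OF complex] assms by blast+
  have "T \<noteq> {}" using T(2) by auto
  then obtain v where v: "v \<in> T" by blast
  obtain R where R: "R \<in> simplices \<F>" "R \<subset> T" "v \<in> R" "card R = card T - 1"
    by (rule remove_vertex[OF T(1) v]) (simp add: T(2))
  have "edges_in R \<subseteq> edges_in T" using R(2) by (auto simp: edges_in_def)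
  moreover have "\<not> edges_in T \<subseteq> edges_in R"
    using edges_in_eqD[OF T(1), of R] R(2) T(2) by auto
  ultimately have "face_dim (edges_in R) < face_dim (edges_in T)"
    using R T by (intro face_dim_less edges_in_support) auto
  then show ?thesis using face_dim_edges_in_triangle[OF R(1)] R(4) T(2) by simp
qed

lemma face_dim_star_in_I_ge:
  assumes "v \<in> I"
  shows "3 \<le> face_dim (star_in v I)"
proof -
  obtain T where T: "T \<in> \<F>" "v \<in> T" by (rule facet_containing_vertex[OF assms])
  have T': "T \<in> simplices \<F>" "card T = 4" using facet_iff_card[OF complex] T(1) by blast+
  obtain w where w: "w \<notin> T" "{v, w} \<in> edges" by (rule edge_leaving_facet[OF T])
  have "{v, w} \<in> star_in v I" using w(2) edge_subset by (auto simp: star_in_def)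
  moreover have "{v, w} \<notin> star_in v T" using w(1) by (auto simp: star_in_def)
  moreover have "star_in v T \<subseteq> star_in v I"
    using support_subset[of T] T'(1) by (auto simp: star_in_def)
  ultimately have "star_in v T \<subset> star_in v I" by blast
  then have "face_dim (star_in v T) < face_dim (star_in v I)"
    using T T' assms by (intro face_dim_less star_in_support) auto
  then show ?thesis using face_dim_star_in[OF T'(1) T(2)] T'(2) by simp
qed

lemma edges_in_facet_psubset:
  assumes "T \<in> \<F>"
  shows "edges_in T \<subset> edges_in I"
proof -
  have "T \<noteq> {}" using stacked_complex_facet(1)[OF complex assms] by auto
  then obtain v where v: "v \<in> T" by blast
  obtain w where "w \<notin> T" "{v, w} \<in> edges" by (rule edge_leaving_facet[OF assms v])
  then have "{v, w} \<in> edges_in I" "{v, w} \<notin> edges_in T"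
    using edges_in_I by (auto simp: edges_in_def)
  moreover have "edges_in T \<subseteq> edges_in I" using edges_in_I by (auto simp: edges_in_def)
  ultimately show ?thesis by blast
qed

lemma face_dim_edges_in_I: "face_dim (edges_in I) = 4"
proof -
  obtain T where T: "T \<in> \<F>" using facet_containing_vertex[of 0] by auto
  have "face_dim (edges_in T) < face_dim (edges_in I)"
    using edges_in_facet_psubset[OF T] simplices_facet[OF T]
    by (intro face_dim_less edges_in_support) auto
  moreover have "face_dim (edges_in I) \<le> 4"
    using aff_dim_le_DIM[of "edge_point ` edges_in I"] by simp
  ultimately show ?thesis using face_dim_edges_in_facet_ge[OF T] by simp
qed

lemma face_dim_edges_in_facet:
  assumes "T \<in> \<F>"
  shows "face_dim (edges_in T) = 3"
proof -
  have "face_dim (edges_in T) < face_dim (edges_in I)"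
    using edges_in_facet_psubset[OF assms] simplices_facet[OF assms]
    by (intro face_dim_less edges_in_support) auto
  then show ?thesis using face_dim_edges_in_facet_ge[OF assms] face_dim_edges_in_I by simp
qed

lemma face_dim_star_in_I:
  assumes "v \<in> I"
  shows "face_dim (star_in v I) = 3"
proof -
  have "star_in v I \<subset> edges_in I"
    using star_in_sub_edges_in edges_in_not_sub_star[of I v I] by auto
  then have "face_dim (star_in v I) < face_dim (edges_in I)"
    using assms by (intro face_dim_less edges_in_support star_in_support) auto
  then show ?thesis using face_dim_star_in_I_ge[OF assms] face_dim_edges_in_I by simp
qed

definition faces_of_dim :: "nat \<Rightarrow> nat set set set" where
  "faces_of_dim k = {A \<in> face_supports edge_point edges. face_dim A = int k}"

abbreviation triangles :: "nat set set" where
  "triangles \<equiv> {S \<in> simplices \<F>. card S = 3}"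

text \<open>
  The faces of \<open>D\<close> by dimension: the vertices are the edges of \<open>Q\<close>, the edges are the angles of
  triangles of \<open>Q\<close>, the 2-faces are the truncated triangles and the vertex figures of the facets,
  and the facets are the truncated facets and the vertex figures.
\<close>

lemma face_cases:
  assumes "A \<in> face_supports edge_point edges"
  obtains "face_dim A = - 1"
  | e where "face_dim A = 0" "e \<in> edges" "A = {e}"
  | v S where "face_dim A = 1" "S \<in> triangles" "v \<in> S" "A = star_in v S"
  | S where "face_dim A = 2" "S \<in> triangles" "A = edges_in S"
  | v T where "face_dim A = 2" "T \<in> \<F>" "v \<in> T" "A = star_in v T"
  | T where "face_dim A = 3" "T \<in> \<F>" "A = edges_in T"
  | v where "face_dim A = 3" "v \<in> I" "A = star_in v I"
  | "face_dim A = 4"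
proof -
  have sing: "face_dim {e} = 0" for e by simp
  consider "A = edges_in I" | S where "S \<in> simplices \<F>" "A = edges_in S"
    | v where "v \<in> I" "A = star_in v I" | v S where "S \<in> simplices \<F>" "v \<in> S" "A = star_in v S"
    using assms unfolding face_supports_D by blast
  then show ?thesis
  proof cases
    case 1
    then show ?thesis using face_dim_edges_in_I that(8) by simp
  next
    case (2 S)
    have "card S \<le> 4" by (rule stacked_complex_finite(6)[OF complex 2(1)])
    then consider "card S \<le> 1" | "card S = 2" | "card S = 3" | "card S = 4" by linarith
    then show ?thesis
    proof cases
      case 1
      then show ?thesis using edges_in_small[OF 2(1)] 2(2) that(1) by simp
    next
      case c: 2
      have "S \<in> edges" using 2(1) c by (simp add: edges_def)
      then show ?thesis using edges_in_pair[OF 2(1) c] 2(2) sing that(2) by simp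
    next
      case 3
      then show ?thesis using face_dim_edges_in_triangle[OF 2(1)] 2 that(4)[of S] by simp
    next
      case 4
      then have "S \<in> \<F>" using facet_iff_card[OF complex] 2(1) by blast
      then show ?thesis using face_dim_edges_in_facet 2(2) that(6) by simp
    qed
  next
    case (3 v)
    then show ?thesis using face_dim_star_in_I that(7) by simp
  next
    case s: (4 v S)
    have dim: "face_dim A = int (card S) - 2" unfolding s(3) by (rule face_dim_star_in[OF s(1,2)])
    have "card S \<noteq> 0" using s(1,2) stacked_complex_finite(4)[OF complex s(1)] by auto
    moreover have "card S \<le> 4" by (rule stacked_complex_finite(6)[OF complex s(1)])
    ultimately consider "card S = 1" | "card S = 2" | "card S = 3" | "card S = 4" by linarith
    then show ?thesis
    proof cases
      case 1
      then show ?thesis using dim that(1) by simp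
    next
      case 2
      then have "S \<in> edges" "A = {S}"
        using s star_in_pair[OF s(1) 2 s(2)] by (simp_all add: edges_def)
      then show ?thesis using dim 2 that(2) by simp
    next
      case 3
      then show ?thesis using dim s that(3)[of S v] by simp
    next
      case 4
      then have "S \<in> \<F>" using facet_iff_card[OF complex] s(1) by blast
      then show ?thesis using dim 4 s that(5)[of S v] by simp
    qed
  qed
qed

lemma faces_of_dim_0: "faces_of_dim 0 = (\<lambda>e. {e}) ` edges"
proof (intro subset_antisym subsetI)
  fix A assume "A \<in> faces_of_dim 0"
  then have A: "A \<in> face_supports edge_point edges" "face_dim A = 0" by (simp_all add: faces_of_dim_def)
  show "A \<in> (\<lambda>e. {e}) ` edges"
    using A(1) by (cases rule: face_cases) (use A(2) in auto)
next
  fix A assume "A \<in> (\<lambda>e. {e}) ` edges"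
  then obtain e where e: "e \<in> edges" "A = {e}" by blast
  then have S: "e \<in> simplices \<F>" "card e = 2" by (simp_all add: edges_def)
  then have "A \<in> face_supports edge_point edges"
    using edges_in_support[of e] edges_in_pair[OF S] e(2) by simp
  then show "A \<in> faces_of_dim 0" using e(2) by (simp add: faces_of_dim_def)
qed

lemma faces_of_dim_1: "faces_of_dim 1 = (\<lambda>(S, v). star_in v S) ` (SIGMA S:triangles. S)"
proof (intro subset_antisym subsetI)
  fix A assume "A \<in> faces_of_dim 1"
  then have A: "A \<in> face_supports edge_point edges" "face_dim A = 1" by (simp_all add: faces_of_dim_def)
  show "A \<in> (\<lambda>(S, v). star_in v S) ` (SIGMA S:triangles. S)"
    using A(1)
  proof (cases rule: face_cases)
    case (3 v S)
    then show ?thesis by (intro image_eqI[of _ _ "(S, v)"]) auto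
  qed (use A(2) in auto)
next
  fix A assume "A \<in> (\<lambda>(S, v). star_in v S) ` (SIGMA S:triangles. S)"
  then obtain S v where S: "S \<in> simplices \<F>" "card S = 3" "v \<in> S" "A = star_in v S" by auto
  then show "A \<in> faces_of_dim 1"
    using star_in_support[of S v] face_dim_star_in[OF S(1,3)] by (simp add: faces_of_dim_def)
qed

lemma faces_of_dim_2:
  "faces_of_dim 2 = edges_in ` triangles \<union> (\<lambda>(T, v). star_in v T) ` (SIGMA T:\<F>. T)"
proof (intro subset_antisym subsetI)
  fix A assume "A \<in> faces_of_dim 2"
  then have A: "A \<in> face_supports edge_point edges" "face_dim A = 2" by (simp_all add: faces_of_dim_def)
  show "A \<in> edges_in ` triangles \<union> (\<lambda>(T, v). star_in v T) ` (SIGMA T:\<F>. T)"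
    using A(1)
  proof (cases rule: face_cases)
    case (5 v S)
    then have "A \<in> (\<lambda>(T, v). star_in v T) ` (SIGMA T:\<F>. T)"
      by (intro image_eqI[of _ _ "(S, v)"]) auto
    then show ?thesis by blast
  qed (use A(2) in auto)
next
  fix A assume "A \<in> edges_in ` triangles \<union> (\<lambda>(T, v). star_in v T) ` (SIGMA T:\<F>. T)"
  then consider S where "S \<in> simplices \<F>" "card S = 3" "A = edges_in S"
    | T v where "T \<in> \<F>" "v \<in> T" "A = star_in v T" by auto
  then show "A \<in> faces_of_dim 2"
  proof cases
    case 1
    then show ?thesis
      using edges_in_support[of S] face_dim_edges_in_triangle[OF 1(1,2)] by (simp add: faces_of_dim_def)
  next
    case 2
    have T: "T \<in> simplices \<F>" "card T = 4" using facet_iff_card[OF complex] 2(1) by blast+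
    then show ?thesis
      using star_in_support[of T v] face_dim_star_in[OF T(1) 2(2)] 2 by (simp add: faces_of_dim_def)
  qed
qed

lemma faces_of_dim_3: "faces_of_dim 3 = edges_in ` \<F> \<union> (\<lambda>v. star_in v I) ` I"
proof (intro subset_antisym subsetI)
  fix A assume "A \<in> faces_of_dim 3"
  then have A: "A \<in> face_supports edge_point edges" "face_dim A = 3" by (simp_all add: faces_of_dim_def)
  show "A \<in> edges_in ` \<F> \<union> (\<lambda>v. star_in v I) ` I"
    using A(1) by (cases rule: face_cases) (use A(2) in auto)
next
  fix A assume "A \<in> edges_in ` \<F> \<union> (\<lambda>v. star_in v I) ` I"
  then consider T where "T \<in> \<F>" "A = edges_in T" | v where "v \<in> I" "A = star_in v I" by blast
  then show "A \<in> faces_of_dim 3"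
  proof cases
    case 1
    then show ?thesis
      using edges_in_support[of T] simplices_facet[OF 1(1)] face_dim_edges_in_facet[OF 1(1)]
      by (simp add: faces_of_dim_def)
  next
    case 2
    then show ?thesis
      using star_in_support[of I v] face_dim_star_in_I[OF 2(1)] by (simp add: faces_of_dim_def)
  qed
qed

lemma faces_D: "{F. F face_of D} = (\<lambda>A. convex hull (edge_point ` A)) ` face_supports edge_point edges"
  unfolding D_eq_hull_edge_points by (rule faces_of_convex_hull[OF finite_edges])

lemma aff_dim_D: "aff_dim D = 4"
  using face_dim_edges_in_I by (simp add: D_eq_hull_edge_points aff_dim_convex_hull edges_in_I)

lemma faces_D_of_dim:
  "{F. F face_of D \<and> aff_dim F = int k} = (\<lambda>A. convex hull (edge_point ` A)) ` faces_of_dim k"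
proof -
  have "{F. F face_of D \<and> aff_dim F = int k} = {F. F face_of D} \<inter> {F. aff_dim F = int k}" by blast
  also have "\<dots> = (\<lambda>A. convex hull (edge_point ` A)) ` faces_of_dim k"
    unfolding faces_D faces_of_dim_def by (auto simp: aff_dim_convex_hull)
  finally show ?thesis .
qed

lemma inj_on_hull_faces:
  "inj_on (\<lambda>A. convex hull (edge_point ` A)) (faces_of_dim k)"
  by (rule inj_on_subset[OF inj_on_face_hull[OF finite_edges]]) (auto simp: faces_of_dim_def)

lemma face_number_D: "face_number k D = card (faces_of_dim k)"
  unfolding face_number_def faces_D_of_dim by (rule card_image[OF inj_on_hull_faces])

lemma card_edges: "card edges = 10 + 4 * n"
  using stacked_complex_counts(1)[OF complex] by (simp add: simplex_count_def edges_def)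

lemma card_triangles: "card triangles = 10 + 6 * n"
  using stacked_complex_counts(2)[OF complex] by (simp add: simplex_count_def)

lemma finite_triangles: "finite triangles"
  using stacked_complex_finite(2)[OF complex] by simp

lemma face_number_0_D: "face_number 0 D = 10 + 4 * n"
  using card_edges by (simp add: face_number_D faces_of_dim_0 card_image)

lemma inj_on_star:
  assumes "\<And>S. S \<in> \<S> \<Longrightarrow> S \<in> simplices \<F> \<and> 3 \<le> card S"
  shows "inj_on (\<lambda>(S, v). star_in v S) (SIGMA S:\<S>. S)"
proof (rule inj_onI, clarify)
  fix S v S' v' assume *: "S \<in> \<S>" "v \<in> S" "S' \<in> \<S>" "v' \<in> S'" "star_in v S = star_in v' S'"
  have S: "S \<in> simplices \<F>" "3 \<le> card S" "S' \<in> simplices \<F>" "3 \<le> card S'"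
    using assms *(1,3) by blast+
  have "v' = v" using star_in_eqD[OF insertI2[OF S(1)] *(2) S(2)] *(5) by blast
  moreover have "S \<subseteq> S'"
    using star_in_subset_edges_in_iff[OF S(1) *(2)] star_in_sub_edges_in[of v' S'] S(2) *(5) by simp
  moreover have "S' \<subseteq> S"
    using star_in_subset_edges_in_iff[OF S(3) *(4)] star_in_sub_edges_in[of v S] S(4) *(5) by simp
  ultimately show "S = S' \<and> v = v'" by blast
qed

lemma inj_on_edges_in:
  assumes "\<And>S. S \<in> \<S> \<Longrightarrow> S \<in> simplices \<F> \<and> 2 \<le> card S"
  shows "inj_on edges_in \<S>"
proof (rule inj_onI)
  fix S S' assume "S \<in> \<S>" "S' \<in> \<S>" "edges_in S = edges_in S'"
  then show "S = S'" using edges_in_eqD[of S S'] edges_in_eqD[of S' S] assms by auto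
qed

lemma facet_large: "T \<in> \<F> \<Longrightarrow> T \<in> simplices \<F> \<and> 3 \<le> card T"
  using simplices_facet[of T] stacked_complex_facet(1)[OF complex, of T] by simp

lemma face_number_1_D: "face_number 1 D = 30 + 18 * n"
proof -
  have "card (faces_of_dim 1) = card (SIGMA S:triangles. S)"
    unfolding faces_of_dim_1 by (rule card_image[OF inj_on_star]) auto
  also have "\<dots> = (\<Sum>S\<in>triangles. card S)"
    using finite_triangles stacked_complex_finite(4)[OF complex] by (intro card_SigmaI) auto
  also have "\<dots> = 3 * card triangles" by simp
  finally show ?thesis using card_triangles by (simp add: face_number_D)
qed

lemma face_number_2_D: "face_number 2 D = 30 + 18 * n"
proof -
  let ?A = "edges_in ` triangles" and ?B = "(\<lambda>(T, v). star_in v T) ` (SIGMA T:\<F>. T)"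
  have fin: "finite (SIGMA T:\<F>. T)"
    using stacked_complex_finite(1,3)[OF complex] by (intro finite_SigmaI) auto
  have "card ?A = card triangles" by (rule card_image[OF inj_on_edges_in]) auto
  moreover have "card ?B = 4 * card \<F>"
  proof -
    have "card ?B = card (SIGMA T:\<F>. T)"
      by (rule card_image[OF inj_on_star]) (rule facet_large)
    also have "\<dots> = (\<Sum>T\<in>\<F>. card T)"
      using stacked_complex_finite(1,3)[OF complex] by (intro card_SigmaI) auto
    also have "\<dots> = 4 * card \<F>" using stacked_complex_facet(1)[OF complex] by simp
    finally show ?thesis .
  qed
  moreover have "?A \<inter> ?B = {}"
  proof -
    have "edges_in S \<noteq> star_in v T" if "S \<in> triangles" for S v T
      using edges_in_not_sub_star[of S v T] that by auto
    then show ?thesis by (auto simp: disjoint_iff)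
  qed
  ultimately have "card (faces_of_dim 2) = card triangles + 4 * card \<F>"
    unfolding faces_of_dim_2 using finite_triangles fin by (subst card_Un_disjoint) auto
  then show ?thesis
    using card_triangles stacked_complex_counts(3)[OF complex] by (simp add: face_number_D)
qed

lemma card_I_ge: "3 \<le> card I" by simp

lemma inj_on_star_I: "inj_on (\<lambda>v. star_in v I) I"
proof (rule inj_onI)
  fix u v assume uv: "u \<in> I" "v \<in> I" "star_in u I = star_in v I"
  show "u = v" using star_in_eqD[OF insertI1 uv(1) card_I_ge, of v I] uv(3) by simp
qed

lemma facets_D_disjoint: "edges_in ` \<F> \<inter> (\<lambda>v. star_in v I) ` I = {}"
proof -
  have "edges_in T \<noteq> star_in v I" if "T \<in> \<F>" for T v
    using edges_in_not_sub_star[of T v I] facet_large[OF that] by auto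
  then show ?thesis by blast
qed

lemma inj_on_edges_in_facets: "inj_on edges_in \<F>"
  by (rule inj_on_edges_in) (use facet_large in force)

lemma face_number_3_D: "face_number 3 D = 10 + 4 * n"
proof -
  have "card (faces_of_dim 3) = card (edges_in ` \<F>) + card ((\<lambda>v. star_in v I) ` I)"
    unfolding faces_of_dim_3 using facets_D_disjoint stacked_complex_finite(1)[OF complex]
    by (intro card_Un_disjoint) auto
  also have "\<dots> = card \<F> + card I"
    by (simp only: card_image[OF inj_on_edges_in_facets] card_image[OF inj_on_star_I])
  finally show ?thesis using stacked_complex_counts(3)[OF complex] by (simp add: face_number_D)
qed

end

section \<open>The truncated polytope is 2-simplicial and 2-simple\<close>

context truncation_system
begin

lemma inj_on_edge_point: "inj_on edge_point edges"
proof (rule inj_onI)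
  fix e e' assume e: "e \<in> edges" "e' \<in> edges" "edge_point e = edge_point e'"
  have "{e} \<in> face_supports edge_point edges"
    using e(1) faces_of_dim_0 by (auto simp: faces_of_dim_def)
  then have "edge_point e' \<in> convex hull (edge_point ` {e}) \<longleftrightarrow> e' \<in> {e}"
    by (rule point_in_face_iff[OF finite_edges _ e(2)])
  then show "e = e'" using e(3) by simp
qed

lemma extreme_point_D_iff: "x extreme_point_of D \<longleftrightarrow> x \<in> edge_point ` edges"
proof
  assume "x extreme_point_of D"
  then show "x \<in> edge_point ` edges"
    unfolding D_eq_hull_edge_points by (rule extreme_point_of_convex_hull)
next
  assume "x \<in> edge_point ` edges"
  then obtain e where e: "e \<in> edges" "x = edge_point e" by blast
  then have "{e} \<in> faces_of_dim 0" by (simp add: faces_of_dim_0)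
  then have "convex hull (edge_point ` {e}) \<in> {F. F face_of D}"
    unfolding faces_D faces_of_dim_def by (intro imageI) simp
  then show "x extreme_point_of D" using e(2) by (simp add: face_of_singleton)
qed

text \<open>
  Each edge is counted at both of its ends.
\<close>

lemma sum_card_stars: "(\<Sum>v\<in>I. card (star_in v I)) = 2 * card edges"
proof -
  have "card (star_in v I) = (\<Sum>e\<in>edges. if v \<in> e then 1 else 0)" for v
  proof -
    have "star_in v I = {e \<in> edges. v \<in> e}" using edge_subset by (auto simp: star_in_def)
    then show ?thesis using finite_edges by (simp add: sum.If_cases Int_def)
  qed
  then have "(\<Sum>v\<in>I. card (star_in v I)) = (\<Sum>v\<in>I. \<Sum>e\<in>edges. if v \<in> e then 1 else 0)" by simp
  also have "\<dots> = (\<Sum>e\<in>edges. \<Sum>v\<in>I. if v \<in> e then 1 else 0)" by (rule sum.swap)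
  also have "\<dots> = (\<Sum>e\<in>edges. 2)"
  proof (rule sum.cong[OF refl])
    fix e assume e: "e \<in> edges"
    have "{v \<in> I. v \<in> e} = e" using edge_subset[OF e] by blast
    then show "(\<Sum>v\<in>I. if v \<in> e then 1 else 0) = (2::nat)"
      using e by (simp add: sum.If_cases Int_def edges_def)
  qed
  finally show ?thesis by simp
qed

text \<open>
  A truncated facet of \<open>Q\<close> is an octahedron and has six vertices; the vertex figures contribute the
  degrees of the vertices of \<open>Q\<close>.
\<close>

lemma vertex_face_number_D: "vertex_face_number 3 D = 50 + 26 * n"
proof -
  let ?f = "\<lambda>(A, e). (edge_point e, convex hull (edge_point ` A))"
  let ?S = "SIGMA A:faces_of_dim 3. A"
  have supp: "A \<in> face_supports edge_point edges" "A \<subseteq> edges" if "A \<in> faces_of_dim 3" for A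
    using that face_supports_subset[of A edge_point edges] by (auto simp: faces_of_dim_def)
  have inj: "inj_on ?f ?S"
  proof (rule inj_onI, clarify)
    fix A e A' e' assume *: "A \<in> faces_of_dim 3" "e \<in> A" "A' \<in> faces_of_dim 3" "e' \<in> A'"
      "edge_point e = edge_point e'" "convex hull (edge_point ` A) = convex hull (edge_point ` A')"
    have "A = A'" using inj_onD[OF inj_on_hull_faces *(6) *(1,3)] .
    moreover have "e = e'"
      using inj_onD[OF inj_on_edge_point *(5)] supp(2)[OF *(1)] supp(2)[OF *(3)] *(2,4) by blast
    ultimately show "A = A' \<and> e = e'" by blast
  qed
  have im: "{(v, F). v extreme_point_of D \<and> F face_of D \<and> aff_dim F = int 3 \<and> v \<in> F} = ?f ` ?S"
  proof (intro subset_antisym subsetI)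
    fix z assume "z \<in> {(v, F). v extreme_point_of D \<and> F face_of D \<and> aff_dim F = int 3 \<and> v \<in> F}"
    then obtain v F where z: "z = (v, F)" "v extreme_point_of D" "F face_of D" "aff_dim F = int 3" "v \<in> F"
      by blast
    obtain e where e: "e \<in> edges" "v = edge_point e" using z(2) extreme_point_D_iff by blast
    have "F \<in> {F. F face_of D \<and> aff_dim F = int 3}" using z(3,4) by blast
    then obtain A where A: "A \<in> faces_of_dim 3" "F = convex hull (edge_point ` A)"
      unfolding faces_D_of_dim by blast
    have "e \<in> A"
      using point_in_face_iff[OF finite_edges supp(1)[OF A(1)] e(1)] z(5) A(2) e(2) by simp
    then show "z \<in> ?f ` ?S" using z(1) A e(2) by (intro image_eqI[of _ _ "(A, e)"]) auto
  next
    fix z assume "z \<in> ?f ` ?S"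
    then obtain A e where z: "A \<in> faces_of_dim 3" "e \<in> A"
      "z = (edge_point e, convex hull (edge_point ` A))" by auto
    have "convex hull (edge_point ` A) \<in> {F. F face_of D \<and> aff_dim F = int 3}"
      unfolding faces_D_of_dim using z(1) by (rule imageI)
    moreover have "edge_point e extreme_point_of D"
      using z(2) supp(2)[OF z(1)] extreme_point_D_iff by blast
    moreover have "edge_point e \<in> convex hull (edge_point ` A)" using z(2) by (intro hull_inc imageI)
    ultimately show "z \<in> {(v, F). v extreme_point_of D \<and> F face_of D \<and> aff_dim F = int 3 \<and> v \<in> F}"
      using z(3) by blast
  qed
  have fin: "finite (faces_of_dim 3)"
    unfolding faces_of_dim_3 using stacked_complex_finite(1)[OF complex] by simp
  have "vertex_face_number 3 D = card ?S"
    unfolding vertex_face_number_def im by (rule card_image[OF inj])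
  also have "\<dots> = (\<Sum>A\<in>faces_of_dim 3. card A)"
    using fin supp(2) finite_edges by (intro card_SigmaI) (auto intro: finite_subset)
  also have "\<dots> = (\<Sum>A\<in>edges_in ` \<F>. card A) + (\<Sum>A\<in>(\<lambda>v. star_in v I) ` I. card A)"
    unfolding faces_of_dim_3 using facets_D_disjoint stacked_complex_finite(1)[OF complex]
    by (intro sum.union_disjoint) auto
  also have "\<dots> = (\<Sum>T\<in>\<F>. card (edges_in T)) + (\<Sum>v\<in>I. card (star_in v I))"
    by (simp only: sum.reindex[OF inj_on_edges_in_facets] sum.reindex[OF inj_on_star_I] comp_def)
  also have "(\<Sum>T\<in>\<F>. card (edges_in T)) = (\<Sum>T\<in>\<F>. 6)"
  proof (rule sum.cong[OF refl])
    fix T assume T: "T \<in> \<F>"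
    show "card (edges_in T) = 6"
      using card_edges_in_simplex(2)[OF simplices_facet[OF T]] stacked_complex_facet(1)[OF complex T]
      by (simp add: choose_two)
  qed
  finally show ?thesis
    using sum_card_stars card_edges stacked_complex_counts(3)[OF complex] by simp
qed

lemma d_polytope_D: "d_polytope 4 D"
proof -
  have "polytope D"
    unfolding D_eq_hull_edge_points by (rule polytope_convex_hull) (simp add: finite_edges)
  then show ?thesis using aff_dim_D by (simp add: d_polytope_def)
qed

lemma rational_D: "rational_polytope D"
  unfolding rational_polytope_def
  using extreme_point_D_iff edge_point_rational by (auto simp: rational_point_def)

text \<open>
  Both kinds of 2-faces have three vertices.
\<close>

lemma simplicial_D: "simplicial 2 D"
  unfolding simplicial_def
proof (intro allI impI)
  fix F assume "F face_of D" "aff_dim F = int 2"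
  then have "F \<in> {F. F face_of D \<and> aff_dim F = int 2}" by blast
  then obtain A where A: "A \<in> faces_of_dim 2" "F = convex hull (edge_point ` A)"
    unfolding faces_D_of_dim by blast
  have cardA: "finite A \<and> card A = 3"
    using A(1) unfolding faces_of_dim_2
  proof
    assume "A \<in> edges_in ` triangles"
    then obtain S where "S \<in> simplices \<F>" "card S = 3" "A = edges_in S" by blast
    then show ?thesis using card_edges_in_simplex[of S] by (simp add: choose_two)
  next
    assume "A \<in> (\<lambda>(T, v). star_in v T) ` (SIGMA T:\<F>. T)"
    then obtain T v where "T \<in> \<F>" "v \<in> T" "A = star_in v T" by auto
    then show ?thesis
      using card_star_in_simplex[OF simplices_facet, of T v] stacked_complex_facet(1)[OF complex, of T]
      by simp
  qed
  have dim: "aff_dim (edge_point ` A) = 2" using A(1) by (simp add: faces_of_dim_def)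
  have "card (edge_point ` A) \<le> 3" using cardA card_image_le[of A edge_point] by simp
  moreover have "2 \<le> int (card (edge_point ` A)) - 1"
    using dim aff_dim_le_card[of "edge_point ` A"] cardA by simp
  ultimately have card3: "card (edge_point ` A) = 3" by simp
  then have "\<not> affine_dependent (edge_point ` A)"
    using affine_independent_iff_card[of "edge_point ` A"] cardA dim by simp
  then show "int 2 simplex F"
    unfolding simplex_def using card3 A(2) by (intro exI[of _ "edge_point ` A"]) simp
qed

text \<open>
  An edge of \<open>D\<close> is the vertex figure at \<open>v\<close> of a triangle \<open>S\<close> of \<open>Q\<close>. The facets through it are
  the vertex figure at \<open>v\<close> and the truncations of the two facets of \<open>Q\<close> that contain \<open>S\<close>.
\<close>

lemma simple_D: "simple 2 D"
  unfolding simple_def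
proof (intro allI impI)
  fix F assume "F face_of D" "aff_dim F = aff_dim D - int 2 - 1"
  then have "F \<in> {F. F face_of D \<and> aff_dim F = int 1}" by (simp add: aff_dim_D)
  then obtain A where A: "A \<in> faces_of_dim 1" "F = convex hull (edge_point ` A)"
    unfolding faces_D_of_dim by blast
  then obtain S v where S: "S \<in> simplices \<F>" "card S = 3" "v \<in> S" "A = star_in v S"
    unfolding faces_of_dim_1 by auto
  have A': "A \<in> face_supports edge_point edges" using A(1) by (simp add: faces_of_dim_def)
  have v: "v \<in> I" using support_subset[of S] S(1,3) by auto
  let ?hull = "\<lambda>B. convex hull (edge_point ` B)"
  have facets: "{G. G facet_of D} = ?hull ` faces_of_dim 3"
  proof -
    have "{G. G facet_of D} = {G. G face_of D \<and> aff_dim G = int 3}"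
      unfolding facet_of_def by (auto simp: aff_dim_D)
    then show ?thesis by (simp only: faces_D_of_dim)
  qed
  have sub: "F \<subseteq> ?hull B \<longleftrightarrow> A \<subseteq> B" if "B \<in> faces_of_dim 3" for B
    unfolding A(2) by (rule face_subset_iff[OF finite_edges A']) (use that in \<open>simp add: faces_of_dim_def\<close>)
  have "{G. G facet_of D \<and> F \<subseteq> G} = {G. G facet_of D} \<inter> {G. F \<subseteq> G}" by blast
  also have "\<dots> = ?hull ` {B \<in> faces_of_dim 3. A \<subseteq> B}"
    unfolding facets using sub by blast
  finally have "card {G. G facet_of D \<and> F \<subseteq> G} = card (?hull ` {B \<in> faces_of_dim 3. A \<subseteq> B})"
    by (rule arg_cong)
  also have "\<dots> = card {B \<in> faces_of_dim 3. A \<subseteq> B}"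
    by (rule card_image[OF inj_on_subset[OF inj_on_hull_faces]]) blast
  also have "{B \<in> faces_of_dim 3. A \<subseteq> B} = insert (star_in v I) (edges_in ` {T \<in> \<F>. S \<subseteq> T})"
  proof -
    have sub_facet: "A \<subseteq> edges_in T \<longleftrightarrow> S \<subseteq> T" for T
      unfolding S(4) by (rule star_in_subset_edges_in_iff[OF S(1,3)]) (simp add: S(2))
    have sub_star: "A \<subseteq> star_in u I \<longleftrightarrow> u = v" for u
    proof
      assume "A \<subseteq> star_in u I"
      then show "u = v"
        using star_in_eqD[OF insertI2[OF S(1)] S(3)] S(2,4) by simp
    next
      assume "u = v"
      then show "A \<subseteq> star_in u I"
        using edge_subset by (auto simp: S(4) star_in_def)
    qed
    have "{B \<in> faces_of_dim 3. A \<subseteq> B} =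
        edges_in ` {T \<in> \<F>. A \<subseteq> edges_in T} \<union> (\<lambda>u. star_in u I) ` {u \<in> I. A \<subseteq> star_in u I}"
      unfolding faces_of_dim_3 by blast
    moreover have "{u \<in> I. u = v} = {v}" using v by blast
    ultimately show ?thesis by (simp only: sub_facet sub_star) simp
  qed
  also have "card \<dots> = Suc (card (edges_in ` {T \<in> \<F>. S \<subseteq> T}))"
    using facets_D_disjoint v stacked_complex_finite(1)[OF complex] by (intro card_insert_disjoint) auto
  also have "card (edges_in ` {T \<in> \<F>. S \<subseteq> T}) = card {T \<in> \<F>. S \<subseteq> T}"
    by (rule card_image[OF inj_on_subset[OF inj_on_edges_in_facets]]) blast
  also have "\<dots> = 2" by (rule stacked_complex_two_facets[OF complex S(1,2)])
  finally show "card {G. G facet_of D \<and> F \<subseteq> G} = 2 + 1" by simp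
qed

lemma rational_2s2s_D: "rational_2s2s_4_polytope D"
  by (simp add: rational_2s2s_4_polytope_def d_polytope_D rational_D simplicial_D simple_D)

section \<open>Truncating the vertices of the realized polytope\<close>

definition H :: "real ^ 4 \<Rightarrow> (real ^ 4) set" where
  "H x = {y. 0 \<le> a (the_inv_into I q x) y}"

lemma H_vertex: "i \<in> I \<Longrightarrow> H (q i) = {y. 0 \<le> a i y}"
  by (simp add: H_def the_inv_into_f_f[OF inj_on_q])

lemma extreme_point_Q_iff: "x extreme_point_of Q \<longleftrightarrow> x \<in> q ` I"
proof
  assume "x extreme_point_of Q"
  then show "x \<in> q ` I" unfolding Q_def by (rule extreme_point_of_convex_hull)
next
  assume "x \<in> q ` I"
  then obtain i where i: "i \<in> I" "x = q i" by blast
  have "{i} \<in> supports" using stacked_complex_vertex[OF complex, of i] i(1) by simp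
  then have "convex hull (q ` {i}) face_of Q"
    unfolding Q_def by (rule face_supports_imp_face[OF finite_lessThan support_faces])
  then show "x extreme_point_of Q" using i(2) by (simp add: face_of_singleton)
qed

lemma D1_eq_D: "D1 Q H = D"
proof -
  have "{v. v extreme_point_of Q} = q ` I" using extreme_point_Q_iff by blast
  then have "D1 Q H = Q \<inter> (\<Inter>i\<in>I. H (q i))" by (simp add: D1_def)
  also have "\<dots> = D" using H_vertex by (auto simp: D_def)
  finally show ?thesis .
qed

lemma d_polytope_Q: "d_polytope 4 Q"
proof -
  have "polytope Q" unfolding Q_def by (rule polytope_convex_hull) simp
  then show ?thesis
    using realizes_aff_dim[OF complex realizes] by (simp add: d_polytope_def Q_def aff_dim_convex_hull)
qed

lemma truncates_vertex_Q:
  assumes "i \<in> I"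
  shows "truncates_vertex Q (q i) (H (q i))"
proof -
  have i: "i < n + 5" using assms by simp
  obtain c b where cb: "a i = (\<lambda>x. c \<bullet> x + b)"
    using a_affine[OF i] by (auto simp: affine_functional_def)
  define k where "k = (if i = 0 then 1 else 0 :: nat)"
  have k: "k < n + 5" "k \<noteq> i" by (auto simp: k_def)
  have "c \<noteq> 0"
    using a_self[OF i] a_pos[OF i k(1)] k(2) by (auto simp: cb)
  have H: "H (q i) = {x. (- c) \<bullet> x \<le> b}" unfolding H_vertex[OF assms] cb by auto
  have "closed_halfspace (H (q i))"
    unfolding closed_halfspace_def H using \<open>c \<noteq> 0\<close> by (intro exI[of _ "- c"] exI[of _ b]) simp
  moreover have "q i \<notin> H (q i)" using H_vertex[OF assms] a_self[OF i] by simp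
  moreover have "w \<in> interior (H (q i))" if "w extreme_point_of Q" "w \<noteq> q i" for w
  proof -
    have "w \<in> q ` I" using that(1) extreme_point_Q_iff by blast
    then obtain l where l: "l < n + 5" "w = q l" by auto
    then have "0 < a i w" using a_pos[OF i l(1)] that(2) by auto
    then have "(- c) \<bullet> w < b" by (simp add: cb)
    moreover have "interior (H (q i)) = {x. (- c) \<bullet> x < b}"
      unfolding H using \<open>c \<noteq> 0\<close> by (intro interior_halfspace_le) simp
    ultimately show ?thesis by simp
  qed
  ultimately show ?thesis by (simp add: truncates_vertex_def)
qed

lemma truncatable_Q: "truncatable_via Q H"
  unfolding truncatable_via_def
proof (intro conjI allI impI)
  fix v assume "v extreme_point_of Q"
  then have "v \<in> q ` I" by (simp only: extreme_point_Q_iff)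
  then obtain i where "i \<in> I" "v = q i" by (elim imageE)
  then show "truncates_vertex Q v (H v)" using truncates_vertex_Q by (simp only:)
next
  fix e assume "e edge_of Q"
  then have e: "e face_of Q" "aff_dim e = 1" by (auto simp: edge_of_def)
  then have "e \<in> (\<lambda>S. convex hull (q ` S)) ` face_supports q I"
    using faces_of_convex_hull[OF finite_lessThan, of q "n + 5"] unfolding Q_def
    by (metis mem_Collect_eq)
  then obtain S where S: "S \<in> supports" "e = convex hull (q ` S)"
    unfolding supports_eq by (elim imageE)
  have "S \<noteq> I"
    using e(2) realizes_aff_dim[OF complex realizes] by (auto simp: S(2) aff_dim_convex_hull)
  then have S': "S \<in> simplices \<F>" using S(1) by simp
  then have "card S = 2"
    using realizes_aff_dim_simplex[OF realizes S'] e(2) by (simp add: S(2) aff_dim_convex_hull)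
  then obtain i k where ik: "S = {i, k}" "i \<noteq> k" by (auto simp: card_2_iff)
  have edge: "{i, k} \<in> simplices \<F>" using S' ik(1) by simp
  have slice: "e \<inter> D1 Q H = {edge_point {i, k}}"
    unfolding D1_eq_D S(2) ik(1) by (rule edge_slice[OF ik(2) edge])
  obtain s t where st: "edge_point {i, k} = s *\<^sub>R q i + t *\<^sub>R q k" "s + t = 1" "0 < s" "0 < t"
    "s = 1 / (1 + a k (q i))" "t = a k (q i) / (1 + a k (q i))"
    by (rule edge_point_combination[OF ik(2) edge])
  have "q i \<noteq> q k" using inj_onD[OF inj_on_q] ik(2) edge_vertices[OF edge] by auto
  then have "edge_point {i, k} \<in> open_segment (q i) (q k)"
    unfolding in_segment using st by (intro conjI exI[of _ t]) auto
  moreover have "e = closed_segment (q i) (q k)" by (simp add: S(2) ik(1) segment_convex_hull)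
  ultimately have "edge_point {i, k} \<in> rel_interior e"
    using \<open>q i \<noteq> q k\<close> by (simp add: rel_interior_closed_segment)
  then show "\<exists>x\<in>rel_interior e. e \<inter> D1 Q H = {x}" using slice by blast
qed

theorem truncated_polytope:
  "d_polytope 4 Q" "truncatable_via Q H" "rational_2s2s_4_polytope (D1 Q H)"
  "face_number 0 (D1 Q H) = 10 + 4 * n" "face_number 1 (D1 Q H) = 30 + 18 * n"
  "face_number 2 (D1 Q H) = 30 + 18 * n" "face_number 3 (D1 Q H) = 10 + 4 * n"
  "vertex_face_number 3 (D1 Q H) = 50 + 26 * n"
  using d_polytope_Q truncatable_Q rational_2s2s_D face_number_0_D face_number_1_D
    face_number_2_D face_number_3_D vertex_face_number_D by (simp_all add: D1_eq_D)

end

section \<open>Infinitely many combinatorial types\<close>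

text \<open>
  Among the faces, the vertices are characterized by inclusion alone, and so the number of vertices
  is a combinatorial invariant.
\<close>

lemma vertex_face_iff_minimal:
  assumes "polytope P" "F face_of P"
  shows "aff_dim F = 0 \<longleftrightarrow> F \<noteq> {} \<and> (\<forall>G. G face_of P \<longrightarrow> G \<subseteq> F \<longrightarrow> G = {} \<or> G = F)"
proof
  assume "aff_dim F = 0"
  then obtain x where "F = {x}" by (auto simp: aff_dim_eq_0)
  then show "F \<noteq> {} \<and> (\<forall>G. G face_of P \<longrightarrow> G \<subseteq> F \<longrightarrow> G = {} \<or> G = F)" by blast
next
  assume *: "F \<noteq> {} \<and> (\<forall>G. G face_of P \<longrightarrow> G \<subseteq> F \<longrightarrow> G = {} \<or> G = F)"
  have "polytope F" by (rule face_of_polytope_polytope[OF assms])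
  then have "compact F" "convex F" by (simp_all add: polytope_imp_compact polytope_imp_convex)
  then obtain x where x: "x extreme_point_of F" using extreme_point_exists_convex[of F] * by blast
  then have "{x} face_of F" by (simp add: face_of_singleton)
  then have "{x} face_of P" using assms(2) by (rule face_of_trans)
  moreover have "{x} \<subseteq> F" using x by (simp add: extreme_point_of_def)
  ultimately have "F = {x}" using * by blast
  then show "aff_dim F = 0" by simp
qed

lemma face_number_0_invariant:
  assumes "polytope P" "polytope P'" "combinatorially_equivalent P P'"
  shows "face_number 0 P = face_number 0 P'"
proof -
  obtain \<phi> where bij: "bij_betw \<phi> {F. F face_of P} {G. G face_of P'}"
    and mono: "\<And>F F'. F face_of P \<Longrightarrow> F' face_of P \<Longrightarrow> F \<subseteq> F' \<longleftrightarrow> \<phi> F \<subseteq> \<phi> F'"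
    using assms(3) unfolding combinatorially_equivalent_def by blast
  have im: "\<phi> F face_of P'" if "F face_of P" for F using bij_betwE[OF bij] that by blast
  have surj: "\<exists>F. F face_of P \<and> G = \<phi> F" if "G face_of P'" for G
    using bij_betw_imp_surj_on[OF bij] that by blast
  have inj: "\<phi> F = \<phi> F' \<longleftrightarrow> F = F'" if "F face_of P" "F' face_of P" for F F'
    using mono[OF that] mono[OF that(2,1)] by blast
  have empty: "\<phi> {} = {}"
  proof -
    obtain F where F: "F face_of P" "{} = \<phi> F" using surj[of "{}"] by auto
    have "\<phi> {} \<subseteq> \<phi> F" using mono[of "{}" F] F(1) by simp
    then show ?thesis using F(2) by simp
  qed
  have vertex: "aff_dim (\<phi> F) = 0 \<longleftrightarrow> aff_dim F = 0" if F: "F face_of P" for F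
  proof -
    have "\<phi> F \<noteq> {} \<longleftrightarrow> F \<noteq> {}" using inj[OF F empty_face_of] empty by simp
    moreover have "(\<forall>G. G face_of P' \<longrightarrow> G \<subseteq> \<phi> F \<longrightarrow> G = {} \<or> G = \<phi> F) \<longleftrightarrow>
        (\<forall>F'. F' face_of P \<longrightarrow> \<phi> F' \<subseteq> \<phi> F \<longrightarrow> \<phi> F' = {} \<or> \<phi> F' = \<phi> F)"
      using surj im by metis
    moreover have "(\<phi> F' \<subseteq> \<phi> F \<longrightarrow> \<phi> F' = {} \<or> \<phi> F' = \<phi> F) \<longleftrightarrow> (F' \<subseteq> F \<longrightarrow> F' = {} \<or> F' = F)"
      if "F' face_of P" for F'
      using mono[OF that F] inj[OF that F] inj[OF that empty_face_of] empty by simp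
    ultimately show ?thesis
      unfolding vertex_face_iff_minimal[OF assms(1) F] vertex_face_iff_minimal[OF assms(2) im[OF F]]
      by auto
  qed
  have "bij_betw \<phi> {F. F face_of P \<and> aff_dim F = int 0} {G. G face_of P' \<and> aff_dim G = int 0}"
    unfolding bij_betw_def
  proof
    show "inj_on \<phi> {F. F face_of P \<and> aff_dim F = int 0}"
      using inj by (intro inj_onI) blast
    show "\<phi> ` {F. F face_of P \<and> aff_dim F = int 0} = {G. G face_of P' \<and> aff_dim G = int 0}"
    proof (intro subset_antisym subsetI)
      fix G assume "G \<in> \<phi> ` {F. F face_of P \<and> aff_dim F = int 0}"
      then show "G \<in> {G. G face_of P' \<and> aff_dim G = int 0}" using im vertex by auto
    next
      fix G assume G: "G \<in> {G. G face_of P' \<and> aff_dim G = int 0}"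
      then obtain F where "F face_of P" "G = \<phi> F" using surj by blast
      then show "G \<in> \<phi> ` {F. F face_of P \<and> aff_dim F = int 0}" using G vertex by auto
    qed
  qed
  then show ?thesis unfolding face_number_def by (rule bij_betw_same_card)
qed

lemma combinatorially_equivalent_refl: "combinatorially_equivalent P P"
  unfolding combinatorially_equivalent_def by (intro exI[of _ id]) auto

text \<open>
  The numbers of vertices \<open>10 + 4 * n\<close> distinguish the truncated polytopes for different \<open>n\<close>.
\<close>

lemma infinitely_many_combinatorial_types:
  "infinite ({D :: (real ^ 4) set. rational_2s2s_4_polytope D} //
             {(D, D'). combinatorially_equivalent D D'})"
proof -
  let ?X = "{D :: (real ^ 4) set. rational_2s2s_4_polytope D}"
  let ?r = "{(D, D' :: (real ^ 4) set). combinatorially_equivalent D D'}"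
  have "\<exists>D :: (real ^ 4) set. rational_2s2s_4_polytope D \<and> face_number 0 D = 10 + 4 * n" for n
  proof -
    obtain \<F> where "stacked_complex n \<F>" using exists_stacked_complex by blast
    then obtain q a where "truncation_system n \<F> q a" using exists_truncation_system by blast
    then interpret truncation_system n \<F> q a .
    show ?thesis using rational_2s2s_D face_number_0_D by blast
  qed
  then have "\<forall>n. \<exists>D :: (real ^ 4) set. rational_2s2s_4_polytope D \<and> face_number 0 D = 10 + 4 * n" ..
  then obtain D :: "nat \<Rightarrow> (real ^ 4) set"
    where D: "\<forall>n. rational_2s2s_4_polytope (D n) \<and> face_number 0 (D n) = 10 + 4 * n"
    by (rule choice[THEN exE])
  have poly: "polytope (D n)" for n
    using D by (simp add: rational_2s2s_4_polytope_def d_polytope_def)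
  have "inj (\<lambda>n. ?r `` {D n})"
  proof (rule injI)
    fix m n assume "?r `` {D m} = ?r `` {D n}"
    moreover have "D n \<in> ?r `` {D n}" by (simp add: combinatorially_equivalent_refl)
    ultimately have "D n \<in> ?r `` {D m}" by simp
    then have "combinatorially_equivalent (D m) (D n)" by simp
    then have "face_number 0 (D m) = face_number 0 (D n)"
      by (rule face_number_0_invariant[OF poly poly])
    then show "m = n" using D by simp
  qed
  then have "infinite (range (\<lambda>n. ?r `` {D n}))" by (simp add: finite_image_iff)
  moreover have "range (\<lambda>n. ?r `` {D n}) \<subseteq> ?X // ?r"
  proof (rule image_subsetI)
    fix n
    show "?r `` {D n} \<in> ?X // ?r" by (rule quotientI) (simp add: D)
  qed
  ultimately show ?thesis using finite_subset by blast
qed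

theorem corollary3p6:
  "(\<forall>(n::nat) (P :: (real ^ 4) set). stacked_polytope 4 n P \<longrightarrow>
      (\<exists>(Q :: (real ^ 4) set) H.
          d_polytope 4 Q \<and> combinatorially_equivalent P Q \<and>
          truncatable_via Q H \<and>
          rational_2s2s_4_polytope (D1 Q H) \<and>
          face_number 0 (D1 Q H) = 10 + 4 * n \<and>
          face_number 1 (D1 Q H) = 30 + 18 * n \<and>
          face_number 2 (D1 Q H) = 30 + 18 * n \<and>
          face_number 3 (D1 Q H) = 10 + 4 * n \<and>
          vertex_face_number 3 (D1 Q H) = 50 + 26 * n)) \<and>
   infinite ({D :: (real ^ 4) set. rational_2s2s_4_polytope D} //
             {(D, D'). combinatorially_equivalent D D'})"
proof (intro conjI allI impI)
  fix n and P :: "(real ^ 4) set" assume "stacked_polytope 4 n P"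
  then obtain \<F> p where p: "stacked_complex n \<F>" "realizes n \<F> p" "P = convex hull (p ` {..<n + 5})"
    using stacked_polytope_realizes by blast
  obtain q a where "truncation_system n \<F> q a" using exists_truncation_system[OF p(1)] by blast
  then interpret truncation_system n \<F> q a .
  have "face_supports p I = face_supports q I"
    using p(2) realizes by (simp add: realizes_def)
  then have "combinatorially_equivalent P Q"
    unfolding p(3) Q_def by (rule combinatorially_equivalent_same_supports[OF finite_lessThan])
  then show "\<exists>(Q :: (real ^ 4) set) H.
          d_polytope 4 Q \<and> combinatorially_equivalent P Q \<and>
          truncatable_via Q H \<and>
          rational_2s2s_4_polytope (D1 Q H) \<and>
          face_number 0 (D1 Q H) = 10 + 4 * n \<and>
          face_number 1 (D1 Q H) = 30 + 18 * n \<and>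
          face_number 2 (D1 Q H) = 30 + 18 * n \<and>
          face_number 3 (D1 Q H) = 10 + 4 * n \<and>
          vertex_face_number 3 (D1 Q H) = 50 + 26 * n"
    using truncated_polytope by (intro exI[of _ Q] exI[of _ H]) simp
qed (rule infinitely_many_combinatorial_types)

end
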